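(* Suppose a set of Verblunsky coefficients obeys $$\alpha_n=Cb^n+O((b\Delta)^n)$$ for some $C\in\mathbb{C}$, $C\ne0$, $b\in(0,1)$ and $\Delta\in(0,1)$. Then the number $J$ of Nevai-Totik points (counted with multiplicity) is finite, and for $n$ large, $\Phi_n(z)$ has $J$ zeros near these points. The other $n-J$ zeros can be written $\{z_j^{(n)}\}_{j=1}^{n-J}$, where $z_j^{(n)}=|z_j^{(n)}|e^{i\theta_j^{(n)}}$ with (for $n$ large) $$\theta_0^{(n)}\equiv0<\theta_1^{(n)}<\theta_2^{(n)}<\cdots<\theta_{n-J}^{(n)}<2\pi\equiv\theta_{n-J+1}^{(n)}.$$ Moreover, $$\sup_{j}\,\bigl|\,|z_j^{(n)}|-b\,\bigr|=O\left(\frac{\log n}{n}\right),$$ $$\sup_{j=0,\dots,n-J}\, n\left|\theta_{j+1}^{(n)}-\theta_j^{(n)}-\frac{2\pi}{n}\right|\to0,$$ and, uniformly in $j=1,\dots,n-J-1$, $$\frac{|z_{j+1}^{(n)}|}{|z_j^{(n)}|}=1+O\left(\frac{1}{n\log n}\right),$$ as $n\to\infty$.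
   Context: $\mathbb{D}=\{|z|<1\}$. For a probability measure $d\mu=w(\theta)\frac{d\theta}{2\pi}+d\mu_s$ on $\partial\mathbb{D}$ not supported on a finite set, $\Phi_n$ are the monic orthogonal polynomials and the Verblunsky coefficients are $\alpha_n=-\overline{\Phi_{n+1}(0)}\in\mathbb{D}$; with $P_n^*(z)=z^n\overline{P_n(1/\bar z)}$ one has $\Phi_{n+1}=z\Phi_n-\bar\alpha_n\Phi_n^*$, $\Phi_0=1$. The Szegő function is $D(z)=\exp\bigl(\int\frac{e^{i\theta}+z}{e^{i\theta}-z}\log w(\theta)\frac{d\theta}{4\pi}\bigr)$ for $z\in\mathbb{D}$; $D(z)^{-1}$ means $1/D(z)$. When $\lim|\alpha_n|^{1/n}=b<1$, $D^{-1}$ has an analytic continuation to $\{|z|<b^{-1}\}$. The Nevai-Totik points are the solutions $z$ of $\overline{D(1/\bar z)}^{-1}=0$ in $\{z: b<|z|<1\}$, with multiplicity the order of the zero of the analytic function $z\mapsto\overline{D(1/\bar z)}^{-1}$. "$\Phi_n$ has $J$ zeros near these points" means that for every sufficiently small $\delta>0$ and all $n$ large, the $\delta$-disk about each Nevai-Totik point contains exactly as many zeros of $\Phi_n$ (with multiplicity) as the multiplicity of that point. *)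

theory Defs
  imports
    "HOL-Complex_Analysis.Complex_Analysis"
    "HOL-Probability.Probability"
    "HOL-Computational_Algebra.Polynomial"
begin

text \<open>A measure on the unit circle is represented as a Borel measure on the complex plane that
  gives full mass to the circle.  The last clause says that it is not supported on a finite set.\<close>

definition nontrivial_circle_prob :: "complex measure \<Rightarrow> bool" where
  "nontrivial_circle_prob \<mu> \<longleftrightarrow>
     prob_space \<mu> \<and> sets \<mu> = sets borel \<and> emeasure \<mu> (sphere 0 1) = 1 \<and>
     (\<forall>F. finite F \<longrightarrow> emeasure \<mu> (UNIV - F) \<noteq> 0)"

text \<open>The measure \<open>d\<theta> / 2\<pi>\<close> on \<open>[0, 2\<pi>)\<close>.\<close>

definition angle_measure :: "real measure" where
  "angle_measure = uniform_measure lborel {0..<2 * pi}"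

text \<open>The Lebesgue decomposition \<open>d\<mu> = w(\<theta>) d\<theta>/2\<pi> + d\<mu>\<^sub>s\<close>; angles are carried to the circle
  by \<^const>\<open>cis\<close>.\<close>

definition circle_decomposition ::
  "complex measure \<Rightarrow> (real \<Rightarrow> real) \<Rightarrow> complex measure \<Rightarrow> bool" where
  "circle_decomposition \<mu> w \<mu>s \<longleftrightarrow>
     w \<in> borel_measurable borel \<and> (\<forall>\<theta>. 0 \<le> w \<theta>) \<and> sets \<mu>s = sets borel \<and>
     (\<exists>N\<in>sets borel. emeasure (distr angle_measure borel cis) N = 0 \<and> emeasure \<mu>s (UNIV - N) = 0) \<and>
     (\<forall>A\<in>sets borel. emeasure \<mu> A =
        emeasure (distr (density angle_measure (\<lambda>\<theta>. ennreal (w \<theta>))) borel cis) A + emeasure \<mu>s A)"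

definition monic_orthogonal :: "complex measure \<Rightarrow> nat \<Rightarrow> complex poly \<Rightarrow> bool" where
  "monic_orthogonal \<mu> n p \<longleftrightarrow> degree p = n \<and> lead_coeff p = 1 \<and>
     (\<forall>k<n. (\<integral>z. cnj (z ^ k) * poly p z \<partial>\<mu>) = 0)"

text \<open>Existence and uniqueness hold whenever \<^term>\<open>nontrivial_circle_prob \<mu>\<close>.\<close>

definition OPUC :: "complex measure \<Rightarrow> nat \<Rightarrow> complex poly" where
  "OPUC \<mu> n = (THE p. monic_orthogonal \<mu> n p)"

definition verblunsky :: "complex measure \<Rightarrow> nat \<Rightarrow> complex" where
  "verblunsky \<mu> n = - cnj (poly (OPUC \<mu> (Suc n)) 0)"

text \<open>This is meaningful when \<open>log w\<close> is integrable, which is the case as soon as the Verblunsky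
  coefficients are square summable.\<close>

definition szego_function :: "(real \<Rightarrow> real) \<Rightarrow> complex \<Rightarrow> complex" where
  "szego_function w z =
     exp (complex_of_real (1 / (4 * pi)) *
       (LINT \<theta>:{0..<2 * pi}|lborel. (cis \<theta> + z) / (cis \<theta> - z) * complex_of_real (ln (w \<theta>))))"

definition szego_inv_continuation ::
  "(real \<Rightarrow> real) \<Rightarrow> real \<Rightarrow> (complex \<Rightarrow> complex) \<Rightarrow> bool" where
  "szego_inv_continuation w b g \<longleftrightarrow>
     g holomorphic_on ball 0 (1 / b) \<and> (\<forall>z\<in>ball 0 1. g z = 1 / szego_function w z)"

lemma szego_inv_continuation_unique:
  assumes "0 < b" "b < 1" "szego_inv_continuation w b g" "szego_inv_continuation w b h"
    and "z \<in> ball 0 (1 / b)"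
  shows "g z = h z"
proof -
  have *: "ball 0 1 \<subseteq> ball (0::complex) (1 / b)"
    using assms(1,2) by (intro subset_ball) (simp add: field_simps)
  show ?thesis
    by (rule analytic_continuation_open[OF _ _ _ _ *, of g h])
       (use assms in \<open>auto simp: szego_inv_continuation_def\<close>)
qed

text \<open>The analytic continuation of \<open>1/D\<close> to the disk of radius \<open>1/b\<close>; by the lemma above its
  values there do not depend on the choice.\<close>

definition szego_inv :: "(real \<Rightarrow> real) \<Rightarrow> real \<Rightarrow> complex \<Rightarrow> complex" where
  "szego_inv w b = (SOME g. szego_inv_continuation w b g)"

definition szego_inv_reflected :: "(real \<Rightarrow> real) \<Rightarrow> real \<Rightarrow> complex \<Rightarrow> complex" where
  "szego_inv_reflected w b z = cnj (szego_inv w b (1 / cnj z))"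

definition nevai_totik_points :: "(real \<Rightarrow> real) \<Rightarrow> real \<Rightarrow> complex set" where
  "nevai_totik_points w b = {z. b < cmod z \<and> cmod z < 1 \<and> szego_inv_reflected w b z = 0}"

definition nevai_totik_mult :: "(real \<Rightarrow> real) \<Rightarrow> real \<Rightarrow> complex \<Rightarrow> nat" where
  "nevai_totik_mult w b p = nat (zorder (szego_inv_reflected w b) p)"

definition nevai_totik_number :: "(real \<Rightarrow> real) \<Rightarrow> real \<Rightarrow> nat" where
  "nevai_totik_number w b = (\<Sum>p\<in>nevai_totik_points w b. nevai_totik_mult w b p)"

end

theory Submission
  imports Defs "HOL-Real_Asymp.Real_Asymp" "HOL-Computational_Algebra.Fundamental_Theorem_Algebra"
begin

text \<open>Write \<open>\<Phi> n\<close> for the monic orthogonal polynomials, \<open>\<Phi>' n\<close> for the reversed ones and \<open>d\<close> for the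
  limit of \<open>\<Phi>' n\<close>. Summing the recursion with \<open>\<alpha> k = C * b ^ k + O((b * \<Delta>) ^ k)\<close> shows that, near the circle
  of radius \<open>b\<close>, the function \<open>(z - b) * \<Phi> n z\<close> equals \<open>z ^ n * H z - b ^ n * Q n z\<close>, where \<open>H\<close> is holomorphic
  and \<open>Q n\<close> converges exponentially fast to \<open>- cnj C * d\<close>, which has no zeros in the closed disk. In
  the coordinate \<open>z = b * exp u\<close> the zeros solve \<open>exp (n * u) * P u = Q n u\<close>. Even if \<open>P\<close> vanishes on the
  imaginary axis, solutions keep a distance of order \<open>ln n / n\<close> from its zeros, so there the logarithmic derivative of
  \<open>Q n / P\<close> is \<open>O(n / ln n)\<close>. Hence the solutions are simple and locally form a lattice with step
  \<open>2 * pi * \<i> / n\<close>, up to a relative error \<open>O(1 / ln n)\<close>. The factor \<open>z - b\<close> adds the solution \<open>u = 0\<close>, which accounts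
  for the two end points \<open>0\<close> and \<open>2 * pi\<close> of the list of arguments.

  For \<open>|z| > b\<close> the quotients \<open>\<Phi> n z / z ^ n\<close> converge to \<open>F z = cnj (d (1 / cnj z))\<close>, and Rouche's theorem gives
  the zeros near those of \<open>F\<close>. Finally \<open>F\<close> is a multiple of the reflection of \<open>1 / D\<close>: orthogonality shows that
  \<open>|d|\<^sup>2 d\<mu>\<close> has the moments of a multiple of arc length, so \<open>w = const / |d|\<^sup>2\<close>, and Schwarz's formula for
  the logarithm of \<open>d\<close> evaluates the integral defining \<open>D\<close>.\<close>

section \<open>Solutions of an exponential equation near the imaginary axis\<close>

text \<open>The scale \<open>ln n / n\<close> comes from a balance. At distance \<sigma> from its
  zeros \<open>P\<close> is at least of order \<open>\<sigma> ^ M\<close>, so at distance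
  \<open>ln n / n\<close> the equation asks of \<open>exp (n * Re u)\<close> only a power of n, and
  \<open>Re u\<close> is at most of order \<open>ln n / n\<close>. Much closer to a zero of
  \<open>P\<close> the left side would stay below the lower bound of \<open>Q n\<close>. The
  logarithmic derivative of \<open>P\<close> has the reciprocal size of this scale, hence relative
  size \<open>1 / ln n\<close> against n; one more division by n gives the
  \<open>1 / (n * ln n)\<close> in the ratio of consecutive moduli. The number n - J is not found by
  counting lattice points. Rouche's theorem counts the zeros near the Nevai-Totik points, no others
  survive outside the ring, and those in the ring are simple, so the degree leaves exactly n - J of
  them. The lattice argument only has to order them. The reflection formula for \<open>1 / D\<close>
  is needed solely to recognise the zeros of \<open>F\<close> and their orders as the Nevai-Totik
  points and multiplicities; the analysis of zeros itself runs on the recursion alone.\<close>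

text \<open>With the factorisation \<open>f w = (w - p) ^ n * g w\<close>, \<open>g\<close> free of
  zeros, the logarithmic derivative is \<open>n / (w - p)\<close> plus a bounded term; both
  estimates follow because \<sigma> does not exceed the distance to the zero \<open>p\<close>. The
  point \<open>q\<close> excludes \<open>f\<close> vanishing identically.\<close>

lemma zero_distance_bounds_local:
  fixes f :: "complex \<Rightarrow> complex"
  assumes "f holomorphic_on S" "open S" "connected S" "p \<in> S" "q \<in> S" "f q \<noteq> 0"
  shows "\<exists>e>0. \<exists>K>0. \<exists>M::nat. \<forall>u\<in>ball p e. \<forall>\<sigma>. 0 < \<sigma> \<longrightarrow> \<sigma> \<le> 1 \<longrightarrow> (\<forall>\<tau>\<in>S. f \<tau> = 0 \<longrightarrow> \<sigma> \<le> dist u \<tau>)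
           \<longrightarrow> \<sigma> ^ M \<le> K * cmod (f u) \<and> cmod (deriv f u) * \<sigma> \<le> K * cmod (f u)"
proof (cases "f p = 0")
  case False
  have "continuous_on S f" "continuous_on S (deriv f)"
    using assms by (auto intro!: holomorphic_on_imp_continuous_on holomorphic_deriv)
  then have "isCont f p" "isCont (deriv f) p"
    using assms by (auto simp: continuous_on_eq_continuous_at)
  then have "\<forall>\<^sub>F u in nhds p. dist (f u) (f p) < cmod (f p) / 2"
     "\<forall>\<^sub>F u in nhds p. dist (deriv f u) (deriv f p) < 1"
    using False by (auto simp only: isCont_def tendsto_at_iff_tendsto_nhds zero_less_norm_iff half_gt_zero_iff zero_less_one intro!: tendstoD)
  then have "\<forall>\<^sub>F u in nhds p. dist (f u) (f p) < cmod (f p) / 2 \<and> dist (deriv f u) (deriv f p) < 1"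
    by (rule eventually_conj)
  then obtain e where e: "e > 0" "\<And>u. dist u p < e \<Longrightarrow> dist (f u) (f p) < cmod (f p) / 2 \<and> dist (deriv f u) (deriv f p) < 1"
    by (auto simp: eventually_nhds_metric)
  define K where "K = 2 * (cmod (deriv f p) + 1) / cmod (f p)"
  have K: "K > 0" using False by (simp add: K_def add_nonneg_pos)
  have b: "cmod (f p) / 2 \<le> cmod (f u)" "cmod (deriv f u) \<le> cmod (deriv f p) + 1" if "u \<in> ball p e" for u
  proof -
    have "dist u p < e" using that by (simp add: dist_commute)
    note h = e(2)[OF this]
    have "cmod (f p) - cmod (f u) \<le> cmod (f u - f p)" by (metis norm_minus_commute norm_triangle_ineq2)
    with h show "cmod (f p) / 2 \<le> cmod (f u)" by (simp add: dist_norm)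
    have "cmod (deriv f u) - cmod (deriv f p) \<le> cmod (deriv f u - deriv f p)" by (rule norm_triangle_ineq2)
    with h show "cmod (deriv f u) \<le> cmod (deriv f p) + 1" by (simp add: dist_norm)
  qed
  \<comment> \<open>Away from zeros the exponent 0 serves. The summand \<open>2 / cmod (f p)\<close>
    covers the first estimate and \<open>K\<close> the second.\<close>
  have "\<sigma> ^ 0 \<le> (K + 2 / cmod (f p)) * cmod (f u) \<and> cmod (deriv f u) * \<sigma> \<le> (K + 2 / cmod (f p)) * cmod (f u)"
    if "u \<in> ball p e" "0 < \<sigma>" "\<sigma> \<le> 1" for u and \<sigma> :: real
  proof
    note bb = b[OF that(1)]
    have 1: "1 \<le> 2 / cmod (f p) * cmod (f u)" using bb(1) False by (simp add: field_simps)
    have 2: "0 \<le> K * cmod (f u)" using K by simp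
    show "\<sigma> ^ 0 \<le> (K + 2 / cmod (f p)) * cmod (f u)" using 1 2 by (simp add: algebra_simps)
    have "cmod (deriv f u) * \<sigma> \<le> cmod (deriv f u) * 1" using that by (intro mult_left_mono) auto
    also have "\<dots> \<le> (cmod (deriv f p) + 1) * 1" using bb(2) by simp
    also have "\<dots> \<le> (cmod (deriv f p) + 1) * (2 / cmod (f p) * cmod (f u))" by (intro mult_left_mono 1) auto
    also have "\<dots> = K * cmod (f u)" by (simp add: K_def)
    finally show "cmod (deriv f u) * \<sigma> \<le> (K + 2 / cmod (f p)) * cmod (f u)" using 1 by (simp add: algebra_simps)
  qed
  moreover have "K + 2 / cmod (f p) > 0" using K False by (simp add: add_pos_pos)
  ultimately show ?thesis using e(1) by blast
next
  case True
  have "\<not> f constant_on S" using True assms(4-6) unfolding constant_on_def by metis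
  then obtain g r n where g: "0 < n" "0 < r" "ball p r \<subseteq> S" "g holomorphic_on ball p r"
     "\<And>w. w \<in> ball p r \<Longrightarrow> f w = (w - p) ^ n * g w" "\<And>w. w \<in> ball p r \<Longrightarrow> g w \<noteq> 0"
    using holomorphic_factor_zero_nonconstant[OF assms(1-4) True] by metis
  have sub: "cball p (r/2) \<subseteq> ball p r" using g(2) by auto
  have cg: "continuous_on (cball p (r/2)) g" "continuous_on (cball p (r/2)) (deriv g)"
    by (rule holomorphic_on_imp_continuous_on holomorphic_on_subset[OF _ sub] holomorphic_deriv g(4) open_ball)+
  have ne: "cball p (r/2) \<noteq> {}" using g(2) by auto
  have "continuous_on (cball p (r/2)) (\<lambda>z. cmod (g z))" using cg(1) by (rule continuous_on_norm)
  from continuous_attains_inf[OF compact_cball ne this]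
  obtain z0 where z0: "z0 \<in> cball p (r/2)" "\<And>z. z \<in> cball p (r/2) \<Longrightarrow> cmod (g z0) \<le> cmod (g z)" by auto
  define m where "m = cmod (g z0)"
  have m: "m > 0" using g(6) z0(1) sub unfolding m_def by auto
  have "compact (deriv g ` cball p (r/2))" by (intro compact_continuous_image cg) auto
  then obtain B where B: "B > 0" "\<And>z. z \<in> cball p (r/2) \<Longrightarrow> cmod (deriv g z) \<le> B"
    by (auto dest!: compact_imp_bounded simp: bounded_pos)
  \<comment> \<open>The first two summands bound the contributions of the power and of
    \<open>g\<close> to the logarithmic derivative; \<open>1 / m\<close> serves the lower bound for
    \<open>f\<close>.\<close>
  define K where "K = real n + r * B / m + 1 / m"
  have K: "K > 0" using g B m by (simp add: K_def add_pos_pos)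
  have "\<sigma> ^ n \<le> K * cmod (f u) \<and> cmod (deriv f u) * \<sigma> \<le> K * cmod (f u)"
    if u: "u \<in> ball p (r/2)" and s: "0 < \<sigma>" "\<sigma> \<le> 1" "\<forall>\<tau>\<in>S. f \<tau> = 0 \<longrightarrow> \<sigma> \<le> dist u \<tau>" for u \<sigma>
  proof
    have ur: "u \<in> ball p r" "u \<in> cball p (r/2)" using u g(2) by auto
    have sd: "\<sigma> \<le> cmod (u - p)" using s(3) True assms(4) by (auto simp: dist_norm)
    have gm: "m \<le> cmod (g u)" using z0(2) ur m_def by auto
    have fu: "cmod (f u) = cmod (u - p) ^ n * cmod (g u)" using g(5)[OF ur(1)] by (simp add: norm_mult norm_power)
    have "\<sigma> ^ n * m \<le> cmod (u - p) ^ n * cmod (g u)" using sd s gm m by (intro mult_mono power_mono) auto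
    then have "\<sigma> ^ n \<le> (1 / m) * cmod (f u)" using m fu by (simp add: field_simps)
    also have "\<dots> \<le> K * cmod (f u)" using g B m by (intro mult_right_mono) (auto simp: K_def)
    finally show "\<sigma> ^ n \<le> K * cmod (f u)" .
    have "((\<lambda>w. (w - p) ^ n) has_field_derivative of_nat n * (u - p) ^ (n - 1)) (at u)"
      by (auto intro!: derivative_eq_intros)
    from DERIV_mult'[OF this holomorphic_derivI[OF g(4) open_ball ur(1)]]
    have "(f has_field_derivative (u - p) ^ n * deriv g u + of_nat n * (u - p) ^ (n - 1) * g u) (at u)"
      by (rule has_field_derivative_transform_within_open[OF _ open_ball ur(1)]) (simp add: g(5))
    then have df: "deriv f u = (u - p) ^ n * deriv g u + of_nat n * (u - p) ^ (n - 1) * g u"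
      by (rule DERIV_imp_deriv)
    have "(u - p) * deriv f u = of_nat n * f u + (u - p) ^ n * ((u - p) * deriv g u)"
    proof -
      have "(u - p) * (u - p) ^ (n - 1) = (u - p) ^ n" using g(1) by (cases n) auto
      then show ?thesis unfolding df g(5)[OF ur(1)] by (simp add: algebra_simps flip: \<open>(u - p) * (u - p) ^ (n - 1) = (u - p) ^ n\<close>)
    qed
    then have "cmod (u - p) * cmod (deriv f u) = cmod (of_nat n * f u + (u - p) ^ n * ((u - p) * deriv g u))"
      by (simp only: norm_mult[symmetric])
    also have "\<dots> \<le> real n * cmod (f u) + cmod (u - p) ^ n * (cmod (u - p) * cmod (deriv g u))"
      by (rule order_trans[OF norm_triangle_ineq]) (simp add: norm_mult norm_power)
    also have "\<dots> \<le> real n * cmod (f u) + cmod (u - p) ^ n * (r * B)"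
      using B ur g(2) by (intro add_left_mono mult_left_mono mult_mono) (auto simp: dist_norm norm_minus_commute)
    also have "cmod (u - p) ^ n * (r * B) \<le> (r * B / m) * cmod (f u)"
    proof -
      have "cmod (u - p) ^ n * (r * B) * m \<le> cmod (u - p) ^ n * (r * B) * cmod (g u)"
        using B g gm by (intro mult_left_mono) auto
      then show ?thesis using m fu by (simp add: field_simps)
    qed
    also have "real n * cmod (f u) + (r * B / m) * cmod (f u) \<le> K * cmod (f u)"
      using m by (simp add: K_def algebra_simps)
    finally have "cmod (u - p) * cmod (deriv f u) \<le> K * cmod (f u)" by simp
    moreover have "cmod (deriv f u) * \<sigma> \<le> cmod (deriv f u) * cmod (u - p)" using sd by (intro mult_left_mono) auto
    ultimately show "cmod (deriv f u) * \<sigma> \<le> K * cmod (f u)" by (simp add: mult.commute)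
  qed
  then show ?thesis using K g(2) by (intro exI[of _ "r/2"] conjI exI[of _ K] exI[of _ n]) auto
qed

text \<open>A finite subcover suffices: the sums of the local constants and of the local exponents
  dominate each single one, where \<sigma> \<le> 1 allows the exponent to grow.\<close>

lemma zero_distance_bounds:
  fixes f :: "complex \<Rightarrow> complex"
  assumes "f holomorphic_on S" "open S" "connected S" "compact X" "X \<subseteq> S" "q \<in> S" "f q \<noteq> 0"
  obtains K :: real and M :: nat where "K > 0"
    "\<And>u \<sigma>. \<lbrakk>u \<in> X; 0 < \<sigma>; \<sigma> \<le> 1; \<And>\<tau>. \<lbrakk>\<tau> \<in> S; f \<tau> = 0\<rbrakk> \<Longrightarrow> \<sigma> \<le> dist u \<tau>\<rbrakk>
       \<Longrightarrow> \<sigma> ^ M \<le> K * cmod (f u) \<and> cmod (deriv f u) * \<sigma> \<le> K * cmod (f u)"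
proof -
  define good where "good p e K M \<longleftrightarrow> e > 0 \<and> K > 0 \<and> (\<forall>u\<in>ball p e. \<forall>\<sigma>. 0 < \<sigma> \<longrightarrow> \<sigma> \<le> 1 \<longrightarrow>
    (\<forall>\<tau>\<in>S. f \<tau> = 0 \<longrightarrow> \<sigma> \<le> dist u \<tau>) \<longrightarrow>
    \<sigma> ^ M \<le> K * cmod (f u) \<and> cmod (deriv f u) * \<sigma> \<le> K * cmod (f u))" for p e K and M :: nat
  have "\<forall>p\<in>X. \<exists>e K M. good p e K M"
    unfolding good_def using zero_distance_bounds_local[OF assms(1-3) _ assms(6,7)] assms(5) by (simp add: subset_iff)
  then obtain e K M where good: "\<And>p. p \<in> X \<Longrightarrow> good p (e p) (K p) (M p)" by metis
  have e: "e p > 0" if "p \<in> X" for p using good[OF that] unfolding good_def by blast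
  have KM: "K p > 0" "\<And>u \<sigma>. \<lbrakk>u \<in> ball p (e p); 0 < \<sigma>; \<sigma> \<le> 1; \<forall>\<tau>\<in>S. f \<tau> = 0 \<longrightarrow> \<sigma> \<le> dist u \<tau>\<rbrakk>
       \<Longrightarrow> \<sigma> ^ M p \<le> K p * cmod (f u) \<and> cmod (deriv f u) * \<sigma> \<le> K p * cmod (f u)" if "p \<in> X" for p
    using good[OF that] unfolding good_def by blast+
  have "X \<subseteq> (\<Union>p\<in>X. ball p (e p))" using e by fastforce
  from compactE_image[OF assms(4) _ this] obtain T where T: "T \<subseteq> X" "finite T" "X \<subseteq> (\<Union>p\<in>T. ball p (e p))"
    by auto
  show thesis
  proof (rule that[of "1 + (\<Sum>p\<in>T. K p)" "\<Sum>p\<in>T. M p"])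
    show "0 < 1 + (\<Sum>p\<in>T. K p)" using KM(1) T(1) by (intro add_pos_nonneg sum_nonneg) (auto intro: less_imp_le)
  next
    fix u \<sigma> assume u: "u \<in> X" and s: "0 < \<sigma>" "\<sigma> \<le> 1" "\<And>\<tau>. \<lbrakk>\<tau> \<in> S; f \<tau> = 0\<rbrakk> \<Longrightarrow> \<sigma> \<le> dist u \<tau>"
    obtain p where p: "p \<in> T" "u \<in> ball p (e p)" using T(3) u by auto
    have h: "\<sigma> ^ M p \<le> K p * cmod (f u) \<and> cmod (deriv f u) * \<sigma> \<le> K p * cmod (f u)"
      using KM(2)[OF _ p(2) s(1,2)] s(3) p T(1) by blast
    have "K p \<le> (\<Sum>p\<in>T. K p)" using p T KM(1) by (intro member_le_sum) (auto intro: less_imp_le)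
    then have Kp: "K p * cmod (f u) \<le> (1 + (\<Sum>p\<in>T. K p)) * cmod (f u)" by (intro mult_right_mono) auto
    have "M p \<le> (\<Sum>p\<in>T. M p)" using p T by (intro member_le_sum) auto
    then have "\<sigma> ^ (\<Sum>p\<in>T. M p) \<le> \<sigma> ^ M p" using s by (intro power_decreasing) auto
    then show "\<sigma> ^ (\<Sum>p\<in>T. M p) \<le> (1 + (\<Sum>p\<in>T. K p)) * cmod (f u) \<and> cmod (deriv f u) * \<sigma> \<le> (1 + (\<Sum>p\<in>T. K p)) * cmod (f u)"
      using h Kp by linarith
  qed
qed


section \<open>The exponential equation: location of its solutions and local logarithms\<close>

text \<open>The hypotheses hold in the strip of half width \<eta>, solutions are sought in the
  smaller one of half width \<eta>', so that compact parts of the latter lie in the domain. Zeros of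
  \<open>P\<close> on the imaginary axis itself are allowed; this is the difficult case.\<close>

locale exponential_lattice =
  fixes \<eta> \<eta>' :: real and P :: "complex \<Rightarrow> complex" and Q :: "nat \<Rightarrow> complex \<Rightarrow> complex" and q0 q1 q2 :: real
  assumes eta: "0 < \<eta>'" "\<eta>' < \<eta>"
    and holP: "P holomorphic_on {u. \<bar>Re u\<bar> < \<eta>}"
    and holQ: "\<And>n. Q n holomorphic_on {u. \<bar>Re u\<bar> < \<eta>}"
    and P0: "P 0 \<noteq> 0"
    and zeros_P: "\<And>u. \<lbrakk>\<bar>Re u\<bar> < \<eta>; P u = 0\<rbrakk> \<Longrightarrow> Re u = 0"
    and q0: "0 < q0"
    and bounds_Q: "\<forall>\<^sub>F n in sequentially. \<forall>u. \<bar>Re u\<bar> < \<eta> \<longrightarrow>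
      q0 \<le> cmod (Q n u) \<and> cmod (Q n u) \<le> q1 \<and> cmod (deriv (Q n) u) \<le> q2"
begin

definition Z :: "nat \<Rightarrow> complex set" where
  "Z n = {u. \<bar>Re u\<bar> < \<eta>' \<and> exp (of_nat n * u) * P u = Q n u}"

text \<open>One turn occupies the heights 0 to 2 pi. Solutions are studied at heights -5 to 15,
  which includes the successor of any solution of that turn (at most 4 pi + 1 high); the window adds
  room for their cells and for nearby zeros of \<open>P\<close>.\<close>

definition window :: "complex set" where
  "window = {u. \<bar>Re u\<bar> \<le> \<eta>' \<and> -9 \<le> Im u \<and> Im u \<le> 20}"

text \<open>The height 10 / n leaves room for the next solution, about 2 pi / n above
  \<open>u\<close>. The cell reaches to the right edge of the strip so that, of two solutions at
  nearly equal height, the one with smaller real part has the other in its cell; moving right also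
  moves away from the zeros of \<open>P\<close>.\<close>

definition cell :: "nat \<Rightarrow> complex \<Rightarrow> complex set" where
  "cell n u = {v. \<bar>Re v\<bar> < \<eta>' \<and> \<bar>Im v - Im u\<bar> < 10 / n \<and> Re u - 10 / n < Re v}"

lemma window_eq: "window = cbox (Complex (-\<eta>') (-9)) (Complex \<eta>' 20)"
  by (auto simp: window_def in_cbox_complex_iff)

lemma compact_window: "compact window" and convex_window: "convex window"
  by (simp_all add: window_eq convex_box)

lemma window_subset: "window \<subseteq> {u. \<bar>Re u\<bar> < \<eta>}"
  using eta by (auto simp: window_def)

lemma open_strip: "open {u::complex. \<bar>Re u\<bar> < e}"
  by (intro open_Collect_less continuous_intros)

lemma convex_strip: "convex {u::complex. \<bar>Re u\<bar> < e}"
proof -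
  have "{u::complex. \<bar>Re u\<bar> < e} = {u. Re u < e} \<inter> {u. Re u > - e}" by auto
  then show ?thesis by (simp add: convex_Int convex_halfspace_Re_lt convex_halfspace_Re_gt)
qed

lemma open_cell: "open (cell n u)"
  unfolding cell_def by (intro open_Collect_conj open_Collect_less continuous_intros)

lemma convex_cell: "convex (cell n u)"
proof -
  have "cell n u = {v. Re v < \<eta>'} \<inter> {v. Re v > - \<eta>'} \<inter> {v. Im v < Im u + 10 / n} \<inter>
     {v. Im v > Im u - 10 / n} \<inter> {v. Re v > Re u - 10 / n}"
    by (auto simp: cell_def)
  then show ?thesis
    by (simp add: convex_Int convex_halfspace_Re_lt convex_halfspace_Re_gt convex_halfspace_Im_lt convex_halfspace_Im_gt)
qed

lemma P_bounds:
  obtains K1 where "K1 > 0" "\<And>u. u \<in> window \<Longrightarrow> cmod (P u) \<le> K1"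
    "\<And>u v. \<lbrakk>u \<in> window; v \<in> window\<rbrakk> \<Longrightarrow> cmod (P u - P v) \<le> K1 * cmod (u - v)"
proof -
  have "continuous_on window P" "continuous_on window (deriv P)"
    by (rule holomorphic_on_imp_continuous_on holomorphic_on_subset[OF _ window_subset] holP holomorphic_deriv open_strip)+
  then have "bounded (P ` window)" "bounded (deriv P ` window)"
    by (auto intro!: compact_imp_bounded compact_continuous_image compact_window)
  then obtain a b where ab: "a > 0" "b > 0" "\<And>u. u \<in> window \<Longrightarrow> cmod (P u) \<le> a" "\<And>u. u \<in> window \<Longrightarrow> cmod (deriv P u) \<le> b"
    by (auto simp: bounded_pos)
  show thesis
  proof (rule that[of "a + b"])
    show "cmod (P u - P v) \<le> (a + b) * cmod (u - v)" if "u \<in> window" "v \<in> window" for u v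
    proof (rule field_differentiable_bound[OF convex_window])
      show "(P has_field_derivative deriv P z) (at z within window)" if "z \<in> window" for z
        using holomorphic_derivI[OF holP open_strip, of z] that window_subset by (auto intro: DERIV_subset)
      show "cmod (deriv P z) \<le> a + b" if "z \<in> window" for z using ab(1) ab(4)[OF that] by simp
    qed (use that in auto)
  qed (use ab in \<open>auto intro: order_trans[OF ab(3)]\<close>)
qed

lemma q2_nonneg: "q2 \<ge> 0" and q1_pos: "q1 > 0"
proof -
  from bounds_Q obtain n where "\<forall>u. \<bar>Re u\<bar> < \<eta> \<longrightarrow>
      q0 \<le> cmod (Q n u) \<and> cmod (Q n u) \<le> q1 \<and> cmod (deriv (Q n) u) \<le> q2"
    by (auto simp: eventually_sequentially)
  then have "q0 \<le> cmod (Q n 0) \<and> cmod (Q n 0) \<le> q1 \<and> cmod (deriv (Q n) 0) \<le> q2" using eta by auto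
  then show "q2 \<ge> 0" "q1 > 0" using q0 norm_ge_zero[of "deriv (Q n) 0"] by linarith+
qed

lemma Z_norm: "u \<in> Z n \<Longrightarrow> exp (n * Re u) * cmod (P u) = cmod (Q n u)"
  unfolding Z_def by (auto simp: norm_mult dest!: arg_cong[where f = cmod])

text \<open>Since \<open>P\<close> is bounded on the window and \<open>Q n\<close> is bounded away
  from 0, the exponential factor cannot be small.\<close>

lemma Re_lower:
  obtains A where "A > 0" "\<forall>\<^sub>F n in sequentially. \<forall>u\<in>Z n \<inter> window. - A \<le> n * Re u"
proof -
  obtain K1 where K1: "K1 > 0" "\<And>u. u \<in> window \<Longrightarrow> cmod (P u) \<le> K1"
    "\<And>u v. \<lbrakk>u \<in> window; v \<in> window\<rbrakk> \<Longrightarrow> cmod (P u - P v) \<le> K1 * cmod (u - v)" using P_bounds by blast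
  have "\<forall>\<^sub>F n in sequentially. \<forall>u\<in>Z n \<inter> window. - \<bar>ln (q0 / K1)\<bar> - 1 \<le> n * Re u"
    using bounds_Q
  proof eventually_elim
    case (elim n)
    show ?case
    proof
      fix u assume u: "u \<in> Z n \<inter> window"
      then have "q0 \<le> exp (n * Re u) * cmod (P u)" using Z_norm[of u n] elim window_subset by auto
      also have "\<dots> \<le> exp (n * Re u) * K1" using K1(2) u by (intro mult_left_mono) auto
      finally have "q0 / K1 \<le> exp (n * Re u)" using K1(1) by (simp add: field_simps)
      then have "ln (q0 / K1) \<le> n * Re u" using q0 K1(1) by (subst (asm) ln_le_cancel_iff[symmetric]) auto
      then show "- \<bar>ln (q0 / K1)\<bar> - 1 \<le> n * Re u" by linarith
    qed
  qed
  then show thesis by (intro that[of "\<bar>ln (q0 / K1)\<bar> + 1"]) auto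
qed

text \<open>Near a zero of \<open>P\<close> the equation forces \<open>exp (n * Re u)\<close> to be large, so a solution cannot come
  closer than the order of \<open>ln n / n\<close> to that zero.\<close>

lemma cell_avoids_zeros:
  "\<forall>\<^sub>F n in sequentially. \<forall>u\<in>Z n. -5 \<le> Im u \<longrightarrow> Im u \<le> 15 \<longrightarrow>
     (\<forall>v\<in>cell n u. v \<in> window \<and> (\<forall>\<tau>. \<bar>Re \<tau>\<bar> < \<eta> \<longrightarrow> P \<tau> = 0 \<longrightarrow> ln n / (4 * n) \<le> dist v \<tau>))"
proof -
  obtain K1 where K1: "K1 > 0" "\<And>u. u \<in> window \<Longrightarrow> cmod (P u) \<le> K1"
    "\<And>u v. \<lbrakk>u \<in> window; v \<in> window\<rbrakk> \<Longrightarrow> cmod (P u - P v) \<le> K1 * cmod (u - v)" using P_bounds by blast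
  obtain A where A: "A > 0" "\<forall>\<^sub>F n in sequentially. \<forall>u\<in>Z n \<inter> window. - A \<le> n * Re u" using Re_lower by blast
  have "\<forall>\<^sub>F n in sequentially. A < ln (real n) / 2" by real_asymp
  \<comment> \<open>The value 40 makes \<open>10 / n\<close> at most \<open>ln n / (4 * n)\<close>,
    so a cell uses up at most half of the distance \<open>s\<close> below.\<close>
  moreover have "\<forall>\<^sub>F n in sequentially. 40 \<le> ln (real n)" by real_asymp
  moreover have "\<forall>\<^sub>F n in sequentially. ln (real n) / n < 1" by real_asymp
  moreover have "\<forall>\<^sub>F n in sequentially. exp (ln (real n) / 2) * K1 * (ln (real n) / n) < q0"
  proof -
    have "((\<lambda>n. exp (ln (real n) / 2) * K1 * (ln (real n) / n)) \<longlongrightarrow> 0) sequentially"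
      by real_asymp
    then show ?thesis using q0 by (auto dest: order_tendstoD)
  qed
  ultimately show ?thesis using bounds_Q A(2) eventually_ge_at_top[of 10]
  proof eventually_elim
    case (elim n)
    have n: "real n > 0" "real n \<ge> 10" using elim by auto
    show ?case
    proof (intro ballI impI conjI allI)
      fix u v assume u: "u \<in> Z n" "-5 \<le> Im u" "Im u \<le> 15" and v: "v \<in> cell n u"
      have "10 / real n \<le> 1" using n by (simp add: field_simps)
      then show "v \<in> window" using v u unfolding cell_def window_def by auto
    next
      fix u v \<tau> assume u: "u \<in> Z n" "-5 \<le> Im u" "Im u \<le> 15" and v: "v \<in> cell n u"
        and \<tau>: "\<bar>Re \<tau>\<bar> < \<eta>" "P \<tau> = 0"
      have \<tau>0: "Re \<tau> = 0" using zeros_P \<tau> by auto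
      have uw: "u \<in> window" using u unfolding Z_def window_def by auto
      \<comment> \<open>Within \<open>s\<close> of a zero of \<open>P\<close>, in both coordinates,
        \<open>exp (n * Re u)\<close> is at most the square root of n while \<open>P u\<close> is of
        order \<open>ln n / n\<close>; their product tends to 0 and falls below
        \<open>q0\<close>.\<close>
      define s where "s = ln (real n) / (2 * n)"
      have s: "s > 0" "s < 1/2" "10 / n \<le> s / 2" using elim n by (auto simp: s_def field_simps)
      have low: "- s < Re u"
      proof -
        have "- A \<le> n * Re u" using elim uw u by auto
        then have "- (ln (real n) / 2) < n * Re u" using elim by linarith
        then show ?thesis using n by (simp add: s_def field_simps)
      qed
      have "s \<le> Re u \<or> s \<le> \<bar>Im u - Im \<tau>\<bar>"
      proof (rule ccontr)
        assume "\<not> ?thesis"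
        then have c: "\<bar>Re u\<bar> < s" "\<bar>Im u - Im \<tau>\<bar> < s" using low by auto
        have "cmod (u - \<tau>) \<le> \<bar>Re (u - \<tau>)\<bar> + \<bar>Im (u - \<tau>)\<bar>" by (rule cmod_le)
        also have "\<dots> \<le> 2 * s" using c \<tau>0 by simp
        finally have d: "cmod (u - \<tau>) \<le> ln n / n" by (simp add: s_def)
        have "\<tau> \<in> window" using \<tau>0 u c s eta unfolding window_def by auto
        from K1(3)[OF uw this] have "cmod (P u) \<le> K1 * cmod (u - \<tau>)" using \<tau>(2) by simp
        also have "\<dots> \<le> K1 * (ln n / n)" using d K1(1) by (intro mult_left_mono) auto
        finally have Pu: "cmod (P u) \<le> K1 * (ln n / n)" .
        have "n * Re u \<le> n * s" using c n by (intro mult_left_mono) auto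
        then have "n * Re u \<le> ln n / 2" using n by (simp add: s_def)
        then have "exp (n * Re u) * cmod (P u) \<le> exp (ln n / 2) * (K1 * (ln n / n))"
          using Pu by (intro mult_mono) auto
        also have "\<dots> < q0" using elim by (simp add: mult.assoc)
        also have "q0 \<le> cmod (Q n u)" using elim uw window_subset by auto
        finally show False using Z_norm[OF u(1)] by simp
      qed
      then have "s / 2 \<le> \<bar>Re v\<bar> \<or> s / 2 \<le> \<bar>Im v - Im \<tau>\<bar>"
      proof
        assume "s \<le> Re u"
        then show ?thesis using v s unfolding cell_def by auto
      next
        assume "s \<le> \<bar>Im u - Im \<tau>\<bar>"
        moreover have "\<bar>Im v - Im u\<bar> < 10 / n" using v unfolding cell_def by auto
        ultimately show ?thesis using s by linarith
      qed
      moreover have "\<bar>Re (v - \<tau>)\<bar> \<le> cmod (v - \<tau>)" "\<bar>Im (v - \<tau>)\<bar> \<le> cmod (v - \<tau>)"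
        by (rule abs_Re_le_cmod abs_Im_le_cmod)+
      ultimately have "s / 2 \<le> dist v \<tau>" using \<tau>0 by (auto simp: dist_norm)
      then show "ln n / (4 * n) \<le> dist v \<tau>" by (simp add: s_def)
    qed
  qed
qed

lemma zero_distance:
  "\<exists>K>0. \<exists>M::nat. \<forall>u \<sigma>. u \<in> window \<longrightarrow> 0 < \<sigma> \<longrightarrow> \<sigma> \<le> 1 \<longrightarrow>
     (\<forall>\<tau>. \<bar>Re \<tau>\<bar> < \<eta> \<longrightarrow> P \<tau> = 0 \<longrightarrow> \<sigma> \<le> dist u \<tau>) \<longrightarrow>
     \<sigma> ^ M \<le> K * cmod (P u) \<and> cmod (deriv P u) * \<sigma> \<le> K * cmod (P u)"
proof -
  have *: "(0::complex) \<in> {u. \<bar>Re u\<bar> < \<eta>}" using eta by auto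
  show ?thesis
  proof (rule zero_distance_bounds[OF holP open_strip convex_connected[OF convex_strip] compact_window window_subset * P0])
    fix K :: real and M :: nat
    assume "K > 0" and *: "\<And>u \<sigma>. \<lbrakk>u \<in> window; 0 < \<sigma>; \<sigma> \<le> 1; \<And>\<tau>. \<lbrakk>\<tau> \<in> {u. \<bar>Re u\<bar> < \<eta>}; P \<tau> = 0\<rbrakk> \<Longrightarrow> \<sigma> \<le> dist u \<tau>\<rbrakk>
       \<Longrightarrow> \<sigma> ^ M \<le> K * cmod (P u) \<and> cmod (deriv P u) * \<sigma> \<le> K * cmod (P u)"
    show ?thesis
    proof (intro exI[of _ K] conjI exI[of _ M] allI impI \<open>K > 0\<close>)
      fix u \<sigma>
      assume u: "u \<in> window" "0 < \<sigma>" "\<sigma> \<le> 1" "\<forall>\<tau>. \<bar>Re \<tau>\<bar> < \<eta> \<longrightarrow> P \<tau> = 0 \<longrightarrow> \<sigma> \<le> dist u \<tau>"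
      then have "\<And>\<tau>. \<lbrakk>\<tau> \<in> {u. \<bar>Re u\<bar> < \<eta>}; P \<tau> = 0\<rbrakk> \<Longrightarrow> \<sigma> \<le> dist u \<tau>" by auto
      from *[OF u(1-3) this]
      show "\<sigma> ^ M \<le> K * cmod (P u)" "cmod (deriv P u) * \<sigma> \<le> K * cmod (P u)" by auto
    qed
  qed
qed

text \<open>To the right of \<open>ln n / n\<close> the values of \<open>P\<close> are at least of
  order \<open>n ^ (-M)\<close>, as all its zeros lie on the imaginary axis. So the exponential is
  at most a multiple of \<open>n ^ M\<close>, and one further \<open>ln n\<close> absorbs the
  constant.\<close>

lemma Re_upper:
  obtains A where "A > 0" "\<forall>\<^sub>F n in sequentially. \<forall>u\<in>Z n \<inter> window. Re u \<le> A * ln n / n"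
proof -
  obtain K :: real and M :: nat where K: "K > 0" and KM': "\<forall>u \<sigma>. u \<in> window \<longrightarrow> 0 < \<sigma> \<longrightarrow> \<sigma> \<le> 1 \<longrightarrow>
     (\<forall>\<tau>. \<bar>Re \<tau>\<bar> < \<eta> \<longrightarrow> P \<tau> = 0 \<longrightarrow> \<sigma> \<le> dist u \<tau>) \<longrightarrow>
     \<sigma> ^ M \<le> K * cmod (P u) \<and> cmod (deriv P u) * \<sigma> \<le> K * cmod (P u)"
    using zero_distance by (elim exE conjE)
  have KM: "\<sigma> ^ M \<le> K * cmod (P u) \<and> cmod (deriv P u) * \<sigma> \<le> K * cmod (P u)"
    if "u \<in> window" "0 < \<sigma>" "\<sigma> \<le> 1" "\<And>\<tau>. \<lbrakk>\<bar>Re \<tau>\<bar> < \<eta>; P \<tau> = 0\<rbrakk> \<Longrightarrow> \<sigma> \<le> dist u \<tau>" for u \<sigma>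
    using KM'[rule_format, OF that(1-3)] that(4) by simp
  have "\<forall>\<^sub>F n in sequentially. ln (real n) / n < 1" "\<forall>\<^sub>F n in sequentially. ln (real n) > \<bar>ln (q1 * K)\<bar> + 1" by real_asymp+
  then have "\<forall>\<^sub>F n in sequentially. \<forall>u\<in>Z n \<inter> window. Re u \<le> (real M + 1) * ln n / n"
    using bounds_Q eventually_gt_at_top[of 0]
  proof eventually_elim
    case (elim n)
    show ?case
    proof (rule ballI, rule ccontr)
      fix u assume u: "u \<in> Z n \<inter> window" and "\<not> Re u \<le> (real M + 1) * ln n / n"
      then have Re: "(real M + 1) * ln n / n < Re u" by simp
      have ln1: "ln n > 1" using elim by linarith
      have n: "real n > 0" using elim by simp
      define \<sigma> where "\<sigma> = ln n / n"
      have \<sigma>: "0 < \<sigma>" "\<sigma> \<le> 1" unfolding \<sigma>_def using elim(1) divide_pos_pos[OF _ n, of "ln n"] ln1 by auto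
      have "\<sigma> \<le> Re u"
      proof -
        have "1 * ln (real n) \<le> (real M + 1) * ln n" using ln1 by (intro mult_right_mono) auto
        then have "\<sigma> \<le> (real M + 1) * ln n / n" unfolding \<sigma>_def using elim by (intro divide_right_mono) auto
        then show ?thesis using Re by simp
      qed
      then have "\<sigma> \<le> dist u \<tau>" if "\<bar>Re \<tau>\<bar> < \<eta>" "P \<tau> = 0" for \<tau>
        using zeros_P[OF that] abs_Re_le_cmod[of "u - \<tau>"] by (simp add: dist_norm)
      from KM[OF _ \<sigma> this] u have "\<sigma> ^ M \<le> K * cmod (P u)" by blast
      have "(1 / real n) ^ M \<le> \<sigma> ^ M" using ln1 unfolding \<sigma>_def by (intro power_mono divide_right_mono) auto
      also note \<open>\<sigma> ^ M \<le> K * cmod (P u)\<close>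
      finally have "(1 / real n) ^ M * exp (n * Re u) \<le> K * cmod (P u) * exp (n * Re u)"
        by (intro mult_right_mono) auto
      also have "\<dots> = K * cmod (Q n u)" using Z_norm[of u n] u by (simp add: algebra_simps)
      also have "\<dots> \<le> K * q1" using elim u window_subset K by (intro mult_left_mono) auto
      finally have "exp (n * Re u) \<le> real n ^ M * (q1 * K)" using elim by (simp add: field_simps power_divide)
      then have "n * Re u \<le> ln (real n ^ M * (q1 * K))" using q1_pos K elim
        by (subst ln_ge_iff) auto
      also have "\<dots> = M * ln n + ln (q1 * K)" using elim q1_pos K by (subst ln_mult) (auto simp: ln_realpow)
      also have "\<dots> < M * ln n + ln n" using elim by linarith
      finally have "n * Re u < (real M + 1) * ln n" by (simp add: algebra_simps)
      then show False using Re elim by (simp add: field_simps)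
    qed
  qed
  then show thesis by (intro that[of "real M + 1"]) auto
qed

text \<open>A logarithm of \<open>Q n / P\<close> turns the equation into \<open>n * u = L u\<close> modulo \<open>2 * pi * \<i>\<close>, where \<open>L\<close>
  varies slowly compared with \<open>n\<close>.\<close>

lemma cell_log:
  obtains K where "K > 0" "\<forall>\<^sub>F n in sequentially. \<forall>u\<in>Z n. -5 \<le> Im u \<longrightarrow> Im u \<le> 15 \<longrightarrow>
     (\<exists>L. L holomorphic_on cell n u \<and> (\<forall>v\<in>cell n u. P v \<noteq> 0 \<and> Q n v \<noteq> 0 \<and> exp (L v) = Q n v / P v \<and> 
        deriv L v = deriv (Q n) v / Q n v - deriv P v / P v \<and> cmod (deriv L v) \<le> K / ln n * n))"
proof -
  obtain K :: real and M :: nat where K: "K > 0" and KM': "\<forall>u \<sigma>. u \<in> window \<longrightarrow> 0 < \<sigma> \<longrightarrow> \<sigma> \<le> 1 \<longrightarrow>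
     (\<forall>\<tau>. \<bar>Re \<tau>\<bar> < \<eta> \<longrightarrow> P \<tau> = 0 \<longrightarrow> \<sigma> \<le> dist u \<tau>) \<longrightarrow>
     \<sigma> ^ M \<le> K * cmod (P u) \<and> cmod (deriv P u) * \<sigma> \<le> K * cmod (P u)"
    using zero_distance by (elim exE conjE)
  have KM: "\<sigma> ^ M \<le> K * cmod (P u) \<and> cmod (deriv P u) * \<sigma> \<le> K * cmod (P u)"
    if "u \<in> window" "0 < \<sigma>" "\<sigma> \<le> 1" "\<And>\<tau>. \<lbrakk>\<bar>Re \<tau>\<bar> < \<eta>; P \<tau> = 0\<rbrakk> \<Longrightarrow> \<sigma> \<le> dist u \<tau>" for u \<sigma>
    using KM'[rule_format, OF that(1-3)] that(4) by simp
  have "\<forall>\<^sub>F n in sequentially. ln (real n) / n < 1" "\<forall>\<^sub>F n in sequentially. ln (real n) > 1" by real_asymp+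
  then have "\<forall>\<^sub>F n in sequentially. \<forall>u\<in>Z n. -5 \<le> Im u \<longrightarrow> Im u \<le> 15 \<longrightarrow>
     (\<exists>L. L holomorphic_on cell n u \<and> (\<forall>v\<in>cell n u. P v \<noteq> 0 \<and> Q n v \<noteq> 0 \<and> exp (L v) = Q n v / P v \<and> 
        deriv L v = deriv (Q n) v / Q n v - deriv P v / P v \<and> cmod (deriv L v) \<le> (q2 / q0 + 4 * K) / ln n * n))"
    using bounds_Q eventually_gt_at_top[of 0] cell_avoids_zeros
  proof eventually_elim
    case (elim n)
    show ?case
    proof (intro ballI impI)
      fix u assume u: "u \<in> Z n" "- 5 \<le> Im u" "Im u \<le> 15"
      define G where "G = cell n u"
      have av: "v \<in> window" "\<And>\<tau>. \<bar>Re \<tau>\<bar> < \<eta> \<Longrightarrow> P \<tau> = 0 \<Longrightarrow> ln n / (4 * n) \<le> dist v \<tau>" if "v \<in> G" for v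
        using elim(5) u that unfolding G_def by blast+
      have GS: "G \<subseteq> {u. \<bar>Re u\<bar> < \<eta>}" using av(1) window_subset by blast
      define \<sigma> where "\<sigma> = ln n / (4 * n)"
      have "real n > 0" using elim by simp
      have s4: "\<sigma> = (ln n / n) / 4" by (simp add: \<sigma>_def)
      have "0 < ln n / n" using divide_pos_pos[OF _ \<open>real n > 0\<close>, of "ln n"] elim(2) by linarith
      then have \<sigma>: "0 < \<sigma>" "\<sigma> \<le> 1" unfolding s4 using elim(1) by auto
      have PK: "\<sigma> ^ M \<le> K * cmod (P v)" "cmod (deriv P v) * \<sigma> \<le> K * cmod (P v)" if "v \<in> G" for v
        using KM[OF av(1)[OF that] \<sigma>] av(2)[OF that] unfolding \<sigma>_def by blast+
      have P0: "P v \<noteq> 0" if "v \<in> G" for v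
      proof
        assume "P v = 0"
        then have "\<sigma> ^ M \<le> 0" using PK(1)[OF that] by simp
        then show False using \<sigma>(1) by (simp add: power_le_zero_eq)
      qed
      have Qb: "q0 \<le> cmod (Q n v)" "cmod (deriv (Q n) v) \<le> q2" if "v \<in> G" for v
        using elim(3) GS that by auto
      have Q0: "Q n v \<noteq> 0" if "v \<in> G" for v using Qb(1)[OF that] q0 by auto
      have hP: "P holomorphic_on G" and hQ: "Q n holomorphic_on G"
        using holomorphic_on_subset[OF holP GS] holomorphic_on_subset[OF holQ GS] by auto
      have hq: "(\<lambda>v. Q n v / P v) holomorphic_on G" using hP hQ P0 by (intro holomorphic_intros) auto
      have oG: "open G" unfolding G_def by (rule open_cell)
      have cG: "convex G" unfolding G_def by (rule convex_cell)
      obtain L where L: "L holomorphic_on G" "\<And>v. v \<in> G \<Longrightarrow> Q n v / P v = exp (L v)"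
        by (rule contractible_imp_holomorphic_log[OF hq convex_imp_contractible[OF cG]]) (use P0 Q0 in auto)
      have dL: "deriv L v = deriv (Q n) v / Q n v - deriv P v / P v" if v: "v \<in> G" for v
      proof -
        have "((\<lambda>v. exp (L v) * P v) has_field_derivative (exp (L v) * deriv L v * P v + deriv P v * exp (L v))) (at v)"
          by (rule derivative_eq_intros holomorphic_derivI[OF L(1) oG v] holomorphic_derivI[OF hP oG v] refl)+
        then have "(Q n has_field_derivative (exp (L v) * deriv L v * P v + deriv P v * exp (L v))) (at v)"
          by (rule has_field_derivative_transform_within_open[OF _ oG v]) (use L(2) P0 in \<open>auto simp flip: L(2)\<close>)
        then have "deriv (Q n) v = exp (L v) * deriv L v * P v + deriv P v * exp (L v)" by (rule DERIV_imp_deriv)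
        then show ?thesis using L(2)[OF v, symmetric] P0[OF v] Q0[OF v] by (simp add: field_simps)
      qed
      have bd: "cmod (deriv L v) \<le> (q2 / q0 + 4 * K) / ln n * n" if v: "v \<in> G" for v
      proof -
        have "cmod (deriv L v) \<le> cmod (deriv (Q n) v / Q n v) + cmod (deriv P v / P v)"
          unfolding dL[OF v] by (rule norm_triangle_ineq4)
        also have "cmod (deriv (Q n) v / Q n v) \<le> q2 / q0"
          using Qb[OF v] q0 q2_nonneg by (auto simp: norm_divide intro!: frac_le)
        also have "cmod (deriv P v / P v) \<le> K / \<sigma>" using PK(2)[OF v] P0[OF v] \<sigma> by (simp add: norm_divide field_simps)
        also have "K / \<sigma> = 4 * K / ln n * n" by (simp add: \<sigma>_def)
        \<comment> \<open>The contribution of \<open>Q n\<close> is merely bounded; it is enlarged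
          to the order of that of \<open>P\<close> in order to have one constant.\<close>
        also have "q2 / q0 \<le> q2 / q0 * (n / ln n)"
        proof -
          have "1 \<le> n / ln n" using elim(2,4) ln_le_minus_one[of "real n"] by (simp add: le_divide_eq del: ln_less_self)
          from mult_left_mono[OF this, of "q2 / q0"] show ?thesis using q2_nonneg q0 by simp
        qed
        also have "q2 / q0 * (n / ln n) + 4 * K / ln n * n = (q2 / q0 + 4 * K) / ln n * n"
          by (simp add: add_divide_distrib distrib_right)
        finally show ?thesis by simp
      qed
      show "\<exists>L. L holomorphic_on cell n u \<and> (\<forall>v\<in>cell n u. P v \<noteq> 0 \<and> Q n v \<noteq> 0 \<and> exp (L v) = Q n v / P v \<and> 
        deriv L v = deriv (Q n) v / Q n v - deriv P v / P v \<and> cmod (deriv L v) \<le> (q2 / q0 + 4 * K) / ln n * n)"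
        using L P0 Q0 dL bd unfolding G_def[symmetric] by (intro exI[of _ L]) auto
    qed
  qed
  moreover have "q2 / q0 + 4 * K > 0" using q2_nonneg q0 K by (simp add: add_nonneg_pos)
  ultimately show thesis using that by blast
qed

end

section \<open>A slowly varying logarithm: separation and successors of solutions\<close>

text \<open>The map \<open>n * u - L u\<close> is a perturbation of \<open>n * u\<close> of relative
  size \<delta>. The value 1 / 8 leaves room for the numerical estimates of the next two
  lemmas.\<close>

locale slow_logarithm =
  fixes G :: "complex set" and L :: "complex \<Rightarrow> complex" and n :: nat and \<delta> :: real
  assumes G: "open G" "convex G" and L: "L holomorphic_on G" and n: "n > 0" and \<delta>: "0 < \<delta>" "\<delta> \<le> 1 / 8"
    and dL: "\<And>v. v \<in> G \<Longrightarrow> cmod (deriv L v) \<le> \<delta> * n"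
begin

lemma lipschitz:
  assumes "u \<in> G" "v \<in> G"
  shows "cmod (L v - L u) \<le> (\<delta> * n) * cmod (v - u)"
proof (rule field_differentiable_bound[OF G(2)])
  show "(L has_field_derivative deriv L z) (at z within G)" if "z \<in> G" for z
    using holomorphic_derivI[OF L G(1) that] by (rule DERIV_subset) auto
qed (use dL assms in auto)

text \<open>The values of \<open>n * u - L u\<close> at two solutions differ by
  \<open>2 * pi * k * \<i>\<close>. For k = 0 the small Lipschitz constant of \<open>L\<close>
  forces equality; otherwise the scaled displacement \<zeta> differs from that period by a fraction
  \<delta> of its own length.\<close>

lemma separation:
  assumes u: "u \<in> G" "exp (of_nat n * u) = exp (L u)" and v: "v \<in> G" "exp (of_nat n * v) = exp (L v)"
    and "u \<noteq> v"
  shows "2 * pi - 6 * pi * \<delta> \<le> n * \<bar>Im u - Im v\<bar>"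
proof -
  have "exp (of_nat n * v - L v) = exp (of_nat n * u - L u)"
    using u v by (simp add: exp_diff)
  then obtain k :: int where k: "of_nat n * v - L v = of_nat n * u - L u + (of_int (2 * k) * pi) * \<i>"
    by (auto simp: exp_eq)
  define \<zeta> where "\<zeta> = of_nat n * (v - u)"
  have z: "cmod \<zeta> = n * cmod (v - u)" by (simp add: \<zeta>_def norm_mult)
  have "\<zeta> - (2 * pi * k) * \<i> = L v - L u" using k by (simp add: \<zeta>_def algebra_simps)
  moreover have "\<delta> * n * cmod (v - u) = \<delta> * cmod \<zeta>" unfolding z by simp
  ultimately have d: "cmod (\<zeta> - (2 * pi * k) * \<i>) \<le> \<delta> * cmod \<zeta>" using lipschitz[OF u(1) v(1)] by metis
  have "k \<noteq> 0"
  proof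
    assume "k = 0"
    then have "cmod \<zeta> \<le> \<delta> * cmod \<zeta>" using d by simp
    moreover have "cmod \<zeta> > 0" using \<open>u \<noteq> v\<close> n by (simp add: z)
    ultimately show False using \<delta> by (simp add: mult_le_cancel_right1)
  qed
  define m where "m = 2 * pi * \<bar>real_of_int k\<bar>"
  have "1 \<le> \<bar>real_of_int k\<bar>" using \<open>k \<noteq> 0\<close> by linarith
  from mult_left_mono[OF this, of "2 * pi"] have m: "2 * pi \<le> m" unfolding m_def by simp
  have nk: "cmod ((2 * pi * k) * \<i>) = m" by (simp add: norm_mult m_def)
  have "cmod \<zeta> \<le> cmod (\<zeta> - (2 * pi * k) * \<i>) + cmod ((2 * pi * k) * \<i>)"
    by (metis norm_triangle_sub add.commute)
  then have "cmod \<zeta> \<le> \<delta> * cmod \<zeta> + m" using d nk by linarith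
  also have "\<delta> * cmod \<zeta> \<le> 1 / 8 * cmod \<zeta>" using \<delta> by (intro mult_right_mono) auto
  finally have zm: "cmod \<zeta> \<le> 2 * m" using m pi_gt_zero by linarith
  have "\<bar>Im \<zeta> - 2 * pi * k\<bar> \<le> cmod (\<zeta> - (2 * pi * k) * \<i>)"
    using abs_Im_le_cmod[of "\<zeta> - (2 * pi * k) * \<i>"] by simp
  also have "\<dots> \<le> \<delta> * (2 * m)" using d mult_left_mono[OF zm, of \<delta>] \<delta> by linarith
  finally have "\<bar>2 * pi * k\<bar> - \<delta> * (2 * m) \<le> \<bar>Im \<zeta>\<bar>" by linarith
  then have "m * (1 - 2 * \<delta>) \<le> \<bar>Im \<zeta>\<bar>" by (simp add: m_def abs_mult algebra_simps)
  moreover have "2 * pi * (1 - 2 * \<delta>) \<le> m * (1 - 2 * \<delta>)" using m \<delta> by (intro mult_right_mono) auto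
  moreover have "Im \<zeta> = n * (Im v - Im u)" by (simp add: \<zeta>_def)
  then have "\<bar>Im \<zeta>\<bar> = n * \<bar>Im u - Im v\<bar>" by (simp add: abs_mult abs_minus_commute)
  \<comment> \<open>The loss is really 4 pi \<delta>; it is weakened to the radius that occurs in
    the construction of the successor.\<close>
  moreover have "2 * pi - 6 * pi * \<delta> \<le> 2 * pi * (1 - 2 * \<delta>)" using \<delta> by (simp add: algebra_simps)
  ultimately show ?thesis by linarith
qed

text \<open>Raising \<open>n * u - L u\<close> by exactly one period amounts to a zero of
  \<open>F\<close>, and a holomorphic function that is smaller at the centre of a disc than on its
  boundary has a zero inside.\<close>

lemma next_solution:
  assumes u: "u \<in> G" "exp (of_nat n * u) = exp (L u)" and sub: "cball (u + 2 * pi * \<i> / n) (6 * pi * \<delta> / n) \<subseteq> G"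
  obtains v where "v \<in> cball (u + 2 * pi * \<i> / n) (6 * pi * \<delta> / n)" "exp (of_nat n * v) = exp (L v)"
    "cmod (of_nat n * (v - u) - 2 * pi * \<i>) \<le> 6 * pi * \<delta>"
proof -
  define v0 where "v0 = u + 2 * pi * \<i> / n"
  \<comment> \<open>At the centre \<open>F\<close> is at most 2 pi \<delta>. On the circle the
    linear term is 6 pi \<delta> and the logarithm takes away less than 4 pi \<delta>, so the
    boundary values are larger.\<close>
  define r where "r = 6 * pi * \<delta> / n"
  have r: "r > 0" using \<delta> n by (simp add: r_def)
  have nr: "n * r = 6 * pi * \<delta>" using n by (simp add: r_def)
  have v0u: "cmod (v0 - u) = 2 * pi / n" using n by (simp add: v0_def norm_mult norm_divide)
  have sub: "cball v0 r \<subseteq> G" using sub by (simp add: v0_def r_def)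
  define F where "F = (\<lambda>v. of_nat n * (v - u) - 2 * pi * \<i> - (L v - L u))"
  have hF: "F holomorphic_on G" unfolding F_def by (intro holomorphic_intros L)
  have F: "F v = of_nat n * (v - v0) - (L v - L u)" for v using n by (simp add: F_def v0_def field_simps)
  obtain v where v: "v \<in> ball v0 r" "F v = 0"
  proof (rule holomorphic_contract_to_zero[of v0 r F])
    show "continuous_on (cball v0 r) F" using hF sub holomorphic_on_imp_continuous_on holomorphic_on_subset by blast
    show "F holomorphic_on ball v0 r" using hF sub ball_subset_cball holomorphic_on_subset by blast
    fix z assume z: "cmod (v0 - z) = r"
    then have zc: "z \<in> cball v0 r" by (simp add: dist_norm)
    have v0c: "v0 \<in> cball v0 r" using r by simp
    have "cmod (L v0 - L u) \<le> \<delta> * n * (2 * pi / n)" using lipschitz[OF u(1) subsetD[OF sub v0c]] v0u by simp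
    then have "cmod (F v0) \<le> \<delta> * (2 * pi)" using n by (simp add: F norm_minus_commute)
    moreover have "cmod (of_nat n * (z - v0)) - cmod (L z - L u) \<le> cmod (F z)" unfolding F by (rule norm_triangle_ineq2)
    moreover have "cmod (of_nat n * (z - v0)) = 6 * pi * \<delta>" using z nr by (simp add: norm_mult norm_minus_commute)
    moreover have "cmod (L z - L u) \<le> \<delta> * (2 * pi + 6 * pi * \<delta>)"
    proof -
      have "cmod (z - u) \<le> r + 2 * pi / n" using z v0u norm_triangle_ineq[of "z - v0" "v0 - u"] by (simp add: norm_minus_commute)
      then have "\<delta> * n * cmod (z - u) \<le> \<delta> * n * (r + 2 * pi / n)" using \<delta> by (intro mult_left_mono) auto
      also have "\<dots> = \<delta> * (2 * pi + 6 * pi * \<delta>)" using n by (simp add: r_def field_simps)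
      finally show ?thesis using lipschitz[OF u(1) subsetD[OF sub zc]] by linarith
    qed
    moreover have "\<delta> * (2 * pi + 6 * pi * \<delta>) < \<delta> * (4 * pi)"
    proof -
      have "6 * pi * \<delta> \<le> 6 * pi * (1 / 8)" using \<delta> by (intro mult_left_mono) auto
      then have "2 * pi + 6 * pi * \<delta> < 4 * pi" using pi_gt_zero by linarith
      then show ?thesis using \<delta> by (intro mult_strict_left_mono) auto
    qed
    moreover have "6 * pi * \<delta> = \<delta> * (2 * pi) + \<delta> * (4 * pi)" by simp
    ultimately show "cmod (F v0) < cmod (F z)" by linarith
  qed (use r in auto)
  have "of_nat n * v - L v = of_nat n * u - L u + of_int 2 * pi * \<i>" using v(2) by (simp add: F_def algebra_simps)
  then have "exp (of_nat n * v - L v) = exp (of_nat n * u - L u)" by (simp add: exp_add)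
  then have "exp (of_nat n * v) = exp (L v)" using u by (simp add: exp_diff)
  moreover have "cmod (of_nat n * (v - u) - 2 * pi * \<i>) \<le> 6 * pi * \<delta>"
  proof -
    have "of_nat n * (v - u) - 2 * pi * \<i> = of_nat n * (v - v0)" using n by (simp add: v0_def field_simps)
    then have "cmod (of_nat n * (v - u) - 2 * pi * \<i>) = n * cmod (v - v0)" by (simp add: norm_mult)
    also have "\<dots> \<le> n * r" using v(1) by (intro mult_left_mono) (auto simp: dist_norm norm_minus_commute)
    finally show ?thesis using nr by linarith
  qed
  moreover have "v \<in> cball (u + 2 * pi * \<i> / n) (6 * pi * \<delta> / n)" using v(1) by (simp add: v0_def r_def)
  ultimately show thesis using that by blast
qed

end

section \<open>The solutions form a local lattice\<close>

context exponential_lattice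
begin

text \<open>On each cell the local logarithm is slow with \<delta> of order \<open>1 / ln n\<close>,
  so separation and successor apply to every solution; the a priori bounds on \<open>Re u\<close>
  keep the predicted successor inside the cell.\<close>

lemma lattice_structure:
  obtains K where "K > 0" "\<forall>\<^sub>F n in sequentially. \<forall>u\<in>Z n. -5 \<le> Im u \<longrightarrow> Im u \<le> 15 \<longrightarrow>
     \<bar>Re u\<bar> \<le> K * ln n / n \<and>
     deriv (\<lambda>u. exp (of_nat n * u) * P u - Q n u) u \<noteq> 0 \<and>
     (\<exists>v\<in>Z n. cmod (of_nat n * (v - u) - 2 * pi * \<i>) \<le> K / ln n) \<and>
     (\<forall>v\<in>Z n. -5 \<le> Im v \<longrightarrow> Im v \<le> 15 \<longrightarrow> v \<noteq> u \<longrightarrow> 2 * pi - K / ln n \<le> n * \<bar>Im u - Im v\<bar>)"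
proof -
  obtain A1 where A1: "A1 > 0" "\<forall>\<^sub>F n in sequentially. \<forall>u\<in>Z n \<inter> window. - A1 \<le> n * Re u" using Re_lower by blast
  obtain A2 where A2: "A2 > 0" "\<forall>\<^sub>F n in sequentially. \<forall>u\<in>Z n \<inter> window. Re u \<le> A2 * ln n / n" using Re_upper by blast
  obtain K where K: "K > 0" "\<forall>\<^sub>F n in sequentially. \<forall>u\<in>Z n. -5 \<le> Im u \<longrightarrow> Im u \<le> 15 \<longrightarrow>
     (\<exists>L. L holomorphic_on cell n u \<and> (\<forall>v\<in>cell n u. P v \<noteq> 0 \<and> Q n v \<noteq> 0 \<and> exp (L v) = Q n v / P v \<and> 
        deriv L v = deriv (Q n) v / Q n v - deriv P v / P v \<and> cmod (deriv L v) \<le> K / ln n * n))"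
    using cell_log by blast
  define K' where "K' = A1 + A2 + 6 * pi * K"
  have "\<forall>\<^sub>F n in sequentially. K / ln (real n) \<le> 1 / 8" using K(1) by real_asymp
  moreover have "\<forall>\<^sub>F n in sequentially. ln (real n) > 1" by real_asymp
  moreover have "\<forall>\<^sub>F n in sequentially. A2 * ln (real n) / n + 10 / n < \<eta>'"
    by (rule order_tendstoD[of _ 0]) (real_asymp | fact eta)+
  moreover have "\<forall>\<^sub>F n in sequentially. A1 / n + 10 / n < \<eta>'"
    by (rule order_tendstoD[of _ 0]) (real_asymp | fact eta)+
  ultimately have "\<forall>\<^sub>F n in sequentially. \<forall>u\<in>Z n. -5 \<le> Im u \<longrightarrow> Im u \<le> 15 \<longrightarrow>
     \<bar>Re u\<bar> \<le> K' * ln n / n \<and>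
     deriv (\<lambda>u. exp (of_nat n * u) * P u - Q n u) u \<noteq> 0 \<and>
     (\<exists>v\<in>Z n. cmod (of_nat n * (v - u) - 2 * pi * \<i>) \<le> K' / ln n) \<and>
     (\<forall>v\<in>Z n. -5 \<le> Im v \<longrightarrow> Im v \<le> 15 \<longrightarrow> v \<noteq> u \<longrightarrow> 2 * pi - K' / ln n \<le> n * \<bar>Im u - Im v\<bar>)"
    using A1(2) A2(2) K(2) eventually_gt_at_top[of 0]
  proof eventually_elim
    case (elim n)
    have n: "real n > 0" using elim by simp
    define \<delta> where "\<delta> = K / ln (real n)"
    have \<delta>: "0 < \<delta>" "\<delta> \<le> 1 / 8" using elim(1,2) K(1) divide_pos_pos[of K "ln n"] by (auto simp: \<delta>_def)
    have K'\<delta>: "6 * pi * \<delta> \<le> K' / ln n"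
    proof -
      have "6 * pi * K \<le> K'" using A1(1) A2(1) by (simp add: K'_def)
      then have "6 * pi * K / ln n \<le> K' / ln n" using elim(2) by (intro divide_right_mono) auto
      then show ?thesis by (simp add: \<delta>_def)
    qed
    define good where "good u L \<longleftrightarrow> L holomorphic_on cell n u \<and> (\<forall>v\<in>cell n u. P v \<noteq> 0 \<and> Q n v \<noteq> 0 \<and> exp (L v) = Q n v / P v \<and> 
        deriv L v = deriv (Q n) v / Q n v - deriv P v / P v \<and> cmod (deriv L v) \<le> \<delta> * n)" for u L
    define LL where "LL u = (SOME L. good u L)" for u
    have good: "good u (LL u)" if "u \<in> Z n" "-5 \<le> Im u" "Im u \<le> 15" for u
    proof -
      have "\<exists>L. good u L" using elim(7) that unfolding \<delta>_def good_def by blast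
      then show ?thesis unfolding LL_def by (rule someI_ex)
    qed
    have sl: "slow_logarithm (cell n u) (LL u) n \<delta>" if "u \<in> Z n" "-5 \<le> Im u" "Im u \<le> 15" for u
      using good[OF that] \<delta> n open_cell convex_cell unfolding good_def slow_logarithm_def by auto
    have Zexp: "v \<in> Z n \<longleftrightarrow> exp (of_nat n * v) = exp (LL u v)"
      if "u \<in> Z n" "-5 \<le> Im u" "Im u \<le> 15" "v \<in> cell n u" for u v
    proof -
      have "P v \<noteq> 0" "exp (LL u v) = Q n v / P v" using good[OF that(1-3)] that(4) unfolding good_def by auto
      moreover have "\<bar>Re v\<bar> < \<eta>'" using that(4) unfolding cell_def by auto
      ultimately have *: "P v \<noteq> 0" "Q n v = exp (LL u v) * P v" "\<bar>Re v\<bar> < \<eta>'" by auto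
      show ?thesis unfolding Z_def mem_Collect_eq *(2) using *(1,3) by simp
    qed
    \<comment> \<open>Either the heights differ by at least 7 / n, which exceeds 2 pi / n, or the
      solution with larger real part lies in the cell of the other one.\<close>
    have key: "2 * pi - 6 * pi * \<delta> \<le> n * \<bar>Im u - Im v\<bar>"
      if u: "u \<in> Z n" "-5 \<le> Im u" "Im u \<le> 15" and v: "v \<in> Z n" and uv: "Re u \<le> Re v" "u \<noteq> v" for u v
    proof (cases "7 \<le> n * \<bar>Im u - Im v\<bar>")
      case True
      have "2 * pi \<le> 7" using pi_approx by simp
      moreover have "0 \<le> 6 * pi * \<delta>" using \<delta> by simp
      ultimately show ?thesis using True by linarith
    next
      case False
      then have sm: "\<bar>Im v - Im u\<bar> < 10 / n" using n by (simp add: field_simps abs_minus_commute)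
      interpret slow_logarithm "cell n u" "LL u" n \<delta>
        using sl[OF u] .
      have ten: "0 < 10 / real n" using n by simp
      have uc: "u \<in> cell n u" and vc: "v \<in> cell n u"
        using u v uv ten sm unfolding cell_def Z_def by auto
      show ?thesis by (rule separation) (use uc vc uv Zexp[OF u] u v in auto)
    qed
    show ?case
    proof (intro ballI impI conjI)
      fix u assume u: "u \<in> Z n" "-5 \<le> Im u" "Im u \<le> 15"
      have uw: "u \<in> window" using u unfolding Z_def window_def by auto
      have R1: "- A1 \<le> n * Re u" and R2: "Re u \<le> A2 * ln n / n" using elim uw u by auto
      have R1': "- (A1 / n) \<le> Re u" using R1 n by (simp add: field_simps)
      have "Re u \<ge> - (K' * ln n / n)"
      proof -
        have "A1 * 1 \<le> K' * ln n" using A1(1) A2(1) K(1) elim(2) by (intro mult_mono) (auto simp: K'_def)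
        then have "A1 / n \<le> K' * ln n / n" using n by (simp add: field_simps)
        then show ?thesis using R1' by linarith
      qed
      moreover have "A2 * ln n / n \<le> K' * ln n / n" 
        using A1(1) A2(1) K(1) elim(2) n by (intro divide_right_mono mult_right_mono) (auto simp: K'_def)
      ultimately show "\<bar>Re u\<bar> \<le> K' * ln n / n" using R2 by linarith
      have uc: "u \<in> cell n u" using u n unfolding cell_def Z_def by auto
      have us: "u \<in> {u. \<bar>Re u\<bar> < \<eta>}" using uw window_subset by auto
      show "deriv (\<lambda>u. exp (of_nat n * u) * P u - Q n u) u \<noteq> 0"
      proof
        assume a: "deriv (\<lambda>u. exp (of_nat n * u) * P u - Q n u) u = 0"
        have "((\<lambda>u. exp (of_nat n * u) * P u - Q n u) has_field_derivative
           (exp (of_nat n * u) * of_nat n * P u + deriv P u * exp (of_nat n * u) - deriv (Q n) u)) (at u)"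
          by (rule derivative_eq_intros holomorphic_derivI[OF holP open_strip us] holomorphic_derivI[OF holQ open_strip us] refl | simp)+
        then have "exp (of_nat n * u) * of_nat n * P u + deriv P u * exp (of_nat n * u) - deriv (Q n) u = 0"
          using a DERIV_imp_deriv by metis
        moreover have "P u \<noteq> 0" "Q n u \<noteq> 0" "exp (of_nat n * u) = Q n u / P u"
          and g: "deriv (LL u) u = deriv (Q n) u / Q n u - deriv P u / P u" "cmod (deriv (LL u) u) \<le> \<delta> * n"
          using good[OF u] uc Zexp[OF u uc] u(1) unfolding good_def by auto
        ultimately have e: "deriv (Q n) u = Q n u / P u * of_nat n * P u + deriv P u * (Q n u / P u)" and nz: "P u \<noteq> 0" "Q n u \<noteq> 0"
          by (auto simp del: times_divide_eq_left times_divide_eq_right)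
        \<comment> \<open>A multiple solution would give the logarithm the derivative n, which is
          eight times more than its bound allows.\<close>
        have "of_nat n = deriv (LL u) u" unfolding g(1) e using nz by (simp add: field_simps)
        then have "real n \<le> \<delta> * n" using g(2) by (metis norm_of_nat)
        then show False using \<delta> n by (simp add: mult_le_cancel_right1)
      qed
      show "2 * pi - K' / ln n \<le> n * \<bar>Im u - Im v\<bar>" if v: "v \<in> Z n" "-5 \<le> Im v" "Im v \<le> 15" "v \<noteq> u" for v
      proof -
        have "2 * pi - 6 * pi * \<delta> \<le> n * \<bar>Im u - Im v\<bar>"
        proof (cases "Re u \<le> Re v")
          case True
          then show ?thesis using key u v by blast
        next
          case False
          then have "2 * pi - 6 * pi * \<delta> \<le> n * \<bar>Im v - Im u\<bar>" using key[of v u] u v by auto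
          then show ?thesis by (simp add: abs_minus_commute)
        qed
        then show ?thesis using K'\<delta> by linarith
      qed
      define v0 where "v0 = u + 2 * pi * \<i> / n"
      define r where "r = 6 * pi * \<delta> / n"
      have sub: "cball v0 r \<subseteq> cell n u"
      proof
        fix v assume "v \<in> cball v0 r"
        then have "cmod (v - v0) \<le> r" by (simp add: dist_norm norm_minus_commute)
        then have a: "\<bar>Re v - Re v0\<bar> \<le> r" "\<bar>Im v - Im v0\<bar> \<le> r"
          using abs_Re_le_cmod[of "v - v0"] abs_Im_le_cmod[of "v - v0"] by auto
        have b: "Re v0 = Re u" "Im v0 = Im u + 2 * pi / n" using n by (auto simp: v0_def)
        have "6 * pi * \<delta> \<le> 6 * pi * (1 / 8)" using \<delta> by (intro mult_left_mono) auto
        moreover have pi35: "pi < 35 / 10" using pi_approx by simp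
        ultimately have "2 * pi + 6 * pi * \<delta> < 10" by linarith
        then have "(2 * pi + 6 * pi * \<delta>) / n < 10 / n" using n by (simp add: divide_strict_right_mono)
        then have c: "2 * pi / n + r < 10 / n" by (simp add: r_def add_divide_distrib)
        moreover have "0 < 2 * pi / n" using n by simp
        ultimately have "r < 10 / n" by linarith
        have R3: "Re u \<ge> - (A1 / n)" using R1' .
        have "\<bar>Re v\<bar> < \<eta>'" using a(1) b(1) \<open>r < 10 / n\<close> R2 R3 elim(3,4) by linarith
        moreover have "\<bar>Im v - Im u\<bar> < 10 / n" using a(2) b(2) c \<open>0 < 2 * pi / n\<close> by linarith
        moreover have "Re u - 10 / n < Re v" using a(1) b(1) \<open>r < 10 / n\<close> by linarith
        ultimately show "v \<in> cell n u" by (simp add: cell_def)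
      qed
      interpret slow_logarithm "cell n u" "LL u" n \<delta>
        using sl[OF u] .
      obtain v where v: "v \<in> cball v0 r" "exp (of_nat n * v) = exp (LL u v)"
          "cmod (of_nat n * (v - u) - 2 * pi * \<i>) \<le> 6 * pi * \<delta>"
        using next_solution[OF uc, of thesis] Zexp[OF u uc] u(1) sub unfolding v0_def r_def by blast
      have "v \<in> Z n" using Zexp[OF u, of v] v sub by blast
      then show "\<exists>v\<in>Z n. cmod (of_nat n * (v - u) - 2 * pi * \<i>) \<le> K' / ln n"
        using v(3) K'\<delta> by (intro bexI[of _ v]) auto
    qed
  qed
  moreover have "K' > 0" using A1(1) A2(1) K(1) by (simp add: K'_def add_pos_pos)
  ultimately show thesis using that by blast
qed

end

section \<open>The Szego recursion with nearly geometric coefficients\<close>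

text \<open>The second component is the reversed polynomial, carried along so that no reversal
  operation on polynomials is needed. Only a coefficient sequence enters; the measure is connected
  to it later.\<close>

primrec szego_polys :: "(nat \<Rightarrow> complex) \<Rightarrow> nat \<Rightarrow> complex poly \<times> complex poly" where
  "szego_polys \<alpha> 0 = (1, 1)"
| "szego_polys \<alpha> (Suc n) =
    (pCons 0 (fst (szego_polys \<alpha> n)) - smult (cnj (\<alpha> n)) (snd (szego_polys \<alpha> n)),
     snd (szego_polys \<alpha> n) - smult (\<alpha> n) (pCons 0 (fst (szego_polys \<alpha> n))))"

definition szego_monic :: "(nat \<Rightarrow> complex) \<Rightarrow> nat \<Rightarrow> complex poly" where
  "szego_monic \<alpha> n = fst (szego_polys \<alpha> n)"

definition szego_dual :: "(nat \<Rightarrow> complex) \<Rightarrow> nat \<Rightarrow> complex poly" where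
  "szego_dual \<alpha> n = snd (szego_polys \<alpha> n)"

lemma szego_monic_0 [simp]: "szego_monic \<alpha> 0 = 1"
  and szego_dual_0 [simp]: "szego_dual \<alpha> 0 = 1"
  and szego_monic_Suc: "szego_monic \<alpha> (Suc n) = pCons 0 (szego_monic \<alpha> n) - smult (cnj (\<alpha> n)) (szego_dual \<alpha> n)"
  and szego_dual_Suc: "szego_dual \<alpha> (Suc n) = szego_dual \<alpha> n - smult (\<alpha> n) (pCons 0 (szego_monic \<alpha> n))"
  by (simp_all add: szego_monic_def szego_dual_def)

lemma poly_szego_monic_Suc:
    "poly (szego_monic \<alpha> (Suc n)) z = z * poly (szego_monic \<alpha> n) z - cnj (\<alpha> n) * poly (szego_dual \<alpha> n) z"
  and poly_szego_dual_Suc: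
    "poly (szego_dual \<alpha> (Suc n)) z = poly (szego_dual \<alpha> n) z - \<alpha> n * (z * poly (szego_monic \<alpha> n) z)"
  by (simp_all add: szego_monic_Suc szego_dual_Suc)

lemma degree_szego: "degree (szego_monic \<alpha> n) = n \<and> lead_coeff (szego_monic \<alpha> n) = 1 \<and> degree (szego_dual \<alpha> n) \<le> n"
proof (induction n)
  case (Suc n)
  let ?p = "pCons 0 (szego_monic \<alpha> n)" and ?q = "smult (cnj (\<alpha> n)) (szego_dual \<alpha> n)"
  have nz: "szego_monic \<alpha> n \<noteq> 0" using Suc by auto
  have dp: "degree ?p = Suc n" using nz Suc by simp
  have dq: "degree ?q < Suc n" using Suc by (metis degree_smult_le le_less_trans lessI order_trans)
  have 1: "degree (szego_monic \<alpha> (Suc n)) = Suc n"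
    unfolding szego_monic_Suc diff_conv_add_uminus using dp dq by (subst degree_add_eq_left) auto
  have "coeff ?q (Suc n) = 0" using dq by (rule coeff_eq_0)
  then have 2: "lead_coeff (szego_monic \<alpha> (Suc n)) = 1" unfolding 1 unfolding szego_monic_Suc using Suc[THEN conjunct1] Suc[THEN conjunct2, THEN conjunct1] by (simp del: coeff_smult)
  have "degree (smult (\<alpha> n) ?p) \<le> Suc n" using dp by (metis degree_smult_le)
  then have "degree (szego_dual \<alpha> (Suc n)) \<le> Suc n" unfolding szego_dual_Suc
    using Suc by (intro degree_diff_le) auto
  with 1 2 show ?case by blast
qed auto

lemmas degree_szego_monic = degree_szego[THEN conjunct1]
  and lead_coeff_szego_monic = degree_szego[THEN conjunct2, THEN conjunct1]
  and degree_szego_dual = degree_szego[THEN conjunct2, THEN conjunct2]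

lemma szego_monic_nz [simp]: "szego_monic \<alpha> n \<noteq> 0"
  using lead_coeff_szego_monic[of \<alpha> n] by auto

text \<open>This identifies the second component with the reversed polynomial. The recursion mixes
  the components, so both identities need one induction.\<close>

lemma szego_reversal:
  assumes "z \<noteq> 0"
  shows "poly (szego_monic \<alpha> n) z = z ^ n * cnj (poly (szego_dual \<alpha> n) (1 / cnj z)) \<and>
         poly (szego_dual \<alpha> n) z = z ^ n * cnj (poly (szego_monic \<alpha> n) (1 / cnj z))"
proof (induction n)
  case (Suc n)
  note IH1 = Suc[THEN conjunct1] and IH2 = Suc[THEN conjunct2]
  have "poly (szego_monic \<alpha> (Suc n)) z = z ^ Suc n * cnj (poly (szego_dual \<alpha> (Suc n)) (1 / cnj z))"
    unfolding poly_szego_monic_Suc poly_szego_dual_Suc IH1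
    by (subst IH2) (use assms in \<open>simp add: field_simps\<close>)
  moreover have "poly (szego_dual \<alpha> (Suc n)) z = z ^ Suc n * cnj (poly (szego_monic \<alpha> (Suc n)) (1 / cnj z))"
    unfolding poly_szego_monic_Suc poly_szego_dual_Suc IH2
    by (subst IH1) (use assms in \<open>simp add: field_simps\<close>)
  ultimately show ?case by blast
qed simp

lemmas szego_monic_reversal = szego_reversal[THEN conjunct1]
  and szego_dual_reversal = szego_reversal[THEN conjunct2]

lemma szego_dual_at_0 [simp]: "poly (szego_dual \<alpha> n) 0 = 1"
  by (induction n) (auto simp: poly_szego_dual_Suc)

text \<open>A recursion step is, up to a positive factor if |a| < 1, an isometry of the indefinite
  form \<open>|x|^2 - |y|^2\<close>; this preserves the order between the two components in the
  disk.\<close>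

lemma norm_hyperbolic_difference:
  "(cmod (x - a * y))\<^sup>2 - (cmod (y - cnj a * x))\<^sup>2 = (1 - (cmod a)\<^sup>2) * ((cmod x)\<^sup>2 - (cmod y)\<^sup>2)"
  unfolding cmod_power2 by (simp add: power2_eq_square algebra_simps)

lemma szego_monic_le_dual:
  assumes "\<And>n. cmod (\<alpha> n) < 1" "cmod z \<le> 1"
  shows "cmod (poly (szego_monic \<alpha> n) z) \<le> cmod (poly (szego_dual \<alpha> n) z)"
proof (induction n)
  case (Suc n)
  let ?x = "poly (szego_dual \<alpha> n) z" and ?y = "z * poly (szego_monic \<alpha> n) z"
  have "cmod ?y \<le> 1 * cmod (poly (szego_monic \<alpha> n) z)" unfolding norm_mult using assms by (intro mult_right_mono) auto
  then have "cmod ?y \<le> cmod ?x" using Suc by simp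
  then have "(cmod ?y)\<^sup>2 \<le> (cmod ?x)\<^sup>2" by (intro power_mono) auto
  moreover have "(cmod (\<alpha> n))\<^sup>2 \<le> 1" using assms(1)[of n] by (simp add: power_le_one)
  ultimately have "0 \<le> (1 - (cmod (\<alpha> n))\<^sup>2) * ((cmod ?x)\<^sup>2 - (cmod ?y)\<^sup>2)" by simp
  then have "(cmod (?y - cnj (\<alpha> n) * ?x))\<^sup>2 \<le> (cmod (?x - \<alpha> n * ?y))\<^sup>2"
    using norm_hyperbolic_difference[of ?x "\<alpha> n" ?y] by linarith
  then show ?case unfolding poly_szego_monic_Suc poly_szego_dual_Suc by (rule power2_le_imp_le) auto
qed simp

text \<open>In the closed disk the monic component is dominated by the dual one, so a step is a
  relative change by at most the modulus of the coefficient. The factors multiply to convergent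
  products when the coefficients decay geometrically.\<close>

lemma szego_dual_Suc_bounds:
  assumes "\<And>n. cmod (\<alpha> n) < 1" "cmod z \<le> 1"
  shows "cmod (poly (szego_dual \<alpha> (Suc n)) z) \<le> (1 + cmod (\<alpha> n)) * cmod (poly (szego_dual \<alpha> n) z)"
    and "(1 - cmod (\<alpha> n)) * cmod (poly (szego_dual \<alpha> n) z) \<le> cmod (poly (szego_dual \<alpha> (Suc n)) z)"
proof -
  let ?x = "poly (szego_dual \<alpha> n) z" and ?y = "z * poly (szego_monic \<alpha> n) z"
  have "cmod ?y \<le> 1 * cmod (poly (szego_monic \<alpha> n) z)" unfolding norm_mult using assms by (intro mult_right_mono) auto
  then have "cmod ?y \<le> cmod ?x" using szego_monic_le_dual[of \<alpha> z n] assms by simp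
  then have *: "cmod (\<alpha> n * ?y) \<le> cmod (\<alpha> n) * cmod ?x" unfolding norm_mult[of "\<alpha> n"] by (intro mult_left_mono) auto
  show "cmod (poly (szego_dual \<alpha> (Suc n)) z) \<le> (1 + cmod (\<alpha> n)) * cmod ?x"
    unfolding poly_szego_dual_Suc using * norm_triangle_ineq4[of ?x "\<alpha> n * ?y"] by (simp add: algebra_simps)
  show "(1 - cmod (\<alpha> n)) * cmod ?x \<le> cmod (poly (szego_dual \<alpha> (Suc n)) z)"
    unfolding poly_szego_dual_Suc using * norm_triangle_ineq2[of ?x "\<alpha> n * ?y"] by (simp add: algebra_simps)
qed

section \<open>Limits of sequences with geometric increments\<close>

lemma geometric_increments_limit:
  fixes x :: "nat \<Rightarrow> complex"
  assumes inc: "\<And>n. cmod (x (Suc n) - x n) \<le> K * q ^ n" and q: "0 \<le> q" "q < 1"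
  shows "x \<longlonglongrightarrow> lim x" and "cmod (x n - lim x) \<le> K / (1 - q) * q ^ n"
proof -
  \<comment> \<open>The factor \<open>1 - q ^ k\<close> is the exact partial geometric sum; the
    bound without it would not pass through the induction.\<close>
  have d: "cmod (x (n + k) - x n) \<le> K / (1 - q) * q ^ n * (1 - q ^ k)" for n k
  proof (induction k)
    case (Suc k)
    have "cmod (x (n + Suc k) - x n) \<le> cmod (x (Suc (n + k)) - x (n + k)) + cmod (x (n + k) - x n)"
      using norm_triangle_ineq[of "x (Suc (n + k)) - x (n + k)" "x (n + k) - x n"] by simp
    also have "\<dots> \<le> K * q ^ (n + k) + K / (1 - q) * q ^ n * (1 - q ^ k)" using inc Suc by (intro add_mono) auto
    also have "\<dots> = K / (1 - q) * q ^ n * (1 - q ^ Suc k)" using q by (simp add: field_simps power_add)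
    finally show ?case .
  qed simp
  have K: "0 \<le> K" using order_trans[OF norm_ge_zero inc[of 0]] by simp
  have d': "cmod (x m - x n) \<le> K / (1 - q) * q ^ n" if "n \<le> m" for m n
  proof -
    have "cmod (x m - x n) \<le> K / (1 - q) * q ^ n * (1 - q ^ (m - n))" using d[of n "m - n"] that by simp
    also have "\<dots> \<le> K / (1 - q) * q ^ n * 1" using K q by (intro mult_left_mono) auto
    finally show ?thesis by simp
  qed
  have "(\<lambda>n. q ^ n) \<longlonglongrightarrow> 0" using q by (intro LIMSEQ_realpow_zero) auto
  then have t0: "(\<lambda>n. K / (1 - q) * q ^ n) \<longlonglongrightarrow> 0" by (rule tendsto_mult_right_zero)
  have "Cauchy x"
  proof (rule metric_CauchyI)
    fix e :: real assume "e > 0"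
    then obtain N where N: "K / (1 - q) * q ^ N < e / 2"
      using order_tendstoD(2)[OF t0, of "e / 2"] by (auto simp: eventually_sequentially)
    show "\<exists>M. \<forall>m\<ge>M. \<forall>n\<ge>M. dist (x m) (x n) < e"
    proof (intro exI allI impI)
      fix m n assume "N \<le> m" "N \<le> n"
      then have "cmod (x m - x N) < e / 2" "cmod (x n - x N) < e / 2" using d'[of N m] d'[of N n] N by linarith+
      then show "dist (x m) (x n) < e" using norm_triangle_ineq4[of "x m - x N" "x n - x N"] by (simp add: dist_norm)
    qed
  qed
  then show *: "x \<longlonglongrightarrow> lim x" using Cauchy_convergent_iff convergent_LIMSEQ_iff by blast
  have "(\<lambda>m. cmod (x n - x m)) \<longlonglongrightarrow> cmod (x n - lim x)" by (intro tendsto_intros *)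
  then show "cmod (x n - lim x) \<le> K / (1 - q) * q ^ n"
    by (rule tendsto_upperbound) (use d' in \<open>auto simp: eventually_sequentially norm_minus_commute[of "x n"]\<close>)
qed

text \<open>The rate \<open>q\<close> may depend on the disc, which matters because in both uses it
  deteriorates towards the boundary of the domain.\<close>

lemma geometric_increments_holomorphic:
  assumes "open S" "\<And>n. f n holomorphic_on S"
    and "\<And>x. x \<in> S \<Longrightarrow> \<exists>r>0. \<exists>K q. cball x r \<subseteq> S \<and> 0 \<le> q \<and> q < 1 \<and>
           (\<forall>z\<in>cball x r. \<forall>n. cmod (f (Suc n) z - f n z) \<le> K * q ^ n)"
  shows "(\<lambda>z. lim (\<lambda>n. f n z)) holomorphic_on S"
proof (rule holomorphic_uniform_sequence[OF assms(1,2)])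
  fix x assume "x \<in> S"
  then obtain r K q where r: "r > 0" "cball x r \<subseteq> S" and q: "0 \<le> q" "q < 1"
    and inc: "\<And>z n. z \<in> cball x r \<Longrightarrow> cmod (f (Suc n) z - f n z) \<le> K * q ^ n"
    using assms(3) by meson
  have "(\<lambda>n. q ^ n) \<longlonglongrightarrow> 0" using q by (intro LIMSEQ_realpow_zero) auto
  then have t0: "(\<lambda>n. K / (1 - q) * q ^ n) \<longlonglongrightarrow> 0" by (rule tendsto_mult_right_zero)
  have "uniform_limit (cball x r) f (\<lambda>z. lim (\<lambda>n. f n z)) sequentially"
  proof (rule uniform_limitI)
    fix e :: real assume "e > 0"
    with t0 have "\<forall>\<^sub>F n in sequentially. K / (1 - q) * q ^ n < e" by (rule order_tendstoD)
    then show "\<forall>\<^sub>F n in sequentially. \<forall>z\<in>cball x r. dist (f n z) (lim (\<lambda>n. f n z)) < e"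
    proof eventually_elim
      case (elim n)
      show ?case
      proof
        fix z assume "z \<in> cball x r"
        from geometric_increments_limit(2)[OF inc[OF this] q, of n] elim
        show "dist (f n z) (lim (\<lambda>n. f n z)) < e" by (simp add: dist_norm)
      qed
    qed
  qed
  then show "\<exists>d>0. cball x d \<subseteq> S \<and> uniform_limit (cball x d) f (\<lambda>z. lim (\<lambda>n. f n z)) sequentially"
    using r by blast
qed

section \<open>Nearly geometric coefficients: the limit functions d and H\<close>

text \<open>The asymptotic bound is stated for every n, not just eventually, so that geometric sums
  and inductions can start at 0.\<close>

locale geometric_verblunsky =
  fixes \<alpha> :: "nat \<Rightarrow> complex" and C :: complex and b \<Delta> :: real
  assumes \<alpha>_lt_1: "\<And>n. cmod (\<alpha> n) < 1" and C_nz: "C \<noteq> 0" and b: "0 < b" "b < 1" and \<Delta>: "0 < \<Delta>" "\<Delta> < 1"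
    and \<alpha>_asymp: "\<exists>K. \<forall>n. cmod (\<alpha> n - C * of_real (b ^ n)) \<le> K * (b * \<Delta>) ^ n"
begin

abbreviation "\<Phi> \<equiv> szego_monic \<alpha>"
abbreviation "\<Phi>' \<equiv> szego_dual \<alpha>"

lemma \<alpha>_bound: obtains K where "K > 0" "\<And>n. cmod (\<alpha> n) \<le> K * b ^ n"
proof -
  obtain K where K: "\<And>n. cmod (\<alpha> n - C * of_real (b ^ n)) \<le> K * (b * \<Delta>) ^ n" using \<alpha>_asymp by blast
  have "0 \<le> K" using order_trans[OF norm_ge_zero K[of 0]] by simp
  have "cmod (\<alpha> n) \<le> (K + cmod C + 1) * b ^ n" for n
  proof -
    have "cmod (\<alpha> n) \<le> cmod (\<alpha> n - C * of_real (b ^ n)) + cmod (C * of_real (b ^ n))"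
      by (metis add.commute norm_triangle_sub)
    also have "cmod (C * of_real (b ^ n)) = cmod C * b ^ n" using b by (simp add: norm_mult norm_power)
    also have "cmod (\<alpha> n - C * of_real (b ^ n)) \<le> K * b ^ n"
    proof (rule order_trans[OF K])
      have "\<Delta> ^ n \<le> 1" using \<Delta> by (simp add: power_le_one)
      then have "K * (b ^ n * \<Delta> ^ n) \<le> K * (b ^ n * 1)" using b \<open>0 \<le> K\<close> by (intro mult_left_mono) auto
      then show "K * (b * \<Delta>) ^ n \<le> K * b ^ n" by (simp add: power_mult_distrib)
    qed
    also have "K * b ^ n + cmod C * b ^ n \<le> (K + cmod C + 1) * b ^ n" using b by (simp add: algebra_simps)
    finally show ?thesis by simp
  qed
  moreover have "K + cmod C + 1 > 0" using \<open>0 \<le> K\<close> by (simp add: add_nonneg_pos)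
  ultimately show thesis using that by blast
qed

text \<open>The upper bound exponentiates the sum of the coefficients. For the lower bound finitely
  many factors \<open>1 - |\<alpha> k|\<close> are positive and the remaining product is at least 1
  minus the tail sum, by Weierstrass' inequality.\<close>

lemma dual_bounds:
  obtains c0 M0 where "0 < c0" "c0 \<le> M0" "\<And>n z. cmod z \<le> 1 \<Longrightarrow> c0 \<le> cmod (poly (\<Phi>' n) z) \<and> cmod (poly (\<Phi>' n) z) \<le> M0"
proof -
  obtain K where K: "K > 0" "\<And>n. cmod (\<alpha> n) \<le> K * b ^ n" by (rule \<alpha>_bound) blast
  have sg: "(\<Sum>k<n. b ^ k) \<le> 1 / (1 - b)" for n :: nat
    using b by (simp add: sum_gp_strict divide_right_mono)
  have up: "cmod (poly (\<Phi>' n) z) \<le> exp (K * (\<Sum>k<n. b ^ k))" if "cmod z \<le> 1" for n z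
  proof (induction n)
    case (Suc n)
    have "cmod (poly (\<Phi>' (Suc n)) z) \<le> (1 + cmod (\<alpha> n)) * cmod (poly (\<Phi>' n) z)"
      using szego_dual_Suc_bounds(1)[of \<alpha> z n, OF \<alpha>_lt_1 that] .
    also have "\<dots> \<le> exp (K * b ^ n) * exp (K * (\<Sum>k<n. b ^ k))"
    proof (intro mult_mono Suc)
      show "1 + cmod (\<alpha> n) \<le> exp (K * b ^ n)" using K(2)[of n] exp_ge_add_one_self[of "K * b ^ n"] by linarith
    qed auto
    finally show ?case by (simp add: algebra_simps exp_add)
  qed simp
  have up': "cmod (poly (\<Phi>' n) z) \<le> exp (K / (1 - b))" if "cmod z \<le> 1" for n z
    using up[OF that, of n] mult_left_mono[OF sg[of n], of K] K(1) by (auto intro: order_trans)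
  have "(\<lambda>n. b ^ n) \<longlonglongrightarrow> 0" using b by (intro LIMSEQ_realpow_zero) auto
  then have "(\<lambda>n. K / (1 - b) * b ^ n) \<longlonglongrightarrow> 0" by (rule tendsto_mult_right_zero)
  \<comment> \<open>From this \<open>N\<close> on the coefficients sum to at most 1 / 2, so the
    remaining factors cost at most a factor 2.\<close>
  from order_tendstoD(2)[OF this, of "1/2"] obtain N where N: "K / (1 - b) * b ^ N < 1 / 2"
    by (auto simp: eventually_sequentially)
  define p where "p = (\<Prod>k<N. 1 - cmod (\<alpha> k))"
  have p: "0 < p" "p \<le> 1" unfolding p_def using \<alpha>_lt_1 by (auto intro!: prod_pos prod_le_1 simp: less_imp_le)
  have lo1: "(\<Prod>k<n. 1 - cmod (\<alpha> k)) \<le> cmod (poly (\<Phi>' n) z)" if "cmod z \<le> 1" for n z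
  proof (induction n)
    case (Suc n)
    have "(\<Prod>k<Suc n. 1 - cmod (\<alpha> k)) \<le> (1 - cmod (\<alpha> n)) * cmod (poly (\<Phi>' n) z)"
      using Suc \<alpha>_lt_1[of n] by (auto simp: mult.commute intro: mult_left_mono)
    then show ?case using szego_dual_Suc_bounds(2)[of \<alpha> z n, OF \<alpha>_lt_1 that] by linarith
  qed simp
  have lo2: "p / 2 \<le> (\<Prod>k<n. 1 - cmod (\<alpha> k))" for n
  proof (cases "n \<le> N")
    case True
    have "p = (\<Prod>k<n. 1 - cmod (\<alpha> k)) * (\<Prod>k\<in>{n..<N}. 1 - cmod (\<alpha> k))"
      unfolding p_def using True by (subst prod.union_disjoint[symmetric]) (auto intro!: prod.cong)
    also have "\<dots> \<le> (\<Prod>k<n. 1 - cmod (\<alpha> k)) * 1"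
      using \<alpha>_lt_1 by (intro mult_left_mono prod_nonneg prod_le_1) (auto simp: less_imp_le)
    finally have "p \<le> (\<Prod>k<n. 1 - cmod (\<alpha> k))" by simp
    then show ?thesis using p by linarith
  next
    case False
    have "(\<Prod>k<n. 1 - cmod (\<alpha> k)) = p * (\<Prod>k\<in>{N..<n}. 1 - cmod (\<alpha> k))"
      unfolding p_def using False by (subst prod.union_disjoint[symmetric]) (auto intro!: prod.cong)
    moreover have "1 - (\<Sum>k\<in>{N..<n}. cmod (\<alpha> k)) \<le> (\<Prod>k\<in>{N..<n}. 1 - cmod (\<alpha> k))"
      by (rule Weierstrass_prod_ineq) (use \<alpha>_lt_1 in \<open>auto simp: less_imp_le\<close>)
    moreover have "(\<Sum>k\<in>{N..<n}. cmod (\<alpha> k)) \<le> 1 / 2"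
    proof -
      have "(\<Sum>k\<in>{N..<n}. cmod (\<alpha> k)) \<le> (\<Sum>k\<in>{N..<n}. K * b ^ k)" by (intro sum_mono K)
      also have "\<dots> = K * b ^ N * (\<Sum>k<n-N. b ^ k)"
        by (subst sum.atLeastLessThan_shift_0) (simp add: sum_distrib_left lessThan_atLeast0 power_add mult.assoc)
      also have "\<dots> \<le> K * b ^ N * (1 / (1 - b))" using K(1) b by (intro mult_left_mono sg) auto
      also have "\<dots> = K / (1 - b) * b ^ N" by simp
      finally show ?thesis using N by linarith
    qed
    ultimately have "p * (1 / 2) \<le> (\<Prod>k<n. 1 - cmod (\<alpha> k))" using p by (auto intro!: mult_left_mono)
    then show ?thesis by simp
  qed
  have le: "p / 2 \<le> exp (K / (1 - b))" 
  proof -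
    have "0 \<le> K / (1 - b)" using K(1) b by simp
    then have "1 \<le> exp (K / (1 - b))" by simp
    then show ?thesis using p by linarith
  qed
  show thesis
  proof (rule that[of "p / 2" "exp (K / (1 - b))"])
    show "p / 2 \<le> cmod (poly (\<Phi>' n) z) \<and> cmod (poly (\<Phi>' n) z) \<le> exp (K / (1 - b))" if "cmod z \<le> 1" for n z
      using up'[OF that] order_trans[OF lo2 lo1[OF that]] by blast
  qed (use p le in auto)
qed

text \<open>Up to a positive constant this is the continuation of \<open>1 / D\<close>, see
  \<open>szego_inv_eq\<close>.\<close>

definition d :: "complex \<Rightarrow> complex" where "d z = lim (\<lambda>n. poly (\<Phi>' n) z)"

text \<open>Outside the unit disk the reversal identity bounds \<open>\<Phi> n\<close> by a multiple
  of \<open>R ^ n\<close>; against coefficients of order \<open>b ^ n\<close> this still gives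
  geometric increments as long as \<open>b * R < 1\<close>, which is how the limit reaches radius
  \<open>1 / b\<close>.\<close>

lemma dual_increment:
  assumes "1 \<le> R" 
  obtains K where "K > 0" "\<And>n z. cmod z \<le> R \<Longrightarrow> cmod (poly (\<Phi>' (Suc n)) z - poly (\<Phi>' n) z) \<le> K * (b * R) ^ n"
proof -
  obtain K where K: "K > 0" "\<And>n. cmod (\<alpha> n) \<le> K * b ^ n" by (rule \<alpha>_bound) blast
  obtain c0 M0 where M0: "0 < c0" "c0 \<le> M0" "\<And>n z. cmod z \<le> 1 \<Longrightarrow> c0 \<le> cmod (poly (\<Phi>' n) z) \<and> cmod (poly (\<Phi>' n) z) \<le> M0"
    by (rule dual_bounds) blast
  have mb: "cmod (poly (\<Phi> n) z) \<le> M0 * R ^ n" if "cmod z \<le> R" for n z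
  proof (cases "cmod z \<le> 1")
    case True
    have "cmod (poly (\<Phi> n) z) \<le> M0 * 1" using szego_monic_le_dual[of \<alpha> z n, OF \<alpha>_lt_1 True] M0(3)[OF True, of n] by simp
    also have "\<dots> \<le> M0 * R ^ n" using assms M0 by (intro mult_left_mono) auto
    finally show ?thesis .
  next
    case False
    then have z: "z \<noteq> 0" by auto
    have "cmod (1 / cnj z) \<le> 1" using False z by (simp add: norm_divide divide_le_eq)
    then have "cmod (poly (\<Phi>' n) (1 / cnj z)) \<le> M0" using M0(3) by blast
    moreover have "cmod z ^ n \<le> R ^ n" using that by (intro power_mono) auto
    ultimately have "cmod z ^ n * cmod (poly (\<Phi>' n) (1 / cnj z)) \<le> R ^ n * M0" using assms by (intro mult_mono) auto
    then show ?thesis unfolding szego_monic_reversal[OF z] by (simp add: norm_mult norm_power mult.commute)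
  qed
  show thesis
  proof (rule that[of "K * R * M0"])
    show "0 < K * R * M0" using K M0 assms by simp
    fix n z assume z: "cmod z \<le> R"
    have "cmod (poly (\<Phi>' (Suc n)) z - poly (\<Phi>' n) z) = cmod (\<alpha> n) * (cmod z * cmod (poly (\<Phi> n) z))"
      by (simp add: poly_szego_dual_Suc norm_mult)
    also have "\<dots> \<le> (K * b ^ n) * (R * (M0 * R ^ n))" using K(1) assms M0 b by (intro mult_mono K z mb) auto
    finally show "cmod (poly (\<Phi>' (Suc n)) z - poly (\<Phi>' n) z) \<le> K * R * M0 * (b * R) ^ n"
      by (simp add: power_mult_distrib algebra_simps)
  qed
qed

lemma d_approx:
  assumes "1 \<le> R" "R < 1 / b"
  obtains K where "K > 0" "\<And>n z. cmod z \<le> R \<Longrightarrow> cmod (poly (\<Phi>' n) z - d z) \<le> K * (b * R) ^ n"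
proof -
  obtain K where K: "K > 0" "\<And>n z. cmod z \<le> R \<Longrightarrow> cmod (poly (\<Phi>' (Suc n)) z - poly (\<Phi>' n) z) \<le> K * (b * R) ^ n"
    using dual_increment[OF assms(1)] by blast
  have bR: "0 \<le> b * R" "b * R < 1" using assms b by (auto simp: field_simps)
  show thesis
  proof (rule that[of "K / (1 - b * R)"])
    show "0 < K / (1 - b * R)" using K bR by simp
    show "cmod (poly (\<Phi>' n) z - d z) \<le> K / (1 - b * R) * (b * R) ^ n" if "cmod z \<le> R" for n z
      unfolding d_def by (rule geometric_increments_limit(2)[OF K(2)[OF that] bR])
  qed
qed

lemma dual_tendsto_d:
  assumes "cmod z < 1 / b"
  shows "(\<lambda>n. poly (\<Phi>' n) z) \<longlonglongrightarrow> d z"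
proof -
  define R where "R = max 1 (cmod z)"
  have "1 < 1 / b" using b by simp
  then have R: "1 \<le> R" "R < 1 / b" "cmod z \<le> R" using assms by (auto simp: R_def)
  obtain K where K: "K > 0" "\<And>n z. cmod z \<le> R \<Longrightarrow> cmod (poly (\<Phi>' (Suc n)) z - poly (\<Phi>' n) z) \<le> K * (b * R) ^ n"
    using dual_increment[OF R(1)] by blast
  have bR: "0 \<le> b * R" "b * R < 1" using R b by (auto simp: field_simps)
  show ?thesis unfolding d_def by (rule geometric_increments_limit(1)[OF K(2)[OF R(3)] bR])
qed

lemma d_holomorphic: "d holomorphic_on ball 0 (1 / b)"
proof -
  have "(\<lambda>z. lim (\<lambda>n. poly (\<Phi>' n) z)) holomorphic_on ball 0 (1 / b)"
  proof (rule geometric_increments_holomorphic)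
    fix x :: complex assume x: "x \<in> ball 0 (1 / b)"
    define R where "R = max 1 ((cmod x + 1 / b) / 2)"
    have "1 < 1 / b" using b by simp
    moreover have "cmod x < 1 / b" using x by simp
    ultimately have "1 \<le> R \<and> R < 1 / b \<and> cmod x < R" unfolding R_def by (auto simp: less_max_iff_disj field_simps)
    then have R: "1 \<le> R" "R < 1 / b" "cmod x < R" by auto
    obtain K where K: "K > 0" "\<And>n z. cmod z \<le> R \<Longrightarrow> cmod (poly (\<Phi>' (Suc n)) z - poly (\<Phi>' n) z) \<le> K * (b * R) ^ n"
      using dual_increment[OF R(1)] by blast
    have bR: "0 \<le> b * R" "b * R < 1" using R b by (auto simp: field_simps)
    have "cmod z \<le> R" if "z \<in> cball x (R - cmod x)" for z
      using that norm_triangle_sub[of z x] by (simp add: dist_norm norm_minus_commute)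
    then have c: "cmod z \<le> R" if "z \<in> cball x (R - cmod x)" for z using that by blast
    then have "cball x (R - cmod x) \<subseteq> ball 0 (1 / b)" using R(2) by (fastforce intro: le_less_trans)
    moreover have "\<forall>z\<in>cball x (R - cmod x). \<forall>n. cmod (poly (\<Phi>' (Suc n)) z - poly (\<Phi>' n) z) \<le> K * (b * R) ^ n"
      using K(2) c by blast
    ultimately show "\<exists>r>0. \<exists>K q. cball x r \<subseteq> ball 0 (1 / b) \<and> 0 \<le> q \<and> q < 1 \<and>
           (\<forall>z\<in>cball x r. \<forall>n. cmod (poly (\<Phi>' (Suc n)) z - poly (\<Phi>' n) z) \<le> K * q ^ n)"
      using R(3) bR by (intro exI[of _ "R - cmod x"] conjI exI[of _ K] exI[of _ "b * R"]) auto
  qed (auto intro!: holomorphic_intros)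
  then show ?thesis by (simp add: d_def[abs_def])
qed

lemma d_bounds:
  obtains c0 M0 where "0 < c0" "c0 \<le> M0" "\<And>z. cmod z \<le> 1 \<Longrightarrow> c0 \<le> cmod (d z) \<and> cmod (d z) \<le> M0"
    "\<And>n z. cmod z \<le> 1 \<Longrightarrow> c0 \<le> cmod (poly (\<Phi>' n) z) \<and> cmod (poly (\<Phi>' n) z) \<le> M0"
proof -
  obtain c0 M0 where M0: "0 < c0" "c0 \<le> M0" "\<And>n z. cmod z \<le> 1 \<Longrightarrow> c0 \<le> cmod (poly (\<Phi>' n) z) \<and> cmod (poly (\<Phi>' n) z) \<le> M0"
    by (rule dual_bounds) blast
  have "c0 \<le> cmod (d z) \<and> cmod (d z) \<le> M0" if "cmod z \<le> 1" for z
  proof -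
    have "cmod z < 1 / b" using that b by (intro le_less_trans[OF that]) auto
    then have t: "(\<lambda>n. cmod (poly (\<Phi>' n) z)) \<longlonglongrightarrow> cmod (d z)" by (intro tendsto_norm dual_tendsto_d)
    show ?thesis
      using tendsto_lowerbound[OF t, of c0] tendsto_upperbound[OF t, of M0] M0(3)[OF that] by auto
  qed
  with M0 show thesis using that by blast
qed

lemma d_nonzero: "cmod z \<le> 1 \<Longrightarrow> d z \<noteq> 0"
proof -
  assume "cmod z \<le> 1"
  moreover obtain c0 M0 where "0 < c0" "\<And>z. cmod z \<le> 1 \<Longrightarrow> c0 \<le> cmod (d z) \<and> cmod (d z) \<le> M0"
    by (rule d_bounds) blast
  ultimately show ?thesis by force
qed

lemma d_0 [simp]: "d 0 = 1"
  using LIMSEQ_unique[OF dual_tendsto_d[of 0]] b by auto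

text \<open>The function \<open>F\<close> is the limit of \<open>\<Phi> n z / z ^ n\<close> outside the disk of radius \<open>b\<close>.\<close>

definition F :: "complex \<Rightarrow> complex" where "F z = cnj (d (1 / cnj z))"

text \<open>Replacing \<open>cnj (\<alpha> n) * \<Phi>' n\<close> by
  \<open>cnj C * b ^ n * d\<close> makes two errors: of order \<open>(b * \<Delta>) ^ n\<close> from
  the coefficients and of order \<open>b ^ n * b ^ n\<close> from \<open>\<Phi>' n - d\<close>. This
  is the larger of the two rates.\<close>

definition \<rho> :: real where "\<rho> = b * max \<Delta> b"

text \<open>Subtracting the geometric part of the Verblunsky coefficients from \<open>(z - b) * \<Phi> n z\<close> continues
  the limit across the circle of radius \<open>b\<close>.\<close>

definition X :: "nat \<Rightarrow> complex \<Rightarrow> complex" where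
  "X n z = ((z - b) * poly (\<Phi> n) z - cnj C * d z * b ^ n) / z ^ n"

definition H :: "complex \<Rightarrow> complex" where "H z = lim (\<lambda>n. X n z)"

lemma \<rho>: "0 < \<rho>" "\<rho> < b"
  using b \<Delta> by (auto simp: \<rho>_def)

lemma remainder_bound:
  obtains K where "K > 0" "\<And>n z. cmod z \<le> 1 \<Longrightarrow> cmod (cnj (\<alpha> n) * poly (\<Phi>' n) z - cnj C * of_real (b ^ n) * d z) \<le> K * \<rho> ^ n"
proof -
  obtain K where K: "\<And>n. cmod (\<alpha> n - C * of_real (b ^ n)) \<le> K * (b * \<Delta>) ^ n" using \<alpha>_asymp by blast
  have K0: "0 \<le> K" using order_trans[OF norm_ge_zero K[of 0]] by simp
  obtain c0 M0 where M0: "0 < c0" "c0 \<le> M0" "\<And>n z. cmod z \<le> 1 \<Longrightarrow> c0 \<le> cmod (poly (\<Phi>' n) z) \<and> cmod (poly (\<Phi>' n) z) \<le> M0"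
    by (rule dual_bounds) blast
  obtain K2 where K2: "K2 > 0" "\<And>n z. cmod z \<le> 1 \<Longrightarrow> cmod (poly (\<Phi>' n) z - d z) \<le> K2 * (b * 1) ^ n"
    using d_approx[of 1] b by auto
  show thesis
  proof (rule that[of "K * M0 + cmod C * K2"])
    show "0 < K * M0 + cmod C * K2" using K0 M0 C_nz K2 by (simp add: add_nonneg_pos)
    fix n z assume z: "cmod z \<le> (1::real)"
    have e: "cnj (\<alpha> n) * poly (\<Phi>' n) z - cnj C * of_real (b ^ n) * d z = 
       cnj (\<alpha> n - C * of_real (b ^ n)) * poly (\<Phi>' n) z + cnj C * of_real (b ^ n) * (poly (\<Phi>' n) z - d z)"
      by (simp add: algebra_simps)
    have "cmod (cnj (\<alpha> n) * poly (\<Phi>' n) z - cnj C * of_real (b ^ n) * d z) \<le>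
      cmod (\<alpha> n - C * of_real (b ^ n)) * cmod (poly (\<Phi>' n) z) + cmod C * b ^ n * cmod (poly (\<Phi>' n) z - d z)"
      unfolding e by (rule order_trans[OF norm_triangle_ineq]) (use b in \<open>simp add: norm_mult norm_power del: complex_cnj_diff\<close>)
    also have "\<dots> \<le> K * (b * \<Delta>) ^ n * M0 + cmod C * b ^ n * (K2 * b ^ n)"
      using K K2(2)[OF z] M0(3)[OF z] b M0 K0 \<Delta> by (intro add_mono mult_mono) auto
    also have "\<dots> \<le> K * \<rho> ^ n * M0 + cmod C * (K2 * \<rho> ^ n)"
    proof (intro add_mono mult_right_mono mult_left_mono)
      show "(b * \<Delta>) ^ n \<le> \<rho> ^ n" unfolding \<rho>_def using b \<Delta> by (intro power_mono mult_left_mono) auto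
      have bb: "(b * b) ^ n \<le> \<rho> ^ n" unfolding \<rho>_def using b \<Delta> by (intro power_mono mult_left_mono) auto
      have "cmod C * (K2 * (b * b) ^ n) \<le> cmod C * (K2 * \<rho> ^ n)" by (intro mult_left_mono bb) (use K2 in auto)
      then show "cmod C * b ^ n * (K2 * b ^ n) \<le> cmod C * (K2 * \<rho> ^ n)" by (simp add: power_mult_distrib algebra_simps)
    qed (use K0 M0 in auto)
    finally show "cmod (cnj (\<alpha> n) * poly (\<Phi>' n) z - cnj C * of_real (b ^ n) * d z) \<le> (K * M0 + cmod C * K2) * \<rho> ^ n"
      by (simp add: algebra_simps)
  qed
qed

text \<open>For z different from b, \<open>cnj C * d z * b ^ n / (z - b)\<close> solves the
  recursion \<open>x (Suc n) = z * x n - cnj C * b ^ n * d z\<close> exactly. Once it is subtracted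
  only the remainder drives the recursion; the factor \<open>z - b\<close> clears the pole.\<close>

lemma X_increment:
  assumes "0 < s"
  obtains K where "K > 0" "\<And>n z. \<lbrakk>s \<le> cmod z; cmod z \<le> 1\<rbrakk> \<Longrightarrow> cmod (X (Suc n) z - X n z) \<le> K * (\<rho> / s) ^ n"
proof -
  obtain K where K: "K > 0" "\<And>n z. cmod z \<le> 1 \<Longrightarrow> cmod (cnj (\<alpha> n) * poly (\<Phi>' n) z - cnj C * of_real (b ^ n) * d z) \<le> K * \<rho> ^ n"
    by (rule remainder_bound) blast
  show thesis
  proof (rule that[of "2 * K / s"])
    fix n z assume z: "s \<le> cmod z" "cmod z \<le> 1"
    then have z0: "z \<noteq> 0" using assms by auto
    have "X (Suc n) z - X n z = - (z - b) * (cnj (\<alpha> n) * poly (\<Phi>' n) z - cnj C * of_real (b ^ n) * d z) / z ^ Suc n"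
      using z0 by (simp add: X_def poly_szego_monic_Suc field_simps)
    then have "cmod (X (Suc n) z - X n z) = cmod (z - b) * cmod (cnj (\<alpha> n) * poly (\<Phi>' n) z - cnj C * of_real (b ^ n) * d z) / cmod z ^ Suc n"
      by (simp add: norm_mult norm_divide norm_power norm_minus_commute)
    also have "\<dots> \<le> 2 * (K * \<rho> ^ n) / s ^ Suc n"
    proof (intro frac_le mult_mono K(2) z power_mono)
      have "cmod (z - b) \<le> cmod z + cmod (complex_of_real b)" by (rule norm_triangle_ineq4)
      then show "cmod (z - b) \<le> 2" using z b by simp
    qed (use assms K \<rho> in auto)
    also have "\<dots> = 2 * K / s * (\<rho> / s) ^ n" by (simp add: power_divide)
    finally show "cmod (X (Suc n) z - X n z) \<le> 2 * K / s * (\<rho> / s) ^ n" .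
  qed (use K assms in auto)
qed

lemma X_approx:
  assumes "\<rho> < s"
  obtains K where "K > 0" "\<And>n z. \<lbrakk>s \<le> cmod z; cmod z \<le> 1\<rbrakk> \<Longrightarrow> cmod (X n z - H z) \<le> K * (\<rho> / s) ^ n"
proof -
  have s: "s > 0" using assms \<rho> by simp
  obtain K where K: "K > 0" "\<And>n z. \<lbrakk>s \<le> cmod z; cmod z \<le> 1\<rbrakk> \<Longrightarrow> cmod (X (Suc n) z - X n z) \<le> K * (\<rho> / s) ^ n"
    using X_increment[OF s] by blast
  have q: "0 \<le> \<rho> / s" "\<rho> / s < 1" using assms \<rho> s by auto
  show thesis
  proof (rule that[of "K / (1 - \<rho> / s)"])
    show "cmod (X n z - H z) \<le> K / (1 - \<rho> / s) * (\<rho> / s) ^ n" if z: "s \<le> cmod z" "cmod z \<le> 1" for n z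
      unfolding H_def by (rule geometric_increments_limit(2)[OF K(2)[OF z] q])
  qed (use K q in auto)
qed

lemma X_tendsto:
  assumes "\<rho> < cmod z" "cmod z \<le> 1"
  shows "(\<lambda>n. X n z) \<longlonglongrightarrow> H z"
proof -
  have s: "cmod z > 0" using assms \<rho> by linarith
  obtain K where K: "K > 0" "\<And>n w. \<lbrakk>cmod z \<le> cmod w; cmod w \<le> 1\<rbrakk> \<Longrightarrow> cmod (X (Suc n) w - X n w) \<le> K * (\<rho> / cmod z) ^ n"
    using X_increment[OF s] by blast
  show ?thesis unfolding H_def
    by (rule geometric_increments_limit(1)[where x = "\<lambda>n. X n z", OF K(2)]) (use assms \<rho> s in \<open>auto simp: less_imp_le\<close>)
qed

definition annulus :: "complex set" where "annulus = {z. \<rho> < cmod z \<and> cmod z < 1}"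

lemma open_annulus: "open annulus"
  unfolding annulus_def by (intro open_Collect_conj open_Collect_less continuous_intros)

lemma H_holomorphic: "H holomorphic_on annulus"
proof -
  have "(\<lambda>z. lim (\<lambda>n. X n z)) holomorphic_on annulus"
  proof (rule geometric_increments_holomorphic[OF open_annulus])
    fix n
    have "annulus \<subseteq> ball 0 (1 / b)"
    proof
      fix z assume "z \<in> annulus"
      moreover have "1 < 1 / b" using b by simp
      ultimately show "z \<in> ball 0 (1 / b)" by (auto simp: annulus_def)
    qed
    then have "d holomorphic_on annulus" using d_holomorphic holomorphic_on_subset by blast
    moreover have "z \<noteq> 0" if "z \<in> annulus" for z using that \<rho> by (auto simp: annulus_def)
    ultimately show "X n holomorphic_on annulus" unfolding X_def[abs_def] by (intro holomorphic_intros) auto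
  next
    fix x assume x: "x \<in> annulus"
    define s where "s = (\<rho> + cmod x) / 2"
    have s: "\<rho> < s" "s < cmod x" using x by (auto simp: s_def annulus_def)
    obtain K where K: "K > 0" "\<And>n z. \<lbrakk>s \<le> cmod z; cmod z \<le> 1\<rbrakk> \<Longrightarrow> cmod (X (Suc n) z - X n z) \<le> K * (\<rho> / s) ^ n"
      using X_increment[of s] s \<rho> by auto
    define r where "r = min (cmod x - s) ((1 - cmod x) / 2)"
    have r: "r > 0" using s x by (auto simp: r_def annulus_def)
    have c: "s \<le> cmod z \<and> cmod z < 1" if "z \<in> cball x r" for z
    proof -
      have "cmod (z - x) \<le> r" using that by (simp add: dist_norm norm_minus_commute)
      moreover have "cmod x - cmod z \<le> cmod (z - x)" by (metis norm_minus_commute norm_triangle_ineq2)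
      moreover have "cmod z - cmod x \<le> cmod (z - x)" by (rule norm_triangle_ineq2)
      moreover have "cmod x < 1" using x by (simp add: annulus_def)
      ultimately show ?thesis unfolding r_def by (auto simp: min_def split: if_splits)
    qed
    then have "cball x r \<subseteq> annulus" using s by (fastforce simp: annulus_def)
    moreover have "0 \<le> \<rho> / s" "\<rho> / s < 1" using s \<rho> by auto
    ultimately show "\<exists>r>0. \<exists>K q. cball x r \<subseteq> annulus \<and> 0 \<le> q \<and> q < 1 \<and>
           (\<forall>z\<in>cball x r. \<forall>n. cmod (X (Suc n) z - X n z) \<le> K * q ^ n)"
      using r c K(2) by (intro exI[of _ r] conjI exI[of _ K] exI[of _ "\<rho> / s"]) (auto simp: less_imp_le)
  qed
  then show ?thesis by (simp add: H_def[abs_def])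
qed

text \<open>At \<open>b\<close> the polynomial drops out of \<open>X n\<close>. The value is not 0,
  so \<open>H\<close> has isolated zeros and, in the logarithmic coordinate, \<open>P 0\<close> is
  not 0.\<close>

lemma H_b: "H b = - cnj C * d b"
proof -
  have "X n b = - cnj C * d b" for n using b by (simp add: X_def)
  then show ?thesis by (simp add: H_def)
qed

text \<open>Outside the circle of radius \<open>b\<close> the subtracted term dies out like
  \<open>(b / z) ^ n\<close>. Hence \<open>H\<close> continues \<open>(z - b) * F z\<close> across
  that circle.\<close>

lemma H_eq_F:
  assumes "b < cmod z" "cmod z < 1"
  shows "H z = (z - b) * F z"
proof -
  have z0: "z \<noteq> 0" using assms b by auto
  have "cmod (1 / cnj z) < 1 / b" using assms b z0 by (simp add: norm_divide frac_less2)
  then have "(\<lambda>n. cnj (poly (\<Phi>' n) (1 / cnj z))) \<longlonglongrightarrow> F z"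
    unfolding F_def by (intro tendsto_cnj dual_tendsto_d)
  moreover have "cmod (b / z) < 1" using assms b z0 by (simp add: norm_divide)
  then have "(\<lambda>n. (b / z) ^ n) \<longlonglongrightarrow> 0" by (rule LIMSEQ_power_zero)
  ultimately have "(\<lambda>n. (z - b) * cnj (poly (\<Phi>' n) (1 / cnj z)) - cnj C * d z * (b / z) ^ n) \<longlonglongrightarrow> (z - b) * F z - cnj C * d z * 0"
    by (intro tendsto_diff tendsto_mult tendsto_const)
  moreover have "(z - b) * cnj (poly (\<Phi>' n) (1 / cnj z)) - cnj C * d z * (b / z) ^ n = X n z" for n
    unfolding X_def szego_monic_reversal[OF z0] using z0 by (simp add: field_simps)
  ultimately have "(\<lambda>n. X n z) \<longlonglongrightarrow> (z - b) * F z" by simp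
  moreover have "(\<lambda>n. X n z) \<longlonglongrightarrow> H z" using assms \<rho> by (intro X_tendsto) auto
  ultimately show ?thesis by (rule LIMSEQ_unique[symmetric])
qed

end

section \<open>Counting polynomial zeros with Rouche's theorem\<close>

lemma zorder_poly_eq_order:
  fixes p :: "complex poly"
  assumes "p \<noteq> 0"
  shows "zorder (poly p) x = int (order x p)"
proof -
  obtain q where q: "p = [:- x, 1:] ^ order x p * q" "\<not> [:- x, 1:] dvd q"
    using order_decomp[OF assms] by blast
  show ?thesis
  proof (rule zorder_eqI[of UNIV])
    show "poly q x \<noteq> 0" using q(2) by (simp add: poly_eq_0_iff_dvd)
    fix w assume "w \<noteq> x"
    show "poly p w = poly q w * (w - x) powi int (order x p)"
      by (subst q(1)) (simp add: poly_power mult.commute)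
  qed (auto intro!: holomorphic_intros)
qed

lemma size_filter_proots:
  fixes p :: "complex poly"
  assumes "p \<noteq> 0"
  shows "size {# x \<in># proots p. x \<in> A #} = (\<Sum>x\<in>{x\<in>A. poly p x = 0}. order x p)"
proof -
  have "set_mset {# x \<in># proots p. x \<in> A #} = {x\<in>A. poly p x = 0}" using assms by auto
  moreover have "count {# x \<in># proots p. x \<in> A #} x = order x p" if "x \<in> A" for x
    using assms that by simp
  ultimately show ?thesis by (simp add: size_multiset_overloaded_eq)
qed

text \<open>The general theorem weights zeros in an open set by winding numbers. Along a circle
  these are 1 inside and 0 outside, and the strict inequality excludes zeros on the circle, so the
  sums shrink to the disc.\<close>

lemma rouche_circle:
  assumes hol: "f holomorphic_on ball p R" "g holomorphic_on ball p R" and \<delta>: "0 < \<delta>" "\<delta> < R"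
    and fin: "finite {z\<in>ball p R. f z = 0}" "finite {z\<in>ball p R. f z + g z = 0}"
    and less: "\<And>z. z \<in> sphere p \<delta> \<Longrightarrow> cmod (g z) < cmod (f z)"
  shows "(\<Sum>z\<in>{z\<in>ball p \<delta>. f z + g z = 0}. zorder (\<lambda>z. f z + g z) z) = (\<Sum>z\<in>{z\<in>ball p \<delta>. f z = 0}. zorder f z)"
proof -
  let ?\<gamma> = "circlepath p \<delta>"
  have R: "(\<Sum>z\<in>{z\<in>ball p R. f z + g z = 0}. winding_number ?\<gamma> z * zorder (\<lambda>z. f z + g z) z)
        = (\<Sum>z\<in>{z\<in>ball p R. f z = 0}. winding_number ?\<gamma> z * zorder f z)"
  proof (rule Rouche_theorem)
    show "\<forall>z. z \<notin> ball p R \<longrightarrow> winding_number ?\<gamma> z = 0"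
    proof (intro allI impI)
      fix z assume "z \<notin> ball p R"
      then show "winding_number ?\<gamma> z = 0" using \<delta>
        by (intro winding_number_zero_outside[of _ "cball p \<delta>"]) auto
    qed
  qed (use assms in \<open>auto simp: dist_norm\<close>)
  have W: "(\<Sum>z\<in>{z\<in>ball p R. h z = 0}. winding_number ?\<gamma> z * of_int (zorder h z)) = of_int (\<Sum>z\<in>{z\<in>ball p \<delta>. h z = 0}. zorder h z)"
    if fin: "finite {z\<in>ball p R. h z = 0}" and nz: "\<And>z. z \<in> sphere p \<delta> \<Longrightarrow> h z \<noteq> 0" for h :: "complex \<Rightarrow> complex"
  proof -
    have "(\<Sum>z\<in>{z\<in>ball p R. h z = 0}. winding_number ?\<gamma> z * of_int (zorder h z))
        = (\<Sum>z\<in>{z\<in>ball p \<delta>. h z = 0}. of_int (zorder h z))"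
    proof (rule sum.mono_neutral_cong_right[OF fin])
      show "{z\<in>ball p \<delta>. h z = 0} \<subseteq> {z\<in>ball p R. h z = 0}" using \<delta> by auto
      show "\<forall>z\<in>{z\<in>ball p R. h z = 0} - {z\<in>ball p \<delta>. h z = 0}. winding_number ?\<gamma> z * of_int (zorder h z) = 0"
      proof
        fix z assume z: "z \<in> {z\<in>ball p R. h z = 0} - {z\<in>ball p \<delta>. h z = 0}"
        then have "z \<notin> cball p \<delta>" using nz[of z] by force
        then have "winding_number ?\<gamma> z = 0" using \<delta> by (intro winding_number_zero_outside[of _ "cball p \<delta>"]) auto
        then show "winding_number ?\<gamma> z * of_int (zorder h z) = 0" by simp
      qed
      show "winding_number ?\<gamma> z * of_int (zorder h z) = of_int (zorder h z)" if "z \<in> {z\<in>ball p \<delta>. h z = 0}" for z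
        using that winding_number_circlepath[of z p \<delta>] by (simp add: dist_norm norm_minus_commute)
    qed
    then show ?thesis by simp
  qed
  have n1: "f z \<noteq> 0" if "z \<in> sphere p \<delta>" for z using less[OF that] by auto
  have n2: "f z + g z \<noteq> 0" if "z \<in> sphere p \<delta>" for z
  proof
    assume "f z + g z = 0"
    then have "g z = - f z" by (simp add: eq_neg_iff_add_eq_0 add.commute)
    then show False using less[OF that] by simp
  qed
  note w2 = W[of "\<lambda>z. f z + g z", OF fin(2)] and w1 = W[of f, OF fin(1)]
  have "complex_of_int (\<Sum>z\<in>{z\<in>ball p \<delta>. f z + g z = 0}. zorder (\<lambda>z. f z + g z) z)
      = of_int (\<Sum>z\<in>{z\<in>ball p \<delta>. f z = 0}. zorder f z)"
    by (subst w2[symmetric], erule n2, subst w1[symmetric], erule n1, rule R)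
  then show ?thesis by (simp only: of_int_eq_iff)
qed

lemma rouche_poly_count:
  fixes q :: "complex poly"
  assumes q: "q \<noteq> 0" and hol: "f holomorphic_on ball p R" and \<delta>: "0 < \<delta>" "\<delta> < R"
    and f: "\<And>z. z \<in> ball p R \<Longrightarrow> f z = 0 \<longleftrightarrow> z = p"
    and less: "\<And>z. z \<in> sphere p \<delta> \<Longrightarrow> cmod (poly q z - f z) < cmod (f z)"
  shows "int (size {# x \<in># proots q. x \<in> ball p \<delta> #}) = zorder f p"
proof -
  have "finite {z\<in>ball p R. f z + (poly q z - f z) = 0}"
    using poly_roots_finite[OF q] by (rule finite_subset[rotated]) auto
  moreover have "{z\<in>ball p R. f z = 0} = {p}" using f \<delta> by auto
  ultimately have "(\<Sum>z\<in>{z\<in>ball p \<delta>. f z + (poly q z - f z) = 0}. zorder (\<lambda>z. f z + (poly q z - f z)) z) = (\<Sum>z\<in>{z\<in>ball p \<delta>. f z = 0}. zorder f z)"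
    using less hol \<delta> by (intro rouche_circle[of _ _ R]) (auto intro!: holomorphic_intros)
  moreover have "{z\<in>ball p \<delta>. f z = 0} = {p}" using f \<delta> by auto
  ultimately have "(\<Sum>z\<in>{z\<in>ball p \<delta>. poly q z = 0}. zorder (poly q) z) = zorder f p" by simp
  then show ?thesis unfolding size_filter_proots[OF q] zorder_poly_eq_order[OF q] by simp
qed

section \<open>The limit outside the critical circle and the width of the strip\<close>

context geometric_verblunsky
begin

text \<open>Conjugating a holomorphic function both inside and outside gives a holomorphic function;
  here it is applied to \<open>d (1 / z)\<close>.\<close>

lemma F_holomorphic: "F holomorphic_on {z. b < cmod z}"
proof -
  have "(cnj \<circ> (\<lambda>z. d (1 / z)) \<circ> cnj) holomorphic_on {z. b < cmod z}"
  proof (subst holomorphic_on_compose_cnj_cnj)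
    have "cnj ` {z. b < cmod z} = {z. b < cmod z}"
      by (auto simp: image_iff intro!: exI[of _ "cnj _"])
    moreover have "(d \<circ> (\<lambda>z. 1 / z)) holomorphic_on {z. b < cmod z}"
    proof (rule holomorphic_on_compose_gen[OF _ d_holomorphic])
      show "(\<lambda>z. 1 / z) holomorphic_on {z. b < cmod z}" using b by (intro holomorphic_intros) auto
      show "(\<lambda>z. 1 / z) ` {z. b < cmod z} \<subseteq> ball 0 (1 / b)"
        using b by (auto simp: norm_divide frac_less2)
    qed
    ultimately show "(\<lambda>z. d (1 / z)) holomorphic_on cnj ` {z. b < cmod z}" by (simp add: o_def)
    show "open {z::complex. b < cmod z}" by (intro open_Collect_less continuous_intros)
  qed auto
  then show ?thesis by (simp add: F_def[abs_def] o_def)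
qed

lemma F_nonzero: "F z \<noteq> 0" if "1 \<le> cmod z"
proof -
  have "z \<noteq> 0" using that by auto
  then have "cmod (1 / cnj z) \<le> 1" using that by (simp add: norm_divide divide_le_eq)
  then show ?thesis using d_nonzero unfolding F_def by simp
qed

lemma monic_nonzero: "poly (\<Phi> n) z \<noteq> 0" if "1 \<le> cmod z"
proof -
  obtain c0 M0 where c: "0 < c0" "\<And>n z. cmod z \<le> 1 \<Longrightarrow> c0 \<le> cmod (poly (\<Phi>' n) z) \<and> cmod (poly (\<Phi>' n) z) \<le> M0"
    by (rule d_bounds) blast
  have z: "z \<noteq> 0" using that by auto
  then have "cmod (1 / cnj z) \<le> 1" using that by (simp add: norm_divide divide_le_eq)
  then have "poly (\<Phi>' n) (1 / cnj z) \<noteq> 0" using c(2)[of "1 / cnj z" n] c(1) by auto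
  then show ?thesis unfolding szego_monic_reversal[OF z] using z by simp
qed

text \<open>This is the convergence of the reversed polynomials on the disk of radius
  \<open>1 / r\<close>, carried over by reversal; the error is therefore relative to
  \<open>|z| ^ n\<close>.\<close>

lemma monic_approx_F:
  assumes "b < r" "r < 1"
  obtains K where "K > 0" "\<And>n z. r \<le> cmod z \<Longrightarrow> cmod (poly (\<Phi> n) z - z ^ n * F z) \<le> cmod z ^ n * (K * (b / r) ^ n)"
proof -
  have R: "1 \<le> 1 / r" "1 / r < 1 / b" using assms b by (auto simp: frac_less2)
  obtain K where K: "K > 0" "\<And>n z. cmod z \<le> 1 / r \<Longrightarrow> cmod (poly (\<Phi>' n) z - d z) \<le> K * (b * (1 / r)) ^ n"
    using d_approx[OF R] by blast
  show thesis
  proof (rule that[OF K(1)])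
    fix n z assume z: "r \<le> cmod z"
    then have z0: "z \<noteq> 0" using assms b by auto
    have "cmod (1 / cnj z) \<le> 1 / r" using z assms b by (simp add: norm_divide frac_le)
    from K(2)[OF this] have "cmod (poly (\<Phi>' n) (1 / cnj z) - d (1 / cnj z)) \<le> K * (b / r) ^ n" by simp
    moreover have "poly (\<Phi> n) z - z ^ n * F z = z ^ n * cnj (poly (\<Phi>' n) (1 / cnj z) - d (1 / cnj z))"
      unfolding szego_monic_reversal[OF z0] F_def by (simp add: algebra_simps)
    then have "cmod (poly (\<Phi> n) z - z ^ n * F z) = cmod z ^ n * cmod (poly (\<Phi>' n) (1 / cnj z) - d (1 / cnj z))"
      by (simp only: norm_mult norm_power complex_mod_cnj)
    ultimately show "cmod (poly (\<Phi> n) z - z ^ n * F z) \<le> cmod z ^ n * (K * (b / r) ^ n)"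
      by (simp add: mult_left_mono)
  qed
qed

text \<open>As \<open>H b\<close> is not 0, \<open>H\<close> has finitely many zeros in a compact
  annulus around the critical circle, and a thinner annulus avoids all of them that are off the
  circle.\<close>

lemma strip_exists:
  obtains \<eta> where "0 < \<eta>" "max \<Delta> b * exp (2 * \<eta>) < 1"
    "\<And>z. \<lbrakk>b * exp (- \<eta>) < cmod z; cmod z < b * exp \<eta>; H z = 0\<rbrakk> \<Longrightarrow> cmod z = b"
proof -
  define m where "m = max \<Delta> b"
  have m: "0 < m" "m < 1" "b \<le> m" using b \<Delta> by (auto simp: m_def)
  \<comment> \<open>Then \<open>m = exp (- 4 * \<eta>1)\<close>, so even after a factor
    \<open>exp (2 * \<eta>1)\<close> it stays below 1, and the annulus of log-width
    \<open>\<eta>1\<close> lies inside the domain of \<open>H\<close>.\<close>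
  define \<eta>1 where "\<eta>1 = - ln m / 4"
  have \<eta>1: "0 < \<eta>1" using m by (simp add: \<eta>1_def)
  have ml: "m = exp (- 4 * \<eta>1)" using m by (simp add: \<eta>1_def)
  have m2: "m * exp (2 * \<eta>1) < 1" using \<eta>1 unfolding ml by (simp flip: exp_add)
  have "b * exp \<eta>1 \<le> m * exp \<eta>1" using m by simp
  also have "m * exp \<eta>1 < 1" using \<eta>1 unfolding ml by (simp flip: exp_add)
  finally have t1: "b * exp \<eta>1 < 1" .
  have "m < exp (- \<eta>1)" using \<eta>1 unfolding ml by simp
  then have r1: "\<rho> < b * exp (- \<eta>1)" using b by (simp add: \<rho>_def m_def)
  define A where "A = cball (0::complex) (b * exp \<eta>1) - ball 0 (b * exp (- \<eta>1))"
  have cA: "compact A" unfolding A_def by (intro compact_diff) auto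
  have sA: "A \<subseteq> annulus" unfolding A_def annulus_def using t1 r1 by auto
  have con: "connected annulus" using connected_annulus(1)[of \<rho> "0::complex" 1] by (simp add: annulus_def)
  have nz: "H b \<noteq> 0" unfolding H_b using C_nz d_nonzero[of b] b by simp
  have fin: "finite {z\<in>A. H z = 0}"
  proof (cases "H constant_on annulus")
    case True
    then obtain c where c: "\<And>z. z \<in> annulus \<Longrightarrow> H z = c" unfolding constant_on_def by blast
    have "complex_of_real b \<in> annulus" using b \<rho> by (simp add: annulus_def)
    then have "H z \<noteq> 0" if "z \<in> A" for z using c that sA nz by (metis subsetD)
    then have "{z\<in>A. H z = 0} = {}" by auto
    then show ?thesis by (metis finite.emptyI)
  next
    case False
    then show ?thesis by (rule holomorphic_compact_finite_zeros[OF H_holomorphic open_annulus con cA sA])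
  qed
  \<comment> \<open>Inserting \<open>\<eta>1\<close> makes the minimum exist when there are no such
    zeros and keeps it at most \<open>\<eta>1\<close>.\<close>
  define B where "B = insert \<eta>1 ((\<lambda>z. \<bar>ln (cmod z / b)\<bar>) ` {z\<in>A. H z = 0 \<and> cmod z \<noteq> b})"
  have finB: "finite B" unfolding B_def using fin by (auto intro!: finite_imageI elim: finite_subset[rotated])
  have posB: "x > 0" if "x \<in> B" for x
  proof -
    have "\<bar>ln (cmod z / b)\<bar> > 0" if "z \<in> A" "cmod z \<noteq> b" for z
    proof -
      have "cmod z > 0" using that(1) b sA \<rho> unfolding annulus_def by force
      then show ?thesis using that(2) b by (auto simp: ln_div)
    qed
    then show ?thesis using that \<eta>1 unfolding B_def by auto
  qed
  have neB: "B \<noteq> {}" by (simp add: B_def)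
  define \<eta> where "\<eta> = Min B"
  have \<eta>: "0 < \<eta>" unfolding \<eta>_def using Min_gr_iff[OF finB neB, of 0] posB by blast
  have le: "\<eta> \<le> x" if "x \<in> B" for x unfolding \<eta>_def using finB that by (rule Min_le)
  have \<eta>le: "\<eta> \<le> \<eta>1" by (rule le) (simp add: B_def)
  show thesis
  proof (rule that[OF \<eta>])
    have "m * exp (2 * \<eta>) \<le> m * exp (2 * \<eta>1)" using \<eta>le m by (intro mult_left_mono) auto
    then show "max \<Delta> b * exp (2 * \<eta>) < 1" using m2 by (simp add: m_def)
    fix z assume z: "b * exp (- \<eta>) < cmod z" "cmod z < b * exp \<eta>" "H z = 0"
    show "cmod z = b"
    proof (rule ccontr)
      assume ne: "cmod z \<noteq> b"
      have "b * exp (- \<eta>1) \<le> b * exp (- \<eta>)" "b * exp \<eta> \<le> b * exp \<eta>1" using \<eta>le b by auto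
      then have "z \<in> A" using z unfolding A_def by auto
      then have "\<bar>ln (cmod z / b)\<bar> \<in> B" using ne z(3) unfolding B_def by auto
      then have "\<eta> \<le> \<bar>ln (cmod z / b)\<bar>" by (rule le)
      moreover have "cmod z / b > 0" using z(1) b by (meson divide_pos_pos exp_gt_zero less_trans mult_pos_pos)
      moreover have "exp (- \<eta>) < cmod z / b" "cmod z / b < exp \<eta>" using z b by (auto simp: field_simps)
      then have "- \<eta> < ln (cmod z / b)" "ln (cmod z / b) < \<eta>"
        using \<open>cmod z / b > 0\<close> by (metis exp_gt_zero ln_exp ln_less_cancel_iff)+
      ultimately show False by linarith
    qed
  qed
qed

end

section \<open>The zeros in the logarithmic coordinate\<close>

locale geometric_strip = geometric_verblunsky +
  fixes \<eta> :: real
  assumes \<eta>: "0 < \<eta>" and \<eta>_small: "max \<Delta> b * exp (2 * \<eta>) < 1"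
    and H_zeros: "\<And>z. \<lbrakk>b * exp (- \<eta>) < cmod z; cmod z < b * exp \<eta>; H z = 0\<rbrakk> \<Longrightarrow> cmod z = b"
begin

lemma strip_bounds: "b * exp \<eta> < 1" "\<rho> < b * exp (- \<eta>)"
proof -
  have "b * exp \<eta> \<le> max \<Delta> b * exp (2 * \<eta>)" using b \<eta> by (intro mult_mono) auto
  then show "b * exp \<eta> < 1" using \<eta>_small by simp
  have "max \<Delta> b < exp (- (2 * \<eta>))" unfolding exp_minus inverse_eq_divide
    using \<eta>_small by (subst pos_less_divide_eq) simp_all
  also have "\<dots> \<le> exp (- \<eta>)" using \<eta> by simp
  finally show "\<rho> < b * exp (- \<eta>)" using b by (simp add: \<rho>_def)
qed

definition P :: "complex \<Rightarrow> complex" where "P u = H (of_real b * exp u)"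

text \<open>Defined as the difference that makes \<open>exp (n * u) * P u = Q n u\<close> exactly
  equivalent to \<open>(z - b) * \<Phi> n z = 0\<close> at \<open>z = b * exp u\<close>. All the
  analysis goes into showing that it is nearly independent of n.\<close>

definition Q :: "nat \<Rightarrow> complex \<Rightarrow> complex" where
  "Q n u = exp (of_nat n * u) * P u - (of_real b * exp u - of_real b) * poly (\<Phi> n) (of_real b * exp u) / of_real b ^ n"

lemma strip_image:
  fixes u :: complex
  shows "\<bar>Re u\<bar> < \<eta> \<Longrightarrow> b * exp (- \<eta>) < cmod (b * exp u) \<and> cmod (b * exp u) < b * exp \<eta>"
  using b by (auto simp: norm_mult)

lemma strip_annulus:
  fixes u :: complex
  shows "\<bar>Re u\<bar> < \<eta> \<Longrightarrow> b * exp u \<in> annulus"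
  using strip_image[of u] strip_bounds unfolding annulus_def by auto

lemma P_holomorphic: "P holomorphic_on {u. \<bar>Re u\<bar> < \<eta>}"
proof -
  have "(H \<circ> (\<lambda>u. b * exp u)) holomorphic_on {u. \<bar>Re u\<bar> < \<eta>}"
    by (rule holomorphic_on_compose_gen[OF _ H_holomorphic]) (auto intro!: holomorphic_intros strip_annulus)
  then show ?thesis by (simp add: P_def[abs_def] o_def)
qed

lemma Q_holomorphic: "Q n holomorphic_on {u. \<bar>Re u\<bar> < \<eta>}"
  unfolding Q_def[abs_def] using b
  by (intro holomorphic_intros P_holomorphic) auto

text \<open>The deviation equals \<open>(z / b) ^ n * (H z - X n z)\<close>. The strip costs
  \<open>exp \<eta>\<close> in the first factor and again in the rate \<open>\<rho> / |z|\<close> of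
  the second; this is the origin of \<open>exp (2 * \<eta>)\<close> in the choice of \<eta>.\<close>

lemma Q_approx:
  obtains K \<theta> where "K > 0" "0 < \<theta>" "\<theta> < 1" "\<And>n (u::complex). \<bar>Re u\<bar> < \<eta> \<Longrightarrow> cmod (Q n u + cnj C * d (b * exp u)) \<le> K * \<theta> ^ n"
proof -
  obtain K where K: "K > 0" "\<And>n z. \<lbrakk>b * exp (- \<eta>) \<le> cmod z; cmod z \<le> 1\<rbrakk> \<Longrightarrow> cmod (X n z - H z) \<le> K * (\<rho> / (b * exp (- \<eta>))) ^ n"
    using X_approx[OF strip_bounds(2)] by blast
  show thesis
  proof (rule that[OF K(1)])
    show "0 < max \<Delta> b * exp (2 * \<eta>)" using b by simp
    show "max \<Delta> b * exp (2 * \<eta>) < 1" by (rule \<eta>_small)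
    fix n u assume u: "\<bar>Re u\<bar> < \<eta>"
    define z where "z = b * exp u"
    have z: "b * exp (- \<eta>) \<le> cmod z" "cmod z \<le> 1" "cmod z \<le> b * exp \<eta>"
      using strip_image[OF u] strip_bounds(1) unfolding z_def by auto
    have z0: "z \<noteq> 0" using b by (simp add: z_def)
    have e: "exp (of_nat n * u) = (z / b) ^ n" using b by (simp add: z_def exp_of_nat_mult)
    have "Q n u + cnj C * d z = (z / b) ^ n * (H z - X n z)"
      using z0 b unfolding Q_def P_def e z_def[symmetric] X_def by (simp add: field_simps)
    then have "cmod (Q n u + cnj C * d z) = (cmod z / b) ^ n * cmod (X n z - H z)"
      using b by (simp add: norm_mult norm_power norm_divide norm_minus_commute)
    also have "\<dots> \<le> (exp \<eta>) ^ n * (K * (\<rho> / (b * exp (- \<eta>))) ^ n)"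
      using z b K \<rho> by (intro mult_mono power_mono K(2)) (auto simp: field_simps)
    also have "\<dots> = K * (exp \<eta> * (\<rho> / (b * exp (- \<eta>)))) ^ n"
      by (simp only: power_mult_distrib mult.left_commute)
    also have "exp \<eta> * (\<rho> / (b * exp (- \<eta>))) = max \<Delta> b * (exp \<eta> * exp \<eta>)"
      using b by (simp add: \<rho>_def exp_minus field_simps)
    also have "exp \<eta> * exp \<eta> = exp (2 * \<eta>)" by (simp flip: exp_add)
    finally show "cmod (Q n u + cnj C * d (b * exp u)) \<le> K * (max \<Delta> b * exp (2 * \<eta>)) ^ n"
      by (simp add: z_def)
  qed
qed

lemma Q_bounds:
  obtains q0 q1 where "0 < q0" "\<forall>\<^sub>F n in sequentially. \<forall>u. \<bar>Re u\<bar> < \<eta> \<longrightarrow> q0 \<le> cmod (Q n u) \<and> cmod (Q n u) \<le> q1"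
proof -
  obtain c0 M0 where c: "0 < c0" "\<And>z. cmod z \<le> 1 \<Longrightarrow> c0 \<le> cmod (d z) \<and> cmod (d z) \<le> M0"
    by (rule d_bounds) blast
  obtain K \<theta> where K: "K > 0" "0 < \<theta>" "\<theta> < 1" "\<And>n (u::complex). \<bar>Re u\<bar> < \<eta> \<Longrightarrow> cmod (Q n u + cnj C * d (b * exp u)) \<le> K * \<theta> ^ n"
    by (rule Q_approx) blast
  define q0 where "q0 = cmod C * c0 / 2"
  have q0: "q0 > 0" using C_nz c by (simp add: q0_def)
  have "(\<lambda>n. \<theta> ^ n) \<longlonglongrightarrow> 0" using K by (intro LIMSEQ_realpow_zero) auto
  then have "(\<lambda>n. K * \<theta> ^ n) \<longlonglongrightarrow> 0" by (rule tendsto_mult_right_zero)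
  then have "\<forall>\<^sub>F n in sequentially. K * \<theta> ^ n < q0" using q0 by (rule order_tendstoD)
  then have "\<forall>\<^sub>F n in sequentially. \<forall>u. \<bar>Re u\<bar> < \<eta> \<longrightarrow> q0 \<le> cmod (Q n u) \<and> cmod (Q n u) \<le> cmod C * M0 + q0"
  proof eventually_elim
    case (elim n)
    show ?case
    proof (intro allI impI)
      fix u assume u: "\<bar>Re u\<bar> < \<eta>"
      define w where "w = cnj C * d (b * exp u)"
      have "cmod (b * exp u) \<le> 1" using strip_annulus[OF u] by (simp add: annulus_def)
      note cc = c(2)[OF this]
      have "cmod w = cmod C * cmod (d (b * exp u))" by (simp add: w_def norm_mult)
      then have w: "cmod C * c0 \<le> cmod w" "cmod w \<le> cmod C * M0" using cc by (auto intro: mult_left_mono)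
      have "cmod (Q n u + w) < q0" using K(4)[OF u, of n] elim by (simp add: w_def)
      moreover have "cmod w - cmod (Q n u) \<le> cmod (Q n u + w)"
        using norm_triangle_ineq2[of w "- Q n u"] by (simp add: add.commute)
      moreover have "cmod (Q n u) - cmod w \<le> cmod (Q n u + w)"
        using norm_triangle_ineq2[of "Q n u" "- w"] by simp
      ultimately show "q0 \<le> cmod (Q n u) \<and> cmod (Q n u) \<le> cmod C * M0 + q0"
        using w unfolding q0_def by (auto simp: field_simps)
    qed
  qed
  then show thesis by (rule that[OF q0])
qed

text \<open>Halving the strip leaves discs of radius \<eta> / 4 around its points inside the
  original one, so Cauchy's inequality turns the bound on \<open>Q n\<close> into one on its
  derivative.\<close>

lemma exponential_lattice_strip:
  obtains q0 q1 q2 where "exponential_lattice (\<eta> / 2) (\<eta> / 4) P Q q0 q1 q2"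
proof -
  obtain q0 q1 where q: "0 < q0" "\<forall>\<^sub>F n in sequentially. \<forall>u. \<bar>Re u\<bar> < \<eta> \<longrightarrow> q0 \<le> cmod (Q n u) \<and> cmod (Q n u) \<le> q1"
    by (rule Q_bounds)
  have "exponential_lattice (\<eta> / 2) (\<eta> / 4) P Q q0 q1 (q1 / (\<eta> / 4))"
  proof
    show "0 < \<eta> / 4" "\<eta> / 4 < \<eta> / 2" "0 < q0" using \<eta> q by auto
    show "P holomorphic_on {u. \<bar>Re u\<bar> < \<eta> / 2}" "Q n holomorphic_on {u. \<bar>Re u\<bar> < \<eta> / 2}" for n
      using \<eta> by (rule_tac holomorphic_on_subset[OF P_holomorphic] holomorphic_on_subset[OF Q_holomorphic], auto)+
    show "P 0 \<noteq> 0" using H_b C_nz d_nonzero[of b] b by (simp add: P_def)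
    show "Re u = 0" if "\<bar>Re u\<bar> < \<eta> / 2" "P u = 0" for u
    proof -
      have "\<bar>Re u\<bar> < \<eta>" using that \<eta> by linarith
      from H_zeros[of "b * exp u"] strip_image[OF this] that(2) have "cmod (b * exp u) = b"
        unfolding P_def by blast
      then show ?thesis using b by (simp add: norm_mult)
    qed
    show "\<forall>\<^sub>F n in sequentially. \<forall>u. \<bar>Re u\<bar> < \<eta> / 2 \<longrightarrow>
        q0 \<le> cmod (Q n u) \<and> cmod (Q n u) \<le> q1 \<and> cmod (deriv (Q n) u) \<le> q1 / (\<eta> / 4)"
      using q(2)
    proof eventually_elim
      case (elim n)
      show ?case
      proof (intro allI impI conjI)
        fix u :: complex assume u: "\<bar>Re u\<bar> < \<eta> / 2"
        then show "q0 \<le> cmod (Q n u)" "cmod (Q n u) \<le> q1" using elim \<eta> by auto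
        have sub: "cball u (\<eta> / 4) \<subseteq> {u. \<bar>Re u\<bar> < \<eta>}"
        proof
          fix v assume "v \<in> cball u (\<eta> / 4)"
          then have "\<bar>Re (v - u)\<bar> \<le> \<eta> / 4" using abs_Re_le_cmod[of "v - u"] by (simp add: dist_norm norm_minus_commute)
          then have "\<bar>Re v\<bar> < \<eta>" using u \<eta> unfolding minus_complex.sel by linarith
          then show "v \<in> {u. \<bar>Re u\<bar> < \<eta>}" by simp
        qed
        have "cmod ((deriv ^^ 1) (Q n) u) \<le> fact 1 * q1 / (\<eta> / 4) ^ 1"
        proof (rule Cauchy_inequality)
          show "Q n holomorphic_on ball u (\<eta> / 4)" "continuous_on (cball u (\<eta> / 4)) (Q n)"
            using Q_holomorphic sub ball_subset_cball by (blast intro: holomorphic_on_subset holomorphic_on_imp_continuous_on)+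
          show "cmod (Q n x) \<le> q1" if "cmod (u - x) = \<eta> / 4" for x
            using elim sub that by (auto simp: subset_iff dist_norm)
        qed (use \<eta> in auto)
        then show "cmod (deriv (Q n) u) \<le> q1 / (\<eta> / 4)" by simp
      qed
    qed
  qed
  then show thesis by (rule that)
qed

text \<open>The logarithmic coordinates of the zeros of \<open>(z - b) * \<Phi> n z\<close> near the circle of radius \<open>b\<close>; the
  spurious zero \<open>b\<close> sits at the origin.\<close>

definition log_zeros :: "nat \<Rightarrow> complex set" where
  "log_zeros n = {u. \<bar>Re u\<bar> < \<eta> / 4 \<and> (of_real b * exp u - of_real b) * poly (\<Phi> n) (of_real b * exp u) = 0}"

lemma log_zeros_lattice:
  obtains K where "K > 0" "\<forall>\<^sub>F n in sequentially. \<forall>u\<in>log_zeros n. -5 \<le> Im u \<longrightarrow> Im u \<le> 15 \<longrightarrow>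
     \<bar>Re u\<bar> \<le> K * ln n / n \<and>
     deriv (\<lambda>u::complex. (b * exp u - b) * poly (\<Phi> n) (b * exp u) / b ^ n) u \<noteq> 0 \<and>
     (\<exists>v\<in>log_zeros n. cmod (of_nat n * (v - u) - 2 * pi * \<i>) \<le> K / ln n) \<and>
     (\<forall>v\<in>log_zeros n. -5 \<le> Im v \<longrightarrow> Im v \<le> 15 \<longrightarrow> v \<noteq> u \<longrightarrow> 2 * pi - K / ln n \<le> n * \<bar>Im u - Im v\<bar>)"
proof -
  obtain q0 q1 q2 where "exponential_lattice (\<eta> / 2) (\<eta> / 4) P Q q0 q1 q2"
    by (rule exponential_lattice_strip)
  then interpret EL: exponential_lattice "\<eta> / 2" "\<eta> / 4" P Q q0 q1 q2 .
  have Z: "EL.Z n = log_zeros n" for n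
    using b unfolding EL.Z_def log_zeros_def by (auto simp: Q_def)
  have D: "(\<lambda>u. exp (of_nat n * u) * P u - Q n u) = (\<lambda>u::complex. (b * exp u - b) * poly (\<Phi> n) (b * exp u) / b ^ n)" for n
    by (simp add: Q_def fun_eq_iff)
  show thesis by (rule EL.lattice_structure[unfolded Z D]) (rule that)
qed

text \<open>Dividing by \<open>b ^ n\<close> instead of \<open>z ^ n\<close> gives a recursion that
  contracts by \<open>|z| / b\<close> and also covers z = 0. So \<open>Y n\<close> tends to 0
  uniformly, whereas at a zero of \<open>\<Phi> n\<close> its modulus is \<open>|C * d z|\<close>,
  which is bounded below.\<close>

lemma no_zeros_inside:
  "\<forall>\<^sub>F n in sequentially. \<forall>z. cmod z \<le> b * exp (- \<eta> / 4) \<longrightarrow> poly (\<Phi> n) z \<noteq> 0"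
proof -
  obtain c0 M0 where c: "0 < c0" "\<And>z. cmod z \<le> 1 \<Longrightarrow> c0 \<le> cmod (d z) \<and> cmod (d z) \<le> M0"
    by (rule d_bounds) blast
  obtain K where K: "K > 0" "\<And>n z. cmod z \<le> 1 \<Longrightarrow> cmod (cnj (\<alpha> n) * poly (\<Phi>' n) z - cnj C * of_real (b ^ n) * d z) \<le> K * \<rho> ^ n"
    by (rule remainder_bound) blast
  define Y where "Y n z = ((z - b) * poly (\<Phi> n) z - cnj C * d z * b ^ n) / b ^ n" for n and z :: complex
  define e where "e = exp (- \<eta> / 4)"
  define m where "m = max \<Delta> b"
  have e: "0 < e" "e < 1" using \<eta> by (auto simp: e_def)
  have m: "0 < m" "m < 1" using b \<Delta> by (auto simp: m_def)
  \<comment> \<open>A rate strictly above both the contraction \<open>e\<close> and the rate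
    \<open>m\<close> of the inhomogeneous term.\<close>
  define q where "q = (1 + max e m) / 2"
  have q: "e < q" "m < q" "q < 1" using e m by (auto simp: q_def)
  \<comment> \<open>The first summand makes \<open>L * (q - e)\<close> absorb the inhomogeneous term
    in each step; the rest bounds the starting value.\<close>
  define L where "L = 2 * K / b / (q - e) + 2 + cmod C * M0"
  have "c0 \<le> M0" using c(2)[of 0] by simp
  then have L: "L > 0" "2 * K / b / (q - e) \<le> L" "2 + cmod C * M0 \<le> L" 
    using K b q c by (auto simp: L_def add_pos_nonneg)
  have Yb: "cmod (Y n z) \<le> L * q ^ n" if z: "cmod z \<le> b * e" for n and z :: complex
  proof -
    have "b * e \<le> b * 1" using e b by (intro mult_left_mono) auto
    then have z1: "cmod z \<le> 1" using z b by linarith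
    have zb: "cmod (z - b) \<le> 2" using norm_triangle_ineq4[of z b] z1 b by simp
    show ?thesis
    proof (induction n)
      case 0
      have "cmod (Y 0 z) \<le> cmod (z - b) + cmod (cnj C * d z)" by (simp add: Y_def norm_triangle_ineq4)
      also have "\<dots> \<le> 2 + cmod C * M0" using zb c(2)[OF z1] by (simp add: norm_mult mult_left_mono add_mono)
      finally show ?case using L by simp
    next
      case (Suc n)
      define R where "R = cnj (\<alpha> n) * poly (\<Phi>' n) z - cnj C * of_real (b ^ n) * d z"
      have R: "cmod R \<le> K * \<rho> ^ n" using K(2)[OF z1] by (simp add: R_def)
      have "Y (Suc n) z = (z / b) * Y n z - (z - b) * R / b ^ Suc n"
        using b by (simp add: Y_def R_def poly_szego_monic_Suc field_simps)
      then have "cmod (Y (Suc n) z) \<le> cmod ((z / b) * Y n z) + cmod ((z - b) * R / b ^ Suc n)"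
        by (simp add: norm_triangle_ineq4)
      also have "cmod ((z / b) * Y n z) \<le> e * (L * q ^ n)"
        unfolding norm_mult using z b e by (intro mult_mono Suc) (auto simp: norm_divide field_simps)
      also have "cmod ((z - b) * R / b ^ Suc n) \<le> 2 * (K * \<rho> ^ n) / b ^ Suc n"
        using zb R b by (auto simp: norm_mult norm_divide norm_power intro!: divide_right_mono mult_mono)
      also have "2 * (K * \<rho> ^ n) / b ^ Suc n = 2 * K / b * m ^ n"
        using b by (simp add: \<rho>_def m_def power_mult_distrib)
      also have "\<dots> \<le> 2 * K / b * q ^ n" using K b m q by (intro mult_left_mono power_mono) auto
      also have "2 * K / b \<le> L * (q - e)" using mult_right_mono[OF L(2), of "q - e"] q by simp
      finally have "cmod (Y (Suc n) z) \<le> e * (L * q ^ n) + L * (q - e) * q ^ n" using q e by (simp add: mult_right_mono)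
      also have "\<dots> = L * q ^ Suc n" by (simp add: algebra_simps)
      finally show ?case .
    qed
  qed
  have "(\<lambda>n. q ^ n) \<longlonglongrightarrow> 0" using q e by (intro LIMSEQ_realpow_zero) auto
  then have "(\<lambda>n. L * q ^ n) \<longlonglongrightarrow> 0" by (rule tendsto_mult_right_zero)
  moreover have "0 < cmod C * c0" using C_nz c by simp
  ultimately have "\<forall>\<^sub>F n in sequentially. L * q ^ n < cmod C * c0" by (rule order_tendstoD)
  then show ?thesis
  proof eventually_elim
    case (elim n)
    show ?case
    proof (intro allI impI notI)
      fix z assume z: "cmod z \<le> b * exp (- \<eta> / 4)" and "poly (\<Phi> n) z = 0"
      then have "Y n z = - cnj C * d z" using b by (simp add: Y_def)
      moreover have "b * e \<le> b * 1" using e b by (intro mult_left_mono) auto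
      then have z1: "cmod z \<le> 1" using z b unfolding e_def by linarith
      have "cmod C * c0 \<le> cmod C * cmod (d z)" using c(2)[OF z1] by (intro mult_left_mono) auto
      ultimately have "cmod C * c0 \<le> cmod (Y n z)" by (simp add: norm_mult)
      also have "\<dots> \<le> L * q ^ n" using Yb z by (simp add: e_def)
      finally show False using elim by simp
    qed
  qed
qed

section \<open>Zeros near the Nevai-Totik points\<close>

definition NT :: "complex set" where "NT = {z. b < cmod z \<and> cmod z < 1 \<and> F z = 0}"

text \<open>Outside the critical circle zeros of \<open>F\<close> are zeros of \<open>H\<close>, and
  the strip was chosen to contain none of those.\<close>

lemma NT_lower: "p \<in> NT \<Longrightarrow> b * exp \<eta> \<le> cmod p"
proof (rule ccontr)
  assume p: "p \<in> NT" "\<not> b * exp \<eta> \<le> cmod p"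
  then have "H p = 0" using H_eq_F[of p] by (auto simp: NT_def)
  moreover have "b * exp (- \<eta>) < b * 1" using b \<eta> by (intro mult_strict_left_mono) auto
  ultimately have "cmod p = b" using H_zeros[of p] p by (auto simp: NT_def)
  then show False using p by (simp add: NT_def)
qed

lemma open_exterior: "open {z::complex. b < cmod z}"
  by (intro open_Collect_less continuous_intros)

text \<open>The gap next to the critical circle puts the points into a compact annulus, and
  \<open>F\<close> is not identically zero because it has no zeros from the unit circle
  outwards.\<close>

lemma finite_NT: "finite NT"
proof -
  define A where "A = cball (0::complex) 1 - ball 0 (b * exp \<eta>)"
  have "b * 1 < b * exp \<eta>" using b \<eta> by (intro mult_strict_left_mono) auto
  then have sA: "A \<subseteq> {z. b < cmod z}" unfolding A_def by auto
  have cA: "compact A" unfolding A_def by (intro compact_diff) auto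
  have con: "connected {z::complex. b < cmod z}"
    using connected_complement_bounded_convex[of "cball (0::complex) b"] by (simp add: Compl_eq not_le)
  have sub: "NT \<subseteq> {z\<in>A. F z = 0}" using NT_lower by (force simp: NT_def A_def)
  have "finite {z\<in>A. F z = 0}"
  proof (cases "F constant_on {z. b < cmod z}")
    case True
    then obtain c where c: "\<And>z. b < cmod z \<Longrightarrow> F z = c" unfolding constant_on_def by blast
    have "c \<noteq> 0" using c[of 1] F_nonzero[of 1] b by simp
    then have "{z\<in>A. F z = 0} = {}" using c sA by auto
    then show ?thesis by (metis finite.emptyI)
  next
    case False
    then show ?thesis by (rule holomorphic_compact_finite_zeros[OF F_holomorphic open_exterior con cA sA])
  qed
  then show ?thesis using sub finite_subset by blast
qed

lemma F_zero_iff: "b < cmod z \<Longrightarrow> F z = 0 \<longleftrightarrow> z \<in> NT"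
  using F_nonzero[of z] by (cases "1 \<le> cmod z") (auto simp: NT_def)

lemma NT_isolation:
  obtains \<delta>0 where "\<delta>0 > 0" "\<And>p q. \<lbrakk>p \<in> NT; q \<in> NT; p \<noteq> q\<rbrakk> \<Longrightarrow> 2 * \<delta>0 \<le> dist p q"
    "\<And>p z. \<lbrakk>p \<in> NT; z \<in> ball p \<delta>0\<rbrakk> \<Longrightarrow> b * exp (\<eta> / 4) < cmod z"
proof -
  \<comment> \<open>The inserted number keeps the discs outside the ring, the halved distances keep
    them disjoint.\<close>
  define D where "D = insert (b * exp \<eta> - b * exp (\<eta> / 4)) ((\<lambda>(p, q). dist p q / 2) ` {(p, q). p \<in> NT \<and> q \<in> NT \<and> p \<noteq> q})"
  have "{(p, q). p \<in> NT \<and> q \<in> NT \<and> p \<noteq> q} \<subseteq> NT \<times> NT" by auto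
  then have fin: "finite D" unfolding D_def using finite_NT by (auto intro!: finite_imageI elim: finite_subset)
  have "b * exp (\<eta> / 4) < b * exp \<eta>" using b \<eta> by (intro mult_strict_left_mono) auto
  then have pos: "x > 0" if "x \<in> D" for x using that unfolding D_def by auto
  show thesis
  proof (rule that[of "Min D"])
    have "D \<noteq> {}" by (simp add: D_def)
    then show "0 < Min D" using Min_gr_iff[OF fin, of 0] pos by blast
    show "2 * Min D \<le> dist p q" if "p \<in> NT" "q \<in> NT" "p \<noteq> q" for p q
    proof -
      have "dist p q / 2 \<in> D" using that unfolding D_def by (auto intro!: image_eqI[of _ _ "(p, q)"])
      from Min_le[OF fin this] show ?thesis by simp
    qed
    show "b * exp (\<eta> / 4) < cmod z" if "p \<in> NT" "z \<in> ball p (Min D)" for p z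
    proof -
      have "Min D \<le> b * exp \<eta> - b * exp (\<eta> / 4)" by (rule Min_le[OF fin]) (simp add: D_def)
      moreover have "cmod p - cmod z \<le> cmod (p - z)" by (rule norm_triangle_ineq2)
      ultimately show ?thesis using NT_lower[OF that(1)] that(2) by (simp add: dist_norm)
    qed
  qed
qed

text \<open>Away from the ring and the discs \<open>F\<close> is bounded below by compactness, so
  there \<open>\<Phi> n\<close> is closer to \<open>z ^ n * F z\<close> than the size of the latter.
  This excludes further zeros and, as the boundary circles of the discs belong to that region,
  allows Rouche's theorem.\<close>

lemma hurwitz_count:
  assumes \<delta>: "0 < \<delta>" "\<delta> < \<delta>0" 
    and sep: "\<And>p q. \<lbrakk>p \<in> NT; q \<in> NT; p \<noteq> q\<rbrakk> \<Longrightarrow> 2 * \<delta>0 \<le> dist p q"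
    and out: "\<And>p z. \<lbrakk>p \<in> NT; z \<in> ball p \<delta>0\<rbrakk> \<Longrightarrow> b * exp (\<eta> / 4) < cmod z"
  shows "\<forall>\<^sub>F n in sequentially. (\<forall>p\<in>NT. int (size {# x \<in># proots (\<Phi> n). x \<in> ball p \<delta> #}) = zorder F p) \<and>
     (\<forall>z. poly (\<Phi> n) z = 0 \<longrightarrow> z \<notin> (\<Union>p\<in>NT. ball p \<delta>) \<longrightarrow> cmod z < b * exp (\<eta> / 4))"
proof -
  define r where "r = b * exp (\<eta> / 4)"
  have "b * 1 < b * exp (\<eta> / 4)" "b * exp (\<eta> / 4) < b * exp \<eta>" using b \<eta> by (auto intro!: mult_strict_left_mono)
  then have r: "b < r" "r < 1" using strip_bounds by (auto simp: r_def)
  obtain K where K: "K > 0" "\<And>n z. r \<le> cmod z \<Longrightarrow> cmod (poly (\<Phi> n) z - z ^ n * F z) \<le> cmod z ^ n * (K * (b / r) ^ n)"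
    using monic_approx_F[OF r] by blast
  \<comment> \<open>Radius 2 is enough: \<open>\<Phi> n\<close> has no zeros with |z| \<ge> 1, and
    \<delta> < 1 keeps the boundary circles inside, since otherwise a disc of radius
    \<open>\<delta>0\<close> would contain 0.\<close>
  define A where "A = cball (0::complex) 2 - ball 0 r - (\<Union>p\<in>NT. ball p \<delta>)"
  have cA: "compact A" unfolding A_def by (intro compact_diff) auto
  have sA: "A \<subseteq> {z. b < cmod z}" unfolding A_def using r by auto
  have FA: "F z \<noteq> 0" if "z \<in> A" for z
  proof
    assume "F z = 0"
    then have "z \<in> NT" using F_zero_iff[of z] that sA by auto
    moreover have "z \<in> ball z \<delta>" using \<delta> by simp
    ultimately show False using that unfolding A_def by blast
  qed
  have cont: "continuous_on A (\<lambda>z. cmod (F z))"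
    using holomorphic_on_subset[OF F_holomorphic sA] by (intro continuous_on_norm holomorphic_on_imp_continuous_on)
  \<comment> \<open>Some point is needed for the minimum of |F| to be attained.\<close>
  have "(2::complex) \<in> A"
  proof -
    have "(2::complex) \<notin> ball p \<delta>" if "p \<in> NT" for p
    proof
      assume "2 \<in> ball p \<delta>"
      have p: "b * exp \<eta> \<le> cmod p" "cmod p < 1" using NT_lower[OF that] that by (auto simp: NT_def)
      have "cmod (2::complex) - cmod p \<le> dist p 2" by (metis dist_commute dist_norm norm_triangle_ineq2)
      then have d1: "1 < \<delta>" using \<open>2 \<in> ball p \<delta>\<close> p by simp
      have "cmod (p - 0) < \<delta>" using p d1 by simp
      then have "(0::complex) \<in> ball p \<delta>0" using \<delta> by (simp add: dist_norm)
      from out[OF that this] show False using b by (simp add: mult_less_0_iff)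
    qed
    then show ?thesis using r unfolding A_def by auto
  qed
  then have ne: "A \<noteq> {}" by auto
  obtain z0 where z0: "z0 \<in> A" "\<And>z. z \<in> A \<Longrightarrow> cmod (F z0) \<le> cmod (F z)"
    using continuous_attains_inf[OF cA ne cont] by auto
  have "0 < cmod (F z0)" using FA z0 by simp
  have "b / r < 1" "0 < b / r" using b r by auto
  then have "(\<lambda>n. (b / r) ^ n) \<longlonglongrightarrow> 0" by (intro LIMSEQ_realpow_zero) auto
  then have "(\<lambda>n. K * (b / r) ^ n) \<longlonglongrightarrow> 0" by (rule tendsto_mult_right_zero)
  then have "\<forall>\<^sub>F n in sequentially. K * (b / r) ^ n < cmod (F z0)" using \<open>0 < cmod (F z0)\<close> by (rule order_tendstoD)
  then show ?thesis
  proof eventually_elim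
    case (elim n)
    have less: "cmod (poly (\<Phi> n) z - z ^ n * F z) < cmod (z ^ n * F z)" if "z \<in> A" for z
    proof -
      have zr: "r \<le> cmod z" using that unfolding A_def by auto
      then have "0 < cmod z" using r b by linarith
      then have "0 < cmod z ^ n" by simp
      moreover have "K * (b / r) ^ n < cmod (F z)" using z0(2)[OF that] elim by linarith
      ultimately have "cmod z ^ n * (K * (b / r) ^ n) < cmod z ^ n * cmod (F z)" by simp
      then show ?thesis using K(2)[OF zr, of n] by (simp add: norm_mult norm_power)
    qed
    show ?case
    proof (intro conjI ballI allI impI)
      fix z assume z: "poly (\<Phi> n) z = 0" "z \<notin> (\<Union>p\<in>NT. ball p \<delta>)"
      have z1: "cmod z < 1" using monic_nonzero[of z n] z(1) by (metis not_le)
      show "cmod z < b * exp (\<eta> / 4)"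
      proof (rule ccontr)
        assume "\<not> ?thesis"
        then have "z \<in> A" using z z1 unfolding A_def r_def by auto
        from less[OF this] z(1) show False by simp
      qed
    next
      fix p assume p: "p \<in> NT"
      have bigger: "b < cmod z" if "z \<in> ball p \<delta>0" for z using out[OF p that] r by (simp add: r_def)
      have hF: "F holomorphic_on ball p \<delta>0" using bigger by (intro holomorphic_on_subset[OF F_holomorphic]) auto
      have pb: "b < cmod p" using p by (simp add: NT_def)
      have uniq: "F z = 0 \<longleftrightarrow> z = p" if "z \<in> ball p \<delta>0" for z
      proof -
        have "z \<in> NT \<longleftrightarrow> z = p" using sep[OF p, of z] that p \<delta> by auto
        then show ?thesis using F_zero_iff[OF bigger[OF that]] by simp
      qed
      have "int (size {# x \<in># proots (\<Phi> n). x \<in> ball p \<delta> #}) = zorder (\<lambda>z. z ^ n * F z) p"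
      proof (rule rouche_poly_count[OF _ _ \<delta>])
        show "(\<lambda>z. z ^ n * F z) holomorphic_on ball p \<delta>0" by (intro holomorphic_intros hF)
        show "z ^ n * F z = 0 \<longleftrightarrow> z = p" if "z \<in> ball p \<delta>0" for z
          using uniq[OF that] bigger[OF that] b by auto
        show "cmod (poly (\<Phi> n) z - z ^ n * F z) < cmod (z ^ n * F z)" if z: "z \<in> sphere p \<delta>" for z
        proof (rule less)
          have zb: "z \<in> ball p \<delta>0" using z \<delta> by auto
          have "cmod z < 2"
          proof -
            have "\<delta> < 1"
            proof (rule ccontr)
              assume "\<not> \<delta> < 1"
              then have "(0::complex) \<in> ball p \<delta>0" using p \<delta> by (auto simp: NT_def)
              from out[OF p this] show False using b by (simp add: mult_less_0_iff)
            qed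
            moreover have "cmod z \<le> cmod p + dist p z" by (metis dist_norm norm_minus_commute norm_triangle_sub)
            ultimately show ?thesis using z p by (simp add: NT_def)
          qed
          moreover have "z \<notin> ball q \<delta>" if "q \<in> NT" for q
          proof (cases "q = p")
            case False
            then have "2 * \<delta>0 \<le> dist p q" using sep p that by auto
            moreover have "dist p q \<le> dist p z + dist q z" by (rule dist_triangle2)
            ultimately show ?thesis using z \<delta> by auto
          qed (use z in auto)
          ultimately show "z \<in> A" using out[OF p zb] unfolding A_def r_def by auto
        qed
      qed simp
      \<comment> \<open>The power does not vanish at \<open>p\<close> and so leaves the order
        unchanged.\<close>
      also have "zorder (\<lambda>z. z ^ n * F z) p = zorder F p"
      proof -
        have an: "(\<lambda>z. z ^ n) analytic_on {p}" by (intro analytic_intros)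
        have aF: "F analytic_on {p}" using hF \<delta> unfolding analytic_at by (intro exI[of _ "ball p \<delta>0"]) auto
        have nz: "z ^ n * F z \<noteq> 0" if "z \<noteq> p" "dist z p < \<delta>0" for z
        proof -
          have "z \<in> ball p \<delta>0" using that by (simp add: dist_commute)
          then show ?thesis using uniq[of z] bigger[of z] that(1) b by auto
        qed
        have ev: "\<forall>\<^sub>F z in at p. z ^ n * F z \<noteq> 0"
          unfolding eventually_at
        proof (intro exI conjI ballI impI)
          show "0 < \<delta>0" using \<delta> by linarith
        qed (use nz in blast)
        have "zorder (\<lambda>z. z ^ n * F z) p = zorder (\<lambda>z. z ^ n) p + zorder F p"
          by (rule zorder_times_analytic[OF an aF ev])
        moreover have "zorder (\<lambda>z. z ^ n) p = 0"
          by (rule zorder_eq_0I[OF an]) (use pb b in auto)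
        ultimately show ?thesis by simp
      qed
      finally show "int (size {# x \<in># proots (\<Phi> n). x \<in> ball p \<delta> #}) = zorder F p" .
    qed
  qed
qed

end

section \<open>Measures on the circle\<close>

lemma cnj_measurable [measurable]: "cnj \<in> borel_measurable borel"
  by (intro borel_measurable_continuous_onI continuous_intros)

definition circle_measure :: "complex measure \<Rightarrow> bool" where
  "circle_measure M \<longleftrightarrow> finite_measure M \<and> sets M = sets borel \<and> (AE z in M. cmod z = 1)"

lemma circle_measure_integrable:
  fixes f :: "complex \<Rightarrow> 'b::{banach,second_countable_topology}"
  assumes M: "circle_measure M" and f: "f \<in> borel_measurable borel" and B: "\<And>z. cmod z = 1 \<Longrightarrow> norm (f z) \<le> B"
  shows "integrable M f"
proof -
  interpret finite_measure M using M by (simp add: circle_measure_def)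
  have "f \<in> borel_measurable M" using M f by (simp add: circle_measure_def cong: measurable_cong_sets)
  moreover have "AE z in M. norm (f z) \<le> B" using M B by (auto simp: circle_measure_def elim: eventually_mono)
  ultimately show ?thesis by (intro integrable_const_bound)
qed

lemma circle_measure_integral_cong:
  fixes f g :: "complex \<Rightarrow> 'b::{banach,second_countable_topology}"
  assumes M: "circle_measure M" and "f \<in> borel_measurable borel" "g \<in> borel_measurable borel"
    and "\<And>z. cmod z = 1 \<Longrightarrow> f z = g z"
  shows "(\<integral>z. f z \<partial>M) = (\<integral>z. g z \<partial>M)"
  using assms by (intro integral_cong_AE) (auto simp: circle_measure_def cong: measurable_cong_sets elim: eventually_mono)

text \<open>The invariant of an induction over real polynomials in the plane. The weight
  \<open>h\<close> is general so that the factors of a product can be absorbed one after the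
  other.\<close>

definition same_moments :: "complex measure \<Rightarrow> complex measure \<Rightarrow> (complex \<Rightarrow> complex) \<Rightarrow> bool" where
  "same_moments M N h \<longleftrightarrow> h \<in> borel_measurable borel \<and> (\<exists>B. \<forall>z. cmod z = 1 \<longrightarrow> cmod (h z) \<le> B) \<and>
     (\<forall>j k. (\<integral>z. z ^ j * cnj z ^ k * h z \<partial>M) = (\<integral>z. z ^ j * cnj z ^ k * h z \<partial>N))"

lemma same_moments_integrable:
  assumes "circle_measure M" "h \<in> borel_measurable borel" "\<exists>B. \<forall>z. cmod z = 1 \<longrightarrow> cmod (h z) \<le> B"
  shows "integrable M (\<lambda>z. z ^ j * cnj z ^ k * h z)"
proof -
  obtain B where "\<forall>z. cmod z = 1 \<longrightarrow> cmod (h z) \<le> B" using assms by blast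
  moreover have "(\<lambda>z. z ^ j * cnj z ^ k * h z) \<in> borel_measurable borel" using assms(2) by measurable
  ultimately show ?thesis using assms(1)
    by (intro circle_measure_integrable[of _ _ B]) (auto simp: norm_mult norm_power)
qed

text \<open>A real-linear function is \<open>a * z + cnj a * cnj z\<close>, so multiplying by it
  shifts one of the two exponents. In the product case the hypothesis for one factor is applied to a
  weight already containing the other.\<close>

lemma same_moments_mult_polynomial:
  assumes M: "circle_measure M" and N: "circle_measure N"
    and g: "real_polynomial_function g" and h: "same_moments M N h"
  shows "same_moments M N (\<lambda>z. of_real (g z) * h z)"
  using g h
proof (induction g arbitrary: h rule: real_polynomial_function.induct)
  case (linear f)
  define a where "a = (of_real (f 1) - \<i> * of_real (f \<i>)) / 2"
  have lin: "linear f" using linear(1) by (simp add: bounded_linear.linear)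
  have f: "of_real (f z) = a * z + cnj a * cnj z" for z
  proof -
    have "f z = f (Re z *\<^sub>R 1 + Im z *\<^sub>R \<i>)" by (metis complex_eq scaleR_conv_of_real mult.commute mult.right_neutral)
    also have "\<dots> = Re z * f 1 + Im z * f \<i>" using lin by (simp add: linear_add linear_cmul)
    finally show ?thesis by (simp add: a_def complex_eq_iff field_simps)
  qed
  obtain B where hm: "h \<in> borel_measurable borel" and B: "\<And>z. cmod z = 1 \<Longrightarrow> cmod (h z) \<le> B"
    and mom: "\<And>j k. (\<integral>z. z ^ j * cnj z ^ k * h z \<partial>M) = (\<integral>z. z ^ j * cnj z ^ k * h z \<partial>N)"
    using linear(2) unfolding same_moments_def by blast
  have eq: "z ^ j * cnj z ^ k * (of_real (f z) * h z) = a * (z ^ Suc j * cnj z ^ k * h z) + cnj a * (z ^ j * cnj z ^ Suc k * h z)" for z j k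
    unfolding f by (simp add: algebra_simps)
  have I: "(\<integral>z. z ^ j * cnj z ^ k * (of_real (f z) * h z) \<partial>K) = a * (\<integral>z. z ^ Suc j * cnj z ^ k * h z \<partial>K) + cnj a * (\<integral>z. z ^ j * cnj z ^ Suc k * h z \<partial>K)"
    if "circle_measure K" for K j k
  proof -
    have i: "integrable K (\<lambda>z. z ^ j * cnj z ^ k * h z)" for j k
      by (rule same_moments_integrable[OF that hm]) (use B in blast)
    show ?thesis unfolding eq
      by (subst Bochner_Integration.integral_add) (simp_all add: i del: power_Suc)
  qed
  have "(\<lambda>z. complex_of_real (f z) * h z) \<in> borel_measurable borel" unfolding f using hm by measurable
  moreover have "cmod (of_real (f z) * h z) \<le> (2 * cmod a) * \<bar>B\<bar>" if "cmod z = 1" for z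
  proof -
    have "cmod (complex_of_real (f z)) \<le> 2 * cmod a" unfolding f
      by (rule order_trans[OF norm_triangle_ineq]) (simp add: norm_mult that)
    then show ?thesis using B[OF that] by (auto simp: norm_mult intro!: mult_mono simp del: norm_of_real)
  qed
  ultimately show ?case unfolding same_moments_def I[OF M] I[OF N] mom by blast
next
  case (const c)
  obtain B where hm: "h \<in> borel_measurable borel" and B: "\<And>z. cmod z = 1 \<Longrightarrow> cmod (h z) \<le> B"
    and mom: "\<And>j k. (\<integral>z. z ^ j * cnj z ^ k * h z \<partial>M) = (\<integral>z. z ^ j * cnj z ^ k * h z \<partial>N)"
    using const unfolding same_moments_def by blast
  have "cmod (of_real c * h z) \<le> \<bar>c\<bar> * B" if "cmod z = 1" for z
    using B[OF that] by (simp add: norm_mult mult_left_mono)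
  moreover have "(\<lambda>z. of_real c * h z) \<in> borel_measurable borel" using hm by measurable
  moreover have "(\<integral>z. z ^ j * cnj z ^ k * (of_real c * h z) \<partial>K) = of_real c * (\<integral>z. z ^ j * cnj z ^ k * h z \<partial>K)" for j k K
    by (simp add: mult.left_commute)
  ultimately show ?case unfolding same_moments_def using mom by auto
next
  case (add f g)
  have m: "same_moments M N (\<lambda>z. of_real (f z) * h z)" "same_moments M N (\<lambda>z. of_real (g z) * h z)" using add by auto
  then obtain B1 B2 where hm: "(\<lambda>z. of_real (f z) * h z) \<in> borel_measurable borel" "(\<lambda>z. of_real (g z) * h z) \<in> borel_measurable borel"
    and B: "\<And>z. cmod z = 1 \<Longrightarrow> cmod (of_real (f z) * h z) \<le> B1" "\<And>z. cmod z = 1 \<Longrightarrow> cmod (of_real (g z) * h z) \<le> B2"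
    unfolding same_moments_def by blast
  have I: "(\<integral>z. z ^ j * cnj z ^ k * (of_real (f z + g z) * h z) \<partial>K) =
     (\<integral>z. z ^ j * cnj z ^ k * (of_real (f z) * h z) \<partial>K) + (\<integral>z. z ^ j * cnj z ^ k * (of_real (g z) * h z) \<partial>K)"
    if "circle_measure K" for K j k
  proof -
    have "z ^ j * cnj z ^ k * (of_real (f z + g z) * h z) = z ^ j * cnj z ^ k * (of_real (f z) * h z) + z ^ j * cnj z ^ k * (of_real (g z) * h z)" for z
      by (simp add: algebra_simps)
    moreover have "integrable K (\<lambda>z. z ^ j * cnj z ^ k * (of_real (f z) * h z))"
      by (rule same_moments_integrable[OF that hm(1)]) (use B in blast)
    moreover have "integrable K (\<lambda>z. z ^ j * cnj z ^ k * (of_real (g z) * h z))"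
      by (rule same_moments_integrable[OF that hm(2)]) (use B in blast)
    ultimately show ?thesis by (simp only: Bochner_Integration.integral_add)
  qed
  have "(\<lambda>z. of_real (f z + g z) * h z) = (\<lambda>z. of_real (f z) * h z + of_real (g z) * h z)" by (simp add: distrib_right)
  then have "(\<lambda>z. of_real (f z + g z) * h z) \<in> borel_measurable borel" using hm by simp
  moreover have "cmod (of_real (f z + g z) * h z) \<le> B1 + B2" if "cmod z = 1" for z
    using norm_triangle_mono[OF B(1)[OF that] B(2)[OF that]] by (simp add: distrib_right)
  ultimately show ?case using m unfolding same_moments_def I[OF M] I[OF N] by auto
next
  case (mult f g)
  then have "same_moments M N (\<lambda>z. of_real (f z) * (of_real (g z) * h z))" by blast
  then show ?case by (simp add: mult.assoc)
qed

text \<open>On the circle \<open>z * cnj z = 1\<close> cancels the smaller exponent, and a negative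
  power has the conjugate moment.\<close>

lemma same_moments_one:
  assumes M: "circle_measure M" and N: "circle_measure N"
    and mom: "\<And>k. (\<integral>z. z ^ k \<partial>M) = (\<integral>z. z ^ k \<partial>N)"
  shows "same_moments M N (\<lambda>z. 1)"
proof -
  have I: "(\<integral>z. z ^ j * cnj z ^ k \<partial>K) = (if k \<le> j then \<integral>z. z ^ (j - k) \<partial>K else cnj (\<integral>z. z ^ (k - j) \<partial>K))"
    if K: "circle_measure K" for K j k
  proof -
    have one: "z * cnj z = 1" if "cmod z = 1" for z using that by (simp add: complex_norm_square[symmetric])
    show ?thesis
    proof (cases "k \<le> j")
      case True
      have "(\<integral>z. z ^ j * cnj z ^ k \<partial>K) = (\<integral>z. z ^ (j - k) \<partial>K)"
      proof (rule circle_measure_integral_cong[OF K])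
        fix z :: complex assume z: "cmod z = 1"
        have "z ^ j * cnj z ^ k = z ^ (j - k) * (z * cnj z) ^ k" using True by (simp add: power_mult_distrib flip: power_add mult.assoc)
        then show "z ^ j * cnj z ^ k = z ^ (j - k)" using one[OF z] by simp
      qed measurable
      then show ?thesis using True by simp
    next
      case False
      have "(\<integral>z. z ^ j * cnj z ^ k \<partial>K) = (\<integral>z. cnj (z ^ (k - j)) \<partial>K)"
      proof (rule circle_measure_integral_cong[OF K])
        fix z :: complex assume z: "cmod z = 1"
        have "cnj z ^ k = cnj z ^ j * cnj z ^ (k - j)" using False by (simp flip: power_add)
        then have "z ^ j * cnj z ^ k = cnj z ^ (k - j) * (z * cnj z) ^ j" by (simp add: power_mult_distrib mult_ac)
        then show "z ^ j * cnj z ^ k = cnj (z ^ (k - j))" using one[OF z] by simp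
      qed measurable
      then show ?thesis using False by (simp del: complex_cnj_power)
    qed
  qed
  show ?thesis unfolding same_moments_def by (auto simp: I[OF M] I[OF N] mom intro!: exI[of _ 1])
qed

text \<open>Real polynomials in the plane are uniformly dense in the continuous functions on the
  circle by the Stone-Weierstrass theorem, and the integrals of such polynomials agree.\<close>

lemma circle_measure_continuous_integral_eq:
  assumes M: "circle_measure M" and N: "circle_measure N"
    and mom: "\<And>k. (\<integral>z. z ^ k \<partial>M) = (\<integral>z. z ^ k \<partial>N)"
    and f: "continuous_on UNIV (f :: complex \<Rightarrow> real)"
  shows "(\<integral>z. f z \<partial>M) = (\<integral>z. f z \<partial>N)"
proof (rule ccontr)
  assume ne: "(\<integral>z. f z \<partial>M) \<noteq> (\<integral>z. f z \<partial>N)"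
  interpret M: finite_measure M using M by (simp add: circle_measure_def)
  interpret N: finite_measure N using N by (simp add: circle_measure_def)
  \<comment> \<open>The added 1 makes \<open>m\<close> positive and the final inequality
    strict.\<close>
  define m where "m = measure M (space M) + measure N (space N) + 1"
  have m: "m > 0" unfolding m_def by (simp add: add_nonneg_pos)
  define e where "e = \<bar>(\<integral>z. f z \<partial>M) - (\<integral>z. f z \<partial>N)\<bar> / m"
  have e: "e > 0" using ne m by (simp add: e_def)
  have fs: "continuous_on (sphere 0 1) f" using f by (rule continuous_on_subset) auto
  obtain g where g: "real_polynomial_function g" "\<And>z. z \<in> sphere 0 1 \<Longrightarrow> \<bar>f z - g z\<bar> < e"
    using Stone_Weierstrass_real_polynomial_function[OF compact_sphere fs e] by blast
  have gc: "continuous_on UNIV g" using continuous_real_polymonial_function[OF g(1)] by (simp add: continuous_at_imp_continuous_on)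
  have fm: "f \<in> borel_measurable borel" and gm: "g \<in> borel_measurable borel"
    using f gc by (auto intro: borel_measurable_continuous_onI)
  have bd: "\<exists>B. \<forall>z. cmod z = 1 \<longrightarrow> norm (h z) \<le> B" if "continuous_on UNIV h" for h :: "complex \<Rightarrow> real"
  proof -
    have "compact (h ` sphere 0 1)" using that by (intro compact_continuous_image) (auto intro: continuous_on_subset)
    then have "bounded (h ` sphere 0 1)" by (rule compact_imp_bounded)
    then obtain a where "\<forall>x\<in>sphere 0 1. norm (h x) \<le> a" by (auto simp: bounded_iff)
    then show ?thesis by (intro exI[of _ a]) auto
  qed
  have int: "integrable K f" "integrable K g" if "circle_measure K" for K
    using bd[OF f] bd[OF gc] fm gm circle_measure_integrable[OF that] by blast+
  have "same_moments M N (\<lambda>z. of_real (g z) * 1)"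
    by (rule same_moments_mult_polynomial[OF M N g(1) same_moments_one[OF M N mom]])
  then have "(\<integral>z. z ^ 0 * cnj z ^ 0 * (complex_of_real (g z) * 1) \<partial>M) = (\<integral>z. z ^ 0 * cnj z ^ 0 * (of_real (g z) * 1) \<partial>N)"
    unfolding same_moments_def by blast
  then have "complex_of_real (\<integral>z. g z \<partial>M) = of_real (\<integral>z. g z \<partial>N)" by simp
  then have gg: "(\<integral>z. g z \<partial>M) = (\<integral>z. g z \<partial>N)" by simp
  have ap: "\<bar>(\<integral>z. f z \<partial>K) - (\<integral>z. g z \<partial>K)\<bar> \<le> e * measure K (space K)" if K: "circle_measure K" for K
  proof -
    interpret K: finite_measure K using K by (simp add: circle_measure_def)
    have "\<bar>(\<integral>z. f z \<partial>K) - (\<integral>z. g z \<partial>K)\<bar> = \<bar>\<integral>z. f z - g z \<partial>K\<bar>" using int[OF K] by simp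
    also have "\<dots> \<le> (\<integral>z. \<bar>f z - g z\<bar> \<partial>K)" by (rule integral_abs_bound)
    also have "\<dots> \<le> (\<integral>z. e \<partial>K)"
      using int[OF K] K g(2) by (intro integral_mono_AE) (auto simp: circle_measure_def elim!: eventually_mono intro: less_imp_le)
    finally show ?thesis by (simp add: mult.commute)
  qed
  have "\<bar>(\<integral>z. f z \<partial>M) - (\<integral>z. f z \<partial>N)\<bar> \<le> e * measure M (space M) + e * measure N (space N)"
    using ap[OF M] ap[OF N] gg by linarith
  also have "\<dots> < e * m" using e by (simp add: m_def algebra_simps)
  also have "\<dots> = \<bar>(\<integral>z. f z \<partial>M) - (\<integral>z. f z \<partial>N)\<bar>" using m by (simp add: e_def)
  finally show False by simp
qed

text \<open>The indicator of a closed set is the limit of the continuous functions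
  \<open>max 0 (1 - n * infdist z S)\<close>, and closed sets form a generator of the Borel sets
  that is stable under intersection.\<close>

lemma circle_measure_eqI:
  assumes M: "circle_measure M" and N: "circle_measure N"
    and mom: "\<And>k. (\<integral>z. z ^ k \<partial>M) = (\<integral>z. z ^ k \<partial>N)"
  shows "M = N"
proof -
  interpret M: finite_measure M using M by (simp add: circle_measure_def)
  interpret N: finite_measure N using N by (simp add: circle_measure_def)
  have sM: "sets M = sets borel" and sN: "sets N = sets borel" using M N by (auto simp: circle_measure_def)
  have lim: "(\<lambda>n. \<integral>z. max 0 (1 - real n * infdist z S) \<partial>K) \<longlonglongrightarrow> measure K S"
    if S: "closed S" "S \<noteq> {}" and K: "circle_measure K" for K S
  proof -
    interpret K: finite_measure K using K by (simp add: circle_measure_def)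
    have sK: "sets K = sets borel" using K by (auto simp: circle_measure_def)
    have SK: "S \<in> sets K" using S sK by simp
    have "(\<lambda>n. \<integral>z. max 0 (1 - real n * infdist z S) \<partial>K) \<longlonglongrightarrow> (\<integral>z. indicator S z \<partial>K)"
    proof (rule integral_dominated_convergence[where w = "\<lambda>_. 1"])
      show "(indicator S :: complex \<Rightarrow> real) \<in> borel_measurable K" using SK by measurable
      have "(\<lambda>z. max 0 (1 - real n * infdist z S)) \<in> borel_measurable borel" for n
        by (intro borel_measurable_continuous_onI continuous_intros)
      then show "(\<lambda>z. max 0 (1 - real n * infdist z S)) \<in> borel_measurable K" for n
        by (simp cong: measurable_cong_sets[OF sK refl])
      show "AE z in K. (\<lambda>n. max 0 (1 - real n * infdist z S)) \<longlonglongrightarrow> indicator S z"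
      proof (rule AE_I2)
        fix z
        show "(\<lambda>n. max 0 (1 - real n * infdist z S)) \<longlonglongrightarrow> indicator S z"
        proof (cases "z \<in> S")
          case False
          then have pos: "infdist z S > 0" using S in_closed_iff_infdist_zero infdist_nonneg by (metis less_eq_real_def)
          have "\<forall>\<^sub>F n in sequentially. 1 / infdist z S \<le> real n"
            by (rule eventually_sequentiallyI[of "nat \<lceil>1 / infdist z S\<rceil>"]) linarith
          then have "\<forall>\<^sub>F n in sequentially. max 0 (1 - real n * infdist z S) = 0"
            by eventually_elim (use pos in \<open>simp add: field_simps\<close>)
          then show ?thesis using False by (simp add: tendsto_eventually)
        qed simp
      qed
      show "AE z in K. norm (max 0 (1 - real n * infdist z S)) \<le> 1" for n
        by (rule AE_I2) (simp add: infdist_nonneg)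
    qed simp
    then show ?thesis using SK by simp
  qed
  have "emeasure M S = emeasure N S" if "closed S" for S
  proof (cases "S = {}")
    case False
    have "(\<integral>z. max 0 (1 - real n * infdist z S) \<partial>M) = (\<integral>z. max 0 (1 - real n * infdist z S) \<partial>N)" for n
      by (rule circle_measure_continuous_integral_eq[OF M N mom]) (intro continuous_intros)
    then have "measure M S = measure N S"
      using lim[OF that False M] lim[OF that False N] by (simp add: LIMSEQ_unique)
    then show ?thesis by (simp add: M.emeasure_eq_measure N.emeasure_eq_measure)
  qed simp
  moreover have "sets borel = sigma_sets UNIV (Collect (closed :: complex set \<Rightarrow> bool))"
    unfolding borel_eq_closed by simp
  ultimately show ?thesis using sM sN
    by (intro measure_eqI_generator_eq[where \<Omega> = UNIV and E = "Collect closed" and A = "\<lambda>_. UNIV"])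
       (auto simp: Int_stable_def)
qed

lemma cis_integral:
  "((\<lambda>\<theta>. cis \<theta> ^ k) has_integral (if k = 0 then of_real (2 * pi) else 0)) {0..2 * pi}"
proof (cases "k = 0")
  case True
  then show ?thesis using has_integral_const_real[of "1::complex" 0 "2 * pi"] by (simp add: scaleR_conv_of_real)
next
  case False
  have e: "exp (\<i> * k * of_real \<theta>) = cis (real k * \<theta>)" for \<theta> by (simp add: cis_conv_exp mult_ac)
  have "((\<lambda>\<theta>. cis \<theta> ^ k) has_integral (exp (\<i> * k * of_real (2 * pi)) / (\<i> * k) - exp (\<i> * k * of_real 0) / (\<i> * k))) {0..2 * pi}"
  proof (rule fundamental_theorem_of_calculus)
    fix \<theta> :: real
    have "((\<lambda>z. exp (\<i> * k * z) / (\<i> * k)) has_field_derivative exp (\<i> * k * of_real \<theta>)) (at (of_real \<theta>))"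
      using False by (auto intro!: derivative_eq_intros)
    from has_vector_derivative_real_field[OF this]
    show "((\<lambda>\<theta>. exp (\<i> * k * of_real \<theta>) / (\<i> * k)) has_vector_derivative cis \<theta> ^ k) (at \<theta> within {0..2 * pi})"
      unfolding e Complex.DeMoivre .
  qed simp
  moreover have "cis (real k * (2 * pi)) = 1" using cis_multiple_2pi[of "real k"] by (simp add: mult_ac)
  ultimately show ?thesis using False unfolding e by simp
qed

section \<open>Orthogonal polynomials and the Szego function\<close>

locale circle_prob =
  fixes \<mu> :: "complex measure"
  assumes \<mu>: "nontrivial_circle_prob \<mu>"
begin

sublocale prob_space \<mu> using \<mu> by (simp add: nontrivial_circle_prob_def)

lemma sets_\<mu>: "sets \<mu> = sets borel"
  using \<mu> by (simp add: nontrivial_circle_prob_def)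

lemma space_\<mu>: "space \<mu> = UNIV"
  using sets_eq_imp_space_eq[OF sets_\<mu>] by simp

lemma AE_circle: "AE z in \<mu>. cmod z = 1"
proof -
  have "emeasure \<mu> (sphere 0 1) = 1" using \<mu> by (simp add: nontrivial_circle_prob_def)
  then have "prob (sphere 0 1) = 1" by (simp add: measure_def)
  moreover have "sphere 0 1 \<in> events" by (simp add: sets_\<mu>)
  ultimately have "AE z in \<mu>. z \<in> sphere 0 1" using prob_eq_1 by blast
  then show ?thesis by simp
qed

lemma circle_measure_\<mu>: "circle_measure \<mu>"
  unfolding circle_measure_def using AE_circle sets_\<mu> finite_measure_axioms by blast

lemma circle_integrable:
  fixes f :: "complex \<Rightarrow> complex"
  assumes f: "continuous_on UNIV f"
  shows "integrable \<mu> f"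
proof -
  have "compact (f ` sphere 0 1)" using f by (intro compact_continuous_image) (auto intro: continuous_on_subset)
  then have "bounded (f ` sphere 0 1)" by (rule compact_imp_bounded)
  then obtain B where "\<forall>x\<in>sphere 0 1. norm (f x) \<le> B" by (auto simp: bounded_iff)
  then show ?thesis using f
    by (intro circle_measure_integrable[OF circle_measure_\<mu>, of _ B] borel_measurable_continuous_onI) auto
qed

lemma circle_integral_cong:
  fixes f g :: "complex \<Rightarrow> complex"
  assumes "continuous_on UNIV f" "continuous_on UNIV g" "\<And>z. cmod z = 1 \<Longrightarrow> f z = g z"
  shows "(\<integral>z. f z \<partial>\<mu>) = (\<integral>z. g z \<partial>\<mu>)"
  using assms by (intro circle_measure_integral_cong[OF circle_measure_\<mu>] borel_measurable_continuous_onI)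

text \<open>A vanishing integral would concentrate the measure on the finitely many roots of
  \<open>p\<close>, against nontriviality.\<close>

lemma poly_norm_integral_pos:
  assumes "p \<noteq> 0"
  shows "0 < (\<integral>z. (cmod (poly p z))\<^sup>2 \<partial>\<mu>)"
proof -
  have c: "continuous_on UNIV (\<lambda>z. (cmod (poly p z))\<^sup>2)" by (intro continuous_intros)
  have "integrable \<mu> (\<lambda>z. complex_of_real ((cmod (poly p z))\<^sup>2))"
    by (rule circle_integrable) (intro continuous_intros)
  then have int: "integrable \<mu> (\<lambda>z. (cmod (poly p z))\<^sup>2)" by (subst (asm) complex_of_real_integrable_eq)
  have "(\<integral>z. (cmod (poly p z))\<^sup>2 \<partial>\<mu>) \<noteq> 0"
  proof
    assume "(\<integral>z. (cmod (poly p z))\<^sup>2 \<partial>\<mu>) = 0"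
    then have ae: "AE z in \<mu>. poly p z = 0" using integral_nonneg_eq_0_iff_AE[OF int] by simp
    have "finite {z. poly p z = 0}" using assms by (rule poly_roots_finite)
    then have m: "UNIV - {z. poly p z = 0} \<in> sets \<mu>" unfolding sets_\<mu> by (intro borel_open open_Diff finite_imp_closed) auto
    have "emeasure \<mu> (UNIV - {z. poly p z = 0}) = 0"
      by (subst AE_iff_measurable[OF m, symmetric, of "\<lambda>z. poly p z = 0"]) (auto simp: space_\<mu> ae)
    then show False using \<mu> \<open>finite {z. poly p z = 0}\<close> unfolding nontrivial_circle_prob_def by blast
  qed
  moreover have "0 \<le> (\<integral>z. (cmod (poly p z))\<^sup>2 \<partial>\<mu>)" by simp
  ultimately show ?thesis by linarith
qed

lemma integral_cnj_poly_mult: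
  assumes f: "continuous_on UNIV f"
  shows "(\<integral>z. cnj (poly q z) * f z \<partial>\<mu>) = (\<Sum>i\<le>degree q. cnj (coeff q i) * (\<integral>z. cnj (z ^ i) * f z \<partial>\<mu>))"
proof -
  have "cnj (poly q z) * f z = (\<Sum>i\<le>degree q. cnj (coeff q i) * (cnj (z ^ i) * f z))" for z
    by (simp add: poly_altdef sum_distrib_right mult.assoc)
  then have "(\<integral>z. cnj (poly q z) * f z \<partial>\<mu>) = (\<integral>z. (\<Sum>i\<le>degree q. cnj (coeff q i) * (cnj (z ^ i) * f z)) \<partial>\<mu>)" by simp
  also have "\<dots> = (\<Sum>i\<le>degree q. (\<integral>z. cnj (coeff q i) * (cnj (z ^ i) * f z) \<partial>\<mu>))"
    by (intro Bochner_Integration.integral_sum circle_integrable continuous_intros f)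
  finally show ?thesis by simp
qed

text \<open>The difference of two candidates has degree below n, so both are orthogonal to it and
  its norm vanishes.\<close>

lemma monic_orthogonal_unique:
  assumes p: "monic_orthogonal \<mu> n p" and q: "monic_orthogonal \<mu> n q"
  shows "p = q"
proof (rule ccontr)
  assume "p \<noteq> q"
  define r where "r = p - q"
  have r: "r \<noteq> 0" using \<open>p \<noteq> q\<close> by (simp add: r_def)
  have dp: "degree p = n" "degree q = n" "coeff p n = 1" "coeff q n = 1" using p q by (auto simp: monic_orthogonal_def)
  have "degree r \<le> n" unfolding r_def using dp by (intro degree_diff_le) auto
  moreover have "degree r \<noteq> n"
  proof
    assume "degree r = n"
    then have "lead_coeff r = 0" by (simp add: r_def dp)
    then show False using r by simp
  qed
  ultimately have dr: "degree r < n" by simp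
  have o: "(\<integral>z. cnj (poly r z) * poly s z \<partial>\<mu>) = 0" if "monic_orthogonal \<mu> n s" for s
    using that dr by (subst integral_cnj_poly_mult) (auto simp: monic_orthogonal_def intro!: sum.neutral continuous_intros simp del: complex_cnj_power)
  have "(\<integral>z. complex_of_real ((cmod (poly r z))\<^sup>2) \<partial>\<mu>) = (\<integral>z. cnj (poly r z) * poly p z - cnj (poly r z) * poly q z \<partial>\<mu>)"
    by (intro Bochner_Integration.integral_cong refl) (simp only: complex_norm_square r_def poly_diff, simp add: algebra_simps)
  also have "\<dots> = 0" using o[OF p] o[OF q]
    by (subst Bochner_Integration.integral_diff) (auto intro!: circle_integrable continuous_intros)
  finally have "(\<integral>z. (cmod (poly r z))\<^sup>2 \<partial>\<mu>) = 0" by (simp del: of_real_power)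
  then show False using poly_norm_integral_pos[OF r] by simp
qed

lemma OPUC_eqI: "monic_orthogonal \<mu> n p \<Longrightarrow> OPUC \<mu> n = p"
  unfolding OPUC_def using monic_orthogonal_unique by blast

abbreviation "A \<equiv> szego_monic (verblunsky \<mu>)"
abbreviation "B \<equiv> szego_dual (verblunsky \<mu>)"

lemma dual_on_circle: "cmod z = 1 \<Longrightarrow> poly (B n) z = z ^ n * cnj (poly (A n) z)"
proof -
  assume z: "cmod z = 1"
  then have "z \<noteq> 0" by auto
  moreover have "1 / cnj z = z" using z \<open>z \<noteq> 0\<close> by (simp add: field_simps complex_norm_square[symmetric])
  ultimately show ?thesis using szego_dual_reversal[of z "verblunsky \<mu>" n] by simp
qed

text \<open>Reversal on the circle exchanges the exponents k and n - k; hence the range 1, ..., n in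
  place of 0, ..., n - 1.\<close>

lemma dual_orthogonal:
  assumes "monic_orthogonal \<mu> n (A n)" "1 \<le> k" "k \<le> n"
  shows "(\<integral>z. cnj (z ^ k) * poly (B n) z \<partial>\<mu>) = 0"
proof -
  have "(\<integral>z. cnj (z ^ k) * poly (B n) z \<partial>\<mu>) = (\<integral>z. cnj (cnj (z ^ (n - k)) * poly (A n) z) \<partial>\<mu>)"
  proof (rule circle_integral_cong)
    fix z :: complex assume z: "cmod z = 1"
    then have one: "cnj z * z = 1" by (simp add: complex_norm_square[symmetric] mult.commute)
    have "cnj z ^ k * z ^ n = (cnj z * z) ^ k * z ^ (n - k)" using assms(3) by (simp add: power_mult_distrib mult.assoc flip: power_add)
    then have "cnj z ^ k * z ^ n = z ^ (n - k)" using one by simp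
    then show "cnj (z ^ k) * poly (B n) z = cnj (cnj (z ^ (n - k)) * poly (A n) z)"
      unfolding dual_on_circle[OF z] by (simp flip: mult.assoc)
  qed (intro continuous_intros)+
  also have "\<dots> = cnj (\<integral>z. cnj (z ^ (n - k)) * poly (A n) z \<partial>\<mu>)" by (rule Bochner_Integration.integral_cnj)
  also have "(\<integral>z. cnj (z ^ (n - k)) * poly (A n) z \<partial>\<mu>) = 0"
    using assms unfolding monic_orthogonal_def by (metis diff_less less_le_trans zero_less_one)
  finally show ?thesis by simp
qed

text \<open>In the squared norm of \<open>A n\<close> only the leading coefficient 1 survives
  orthogonality, and the remaining moment is the conjugate of the integral of the reversed
  polynomial.\<close>

lemma dual_integral:
  assumes "monic_orthogonal \<mu> n (A n)"
  shows "(\<integral>z. poly (B n) z \<partial>\<mu>) = of_real (\<integral>z. (cmod (poly (A n) z))\<^sup>2 \<partial>\<mu>)"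
proof -
  have "complex_of_real (\<integral>z. (cmod (poly (A n) z))\<^sup>2 \<partial>\<mu>) = (\<integral>z. complex_of_real ((cmod (poly (A n) z))\<^sup>2) \<partial>\<mu>)"
    by (rule integral_complex_of_real[symmetric])
  also have "\<dots> = (\<integral>z. cnj (poly (A n) z) * poly (A n) z \<partial>\<mu>)"
    by (simp only: complex_norm_square mult.commute)
  also have "\<dots> = (\<Sum>i\<le>degree (A n). cnj (coeff (A n) i) * (\<integral>z. cnj (z ^ i) * poly (A n) z \<partial>\<mu>))"
    by (intro integral_cnj_poly_mult continuous_intros)
  also have "\<dots> = (\<Sum>i\<in>{n}. cnj (coeff (A n) i) * (\<integral>z. cnj (z ^ i) * poly (A n) z \<partial>\<mu>))"
    using assms unfolding degree_szego_monic monic_orthogonal_def by (intro sum.mono_neutral_right) auto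
  also have "\<dots> = (\<integral>z. cnj (z ^ n) * poly (A n) z \<partial>\<mu>)"
    using lead_coeff_szego_monic[of "verblunsky \<mu>" n] unfolding degree_szego_monic by simp
  finally have 1: "complex_of_real (\<integral>z. (cmod (poly (A n) z))\<^sup>2 \<partial>\<mu>) = (\<integral>z. cnj (z ^ n) * poly (A n) z \<partial>\<mu>)" .
  have "(\<integral>z. poly (B n) z \<partial>\<mu>) = (\<integral>z. cnj (cnj (z ^ n) * poly (A n) z) \<partial>\<mu>)"
    by (rule circle_integral_cong) (auto intro!: continuous_intros simp: dual_on_circle)
  also have "\<dots> = cnj (\<integral>z. cnj (z ^ n) * poly (A n) z \<partial>\<mu>)" by (rule Bochner_Integration.integral_cnj)
  finally show ?thesis unfolding 1[symmetric] by simp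
qed

lemma szego_polys_cong: "(\<And>k. k < n \<Longrightarrow> a k = a' k) \<Longrightarrow> szego_polys a n = szego_polys a' n"
  by (induction n) auto

text \<open>Existence of the orthogonal polynomials and the Szego recursion are obtained together: the
  recursion with a suitable coefficient preserves orthogonality, and uniqueness identifies the result.\<close>

lemma monic_orthogonal_szego: "monic_orthogonal \<mu> n (A n)"
proof (induction n)
  case 0
  then show ?case by (simp add: monic_orthogonal_def)
next
  case (Suc n)
  define N where "N = (\<integral>z. poly (B n) z \<partial>\<mu>)"
  have N: "N \<noteq> 0" unfolding N_def dual_integral[OF Suc] using poly_norm_integral_pos[of "A n"] by simp
  \<comment> \<open>Orthogonality to \<open>z, ..., z ^ n\<close> holds for any coefficient; this
    value settles the one remaining condition k = 0.\<close>
  define c where "c = (\<integral>z. z * poly (A n) z \<partial>\<mu>) / N"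
  \<comment> \<open>Changing the coefficient sequence only at \<open>n\<close> lets the facts on
    degrees apply to the candidate. Once its orthogonality is known, its value at 0 shows that
    nothing was changed.\<close>
  define a' where "a' = (verblunsky \<mu>)(n := cnj c)"
  have eq: "szego_polys a' n = szego_polys (verblunsky \<mu>) n"
    by (rule szego_polys_cong) (simp add: a'_def)
  define q where "q = szego_monic a' (Suc n)"
  have q: "q = pCons 0 (A n) - smult c (B n)"
    unfolding q_def szego_monic_def szego_dual_def by (simp add: eq) (simp add: a'_def)
  have "(\<integral>z. cnj (z ^ k) * poly q z \<partial>\<mu>) = 0" if k: "k < Suc n" for k
  proof -
    have "(\<integral>z. cnj (z ^ k) * poly q z \<partial>\<mu>) = (\<integral>z. cnj (z ^ k) * (z * poly (A n) z) - c * (cnj (z ^ k) * poly (B n) z) \<partial>\<mu>)"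
      unfolding q by (simp add: algebra_simps)
    also have "\<dots> = (\<integral>z. cnj (z ^ k) * (z * poly (A n) z) \<partial>\<mu>) - (\<integral>z. c * (cnj (z ^ k) * poly (B n) z) \<partial>\<mu>)"
      by (intro Bochner_Integration.integral_diff circle_integrable continuous_intros)
    also have "(\<integral>z. c * (cnj (z ^ k) * poly (B n) z) \<partial>\<mu>) = c * (\<integral>z. cnj (z ^ k) * poly (B n) z \<partial>\<mu>)" by simp
    also have "(\<integral>z. cnj (z ^ k) * (z * poly (A n) z) \<partial>\<mu>) - c * (\<integral>z. cnj (z ^ k) * poly (B n) z \<partial>\<mu>) = 0"
    proof (cases "k = 0")
      case True
      then show ?thesis using N by (simp add: c_def N_def)
    next
      case False
      have "(\<integral>z. cnj (z ^ k) * (z * poly (A n) z) \<partial>\<mu>) = (\<integral>z. cnj (z ^ (k - 1)) * poly (A n) z \<partial>\<mu>)"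
      proof (rule circle_integral_cong)
        fix z :: complex assume z: "cmod z = 1"
        then have one: "cnj z * z = 1" by (simp add: complex_norm_square[symmetric] mult.commute)
        have "cnj (z ^ k) * (z * poly (A n) z) = cnj (z ^ (k - 1)) * (cnj z * z) * poly (A n) z"
          using False by (cases k) (simp_all add: mult_ac)
        then show "cnj (z ^ k) * (z * poly (A n) z) = cnj (z ^ (k - 1)) * poly (A n) z" using one by simp
      qed (intro continuous_intros)+
      also have "\<dots> = 0" using Suc k False unfolding monic_orthogonal_def by simp
      finally show ?thesis using dual_orthogonal[OF Suc, of k] k False by simp
    qed
    finally show ?thesis .
  qed
  then have mo: "monic_orthogonal \<mu> (Suc n) q"
    unfolding monic_orthogonal_def q_def using degree_szego_monic lead_coeff_szego_monic by blast
  have "verblunsky \<mu> n = - cnj (poly q 0)" unfolding verblunsky_def OPUC_eqI[OF mo] ..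
  also have "\<dots> = cnj c" by (simp add: q)
  finally have "a' = verblunsky \<mu>" by (simp add: a'_def fun_eq_iff)
  then show ?case using mo unfolding q_def by simp
qed

lemma OPUC_eq_szego: "OPUC \<mu> n = A n"
  by (rule OPUC_eqI[OF monic_orthogonal_szego])

text \<open>Integrating the recursion gives \<open>N (Suc n) = N n * (1 - |\<alpha> n|^2)\<close>
  for the squared norms, which are all positive.\<close>

lemma verblunsky_lt_1: "cmod (verblunsky \<mu> n) < 1"
proof -
  define N where "N n = (\<integral>z. (cmod (poly (A n) z))\<^sup>2 \<partial>\<mu>)" for n
  have N: "N n > 0" for n unfolding N_def by (rule poly_norm_integral_pos) simp
  have NB: "(\<integral>z. poly (B n) z \<partial>\<mu>) = of_real (N n)" for n unfolding N_def by (rule dual_integral[OF monic_orthogonal_szego])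
  have "(\<integral>z. cnj (z ^ 0) * poly (A (Suc n)) z \<partial>\<mu>) = 0" using monic_orthogonal_szego[of "Suc n"] unfolding monic_orthogonal_def by blast
  then have "0 = (\<integral>z. z * poly (A n) z - cnj (verblunsky \<mu> n) * poly (B n) z \<partial>\<mu>)" by (simp add: poly_szego_monic_Suc)
  also have "\<dots> = (\<integral>z. z * poly (A n) z \<partial>\<mu>) - (\<integral>z. cnj (verblunsky \<mu> n) * poly (B n) z \<partial>\<mu>)"
    by (intro Bochner_Integration.integral_diff circle_integrable continuous_intros)
  finally have zA: "(\<integral>z. z * poly (A n) z \<partial>\<mu>) = cnj (verblunsky \<mu> n) * of_real (N n)" by (simp add: NB)
  have "of_real (N (Suc n)) = (\<integral>z. poly (B (Suc n)) z \<partial>\<mu>)" by (rule NB[symmetric])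
  also have "\<dots> = (\<integral>z. poly (B n) z - verblunsky \<mu> n * (z * poly (A n) z) \<partial>\<mu>)"
    by (simp only: poly_szego_dual_Suc)
  also have "\<dots> = (\<integral>z. poly (B n) z \<partial>\<mu>) - (\<integral>z. verblunsky \<mu> n * (z * poly (A n) z) \<partial>\<mu>)"
    by (intro Bochner_Integration.integral_diff circle_integrable continuous_intros)
  also have "\<dots> = of_real (N n) - verblunsky \<mu> n * (cnj (verblunsky \<mu> n) * of_real (N n))" by (simp add: NB zA)
  also have "\<dots> = of_real (N n * (1 - (cmod (verblunsky \<mu> n))\<^sup>2))"
    by (simp add: complex_norm_square algebra_simps del: of_real_power)
  finally have "N (Suc n) = N n * (1 - (cmod (verblunsky \<mu> n))\<^sup>2)" by (simp only: of_real_eq_iff)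
  then have "0 < 1 - (cmod (verblunsky \<mu> n))\<^sup>2" using N[of n] N[of "Suc n"] by (simp add: zero_less_mult_iff)
  then have "(cmod (verblunsky \<mu> n))\<^sup>2 < 1\<^sup>2" by simp
  then show ?thesis by (rule power2_less_imp_less) simp
qed

end

section \<open>The measure weighted by the squared modulus of d\<close>

locale circle_prob_geometric = circle_prob \<mu> + geometric_verblunsky "verblunsky \<mu>" C b \<Delta>
  for \<mu> C b \<Delta>
begin

lemma d_measurable [measurable]: "d \<in> borel_measurable borel"
  unfolding d_def[abs_def] by (intro borel_measurable_lim_metric borel_measurable_continuous_onI continuous_intros)

lemma dominated_circle_limit:
  fixes f :: "nat \<Rightarrow> complex \<Rightarrow> complex"
  assumes "\<And>n. f n \<in> borel_measurable borel" "g \<in> borel_measurable borel"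
    and "\<And>z. cmod z = 1 \<Longrightarrow> (\<lambda>n. f n z) \<longlonglongrightarrow> g z" and "\<And>n z. cmod z = 1 \<Longrightarrow> cmod (f n z) \<le> K"
  shows "(\<lambda>n. \<integral>z. f n z \<partial>\<mu>) \<longlonglongrightarrow> (\<integral>z. g z \<partial>\<mu>)"
proof (rule integral_dominated_convergence[where w = "\<lambda>_. K"])
  show "f n \<in> borel_measurable \<mu>" "g \<in> borel_measurable \<mu>" for n
    using assms(1,2) by (simp_all cong: measurable_cong_sets[OF sets_\<mu> refl])
  show "AE z in \<mu>. (\<lambda>n. f n z) \<longlonglongrightarrow> g z" using AE_circle assms(3) by (auto elim: eventually_mono)
  show "AE z in \<mu>. cmod (f n z) \<le> K" for n using AE_circle assms(4) by (auto elim: eventually_mono)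
qed simp

text \<open>The constant in \<open>|d|^2 d\<mu> = N_inf d\<theta> / (2 pi)\<close>; its square root
  becomes the normalisation in \<open>D = sqrt N_inf / d\<close>.\<close>

definition N_inf :: real where "N_inf = (\<integral>z. (cmod (d z))\<^sup>2 \<partial>\<mu>)"

text \<open>The dual polynomial of degree \<open>n\<close> is orthogonal to \<open>z, ..., z ^ n\<close>. Hence the moments of
  \<open>cnj (\<Phi>' m z) * \<Phi>' n z\<close> vanish up to order \<open>n - m\<close>, and one lets \<open>n\<close> and then \<open>m\<close> tend to infinity.\<close>

lemma d_moments:
  "(\<integral>z. cnj (z ^ k) * (cmod (d z))\<^sup>2 \<partial>\<mu>) = (if k = 0 then of_real N_inf else 0)"
proof -
  obtain c0 M0 where M0: "0 < c0" "c0 \<le> M0" "\<And>z. cmod z \<le> 1 \<Longrightarrow> c0 \<le> cmod (d z) \<and> cmod (d z) \<le> M0"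
    "\<And>n z. cmod z \<le> 1 \<Longrightarrow> c0 \<le> cmod (poly (\<Phi>' n) z) \<and> cmod (poly (\<Phi>' n) z) \<le> M0"
    by (rule d_bounds) blast
  have t: "(\<lambda>n. poly (\<Phi>' n) z) \<longlonglongrightarrow> d z" if "cmod z = 1" for z
    using that b by (intro dual_tendsto_d) auto
  have Bm: "poly (\<Phi>' n) \<in> borel_measurable borel" for n by (intro borel_measurable_continuous_onI continuous_intros)
  define I where "I = (\<integral>z. d z \<partial>\<mu>)"
  \<comment> \<open>In the expansion of the polynomial of index m, every power except the constant
    term of the case k = 0 hits the orthogonality range of the one of index n; the constant
    coefficient is 1.\<close>
  have fin: "(\<integral>z. cnj (poly (\<Phi>' m) z) * (cnj (z ^ k) * poly (\<Phi>' n) z) \<partial>\<mu>) = (if k = 0 then (\<integral>z. poly (\<Phi>' n) z \<partial>\<mu>) else 0)"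
    if "k + m \<le> n" for m n
  proof -
    have "(\<integral>z. cnj (poly (\<Phi>' m) z) * (cnj (z ^ k) * poly (\<Phi>' n) z) \<partial>\<mu>)
      = (\<Sum>i\<le>degree (\<Phi>' m). cnj (coeff (\<Phi>' m) i) * (\<integral>z. cnj (z ^ i) * (cnj (z ^ k) * poly (\<Phi>' n) z) \<partial>\<mu>))"
      by (intro integral_cnj_poly_mult continuous_intros)
    also have "\<dots> = (\<Sum>i\<le>degree (\<Phi>' m). if i = 0 \<and> k = 0 then (\<integral>z. poly (\<Phi>' n) z \<partial>\<mu>) else 0)"
    proof (rule sum.cong)
      fix i assume "i \<in> {..degree (\<Phi>' m)}"
      then have i: "i \<le> m" using degree_szego_dual[of "verblunsky \<mu>" m] by auto
      have "coeff (\<Phi>' m) 0 = 1" by (simp flip: poly_0_coeff_0)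
      moreover have "(\<integral>z. cnj (z ^ i) * (cnj (z ^ k) * poly (\<Phi>' n) z) \<partial>\<mu>) = 0" if "\<not> (i = 0 \<and> k = 0)"
      proof -
        have "1 \<le> i + k" "i + k \<le> n" using that i \<open>k + m \<le> n\<close> by auto
        from dual_orthogonal[OF monic_orthogonal_szego this] show ?thesis by (simp add: power_add mult.assoc)
      qed
      ultimately show "cnj (coeff (\<Phi>' m) i) * (\<integral>z. cnj (z ^ i) * (cnj (z ^ k) * poly (\<Phi>' n) z) \<partial>\<mu>)
         = (if i = 0 \<and> k = 0 then (\<integral>z. poly (\<Phi>' n) z \<partial>\<mu>) else 0)" by auto
    qed simp
    also have "\<dots> = (if k = 0 then (\<integral>z. poly (\<Phi>' n) z \<partial>\<mu>) else 0)" by (auto simp: sum.delta)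
    finally show ?thesis .
  qed
  have 1: "(\<lambda>n. \<integral>z. poly (\<Phi>' n) z \<partial>\<mu>) \<longlonglongrightarrow> I"
    unfolding I_def using M0 t Bm by (intro dominated_circle_limit[where K = M0]) auto
  have 2: "(\<integral>z. cnj (poly (\<Phi>' m) z) * (cnj (z ^ k) * d z) \<partial>\<mu>) = (if k = 0 then I else 0)" for m
  proof (rule LIMSEQ_unique)
    show "(\<lambda>n. \<integral>z. cnj (poly (\<Phi>' m) z) * (cnj (z ^ k) * poly (\<Phi>' n) z) \<partial>\<mu>) \<longlonglongrightarrow> (\<integral>z. cnj (poly (\<Phi>' m) z) * (cnj (z ^ k) * d z) \<partial>\<mu>)"
    proof (rule dominated_circle_limit[where K = "M0 * (1 * M0)"])
      show "cmod (cnj (poly (\<Phi>' m) z) * (cnj (z ^ k) * poly (\<Phi>' n) z)) \<le> M0 * (1 * M0)" if "cmod z = 1" for n z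
        unfolding norm_mult using that M0 by (intro mult_mono) (auto simp: norm_power)
      show "(\<lambda>z. cnj (poly (\<Phi>' m) z) * (cnj (z ^ k) * d z)) \<in> borel_measurable borel" using Bm by measurable
      show "(\<lambda>z. cnj (poly (\<Phi>' m) z) * (cnj (z ^ k) * poly (\<Phi>' n) z)) \<in> borel_measurable borel" for n using Bm by measurable
    qed (auto intro!: tendsto_intros t)
    have "(\<lambda>n. if k = 0 then (\<integral>z. poly (\<Phi>' n) z \<partial>\<mu>) else 0) \<longlonglongrightarrow> (if k = 0 then I else 0)" using 1 by auto
    then show "(\<lambda>n. \<integral>z. cnj (poly (\<Phi>' m) z) * (cnj (z ^ k) * poly (\<Phi>' n) z) \<partial>\<mu>) \<longlonglongrightarrow> (if k = 0 then I else 0)"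
      by (rule Lim_transform_eventually) (rule eventually_sequentiallyI[of "k + m"], simp only: fin)
  qed
  have 3: "(\<integral>z. cnj (z ^ k) * (cmod (d z))\<^sup>2 \<partial>\<mu>) = (if k = 0 then I else 0)"
  proof (rule LIMSEQ_unique)
    show "(\<lambda>m. \<integral>z. cnj (poly (\<Phi>' m) z) * (cnj (z ^ k) * d z) \<partial>\<mu>) \<longlonglongrightarrow> (\<integral>z. cnj (z ^ k) * (cmod (d z))\<^sup>2 \<partial>\<mu>)"
    proof (rule dominated_circle_limit[where K = "M0 * (1 * M0)"])
      show "cmod (cnj (poly (\<Phi>' m) z) * (cnj (z ^ k) * d z)) \<le> M0 * (1 * M0)" if "cmod z = 1" for m z
        unfolding norm_mult using that M0 by (intro mult_mono) (auto simp: norm_power)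
      show "(\<lambda>z. cnj (poly (\<Phi>' m) z) * (cnj (z ^ k) * d z)) \<in> borel_measurable borel" for m using Bm by measurable
      show "(\<lambda>z. cnj (z ^ k) * complex_of_real ((cmod (d z))\<^sup>2)) \<in> borel_measurable borel" by measurable
      show "(\<lambda>m. cnj (poly (\<Phi>' m) z) * (cnj (z ^ k) * d z)) \<longlonglongrightarrow> cnj (z ^ k) * complex_of_real ((cmod (d z))\<^sup>2)"
        if "cmod z = 1" for z
      proof -
        have "(\<lambda>m. cnj (poly (\<Phi>' m) z) * (cnj (z ^ k) * d z)) \<longlonglongrightarrow> cnj (d z) * (cnj (z ^ k) * d z)"
          by (intro tendsto_intros t that)
        then show ?thesis unfolding complex_norm_square by (simp add: mult_ac)
      qed
    qed
    show "(\<lambda>m. \<integral>z. cnj (poly (\<Phi>' m) z) * (cnj (z ^ k) * d z) \<partial>\<mu>) \<longlonglongrightarrow> (if k = 0 then I else 0)"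
      unfolding 2 by (rule tendsto_const)
  qed
  show ?thesis
  proof (cases "k = 0")
    case True
    have "(\<integral>z. cnj (z ^ 0) * complex_of_real ((cmod (d z))\<^sup>2) \<partial>\<mu>) = of_real N_inf"
      unfolding N_inf_def by (simp flip: integral_complex_of_real)
    then show ?thesis using True by simp
  next
    case False
    then show ?thesis using 3 by simp
  qed
qed

lemma N_inf_pos: "0 < N_inf"
proof -
  obtain c0 M0 where M0: "0 < c0" "c0 \<le> M0" "\<And>z. cmod z \<le> 1 \<Longrightarrow> c0 \<le> cmod (d z) \<and> cmod (d z) \<le> M0"
    by (rule d_bounds) blast
  have "integrable \<mu> (\<lambda>z. (cmod (d z))\<^sup>2)"
  proof (rule circle_measure_integrable[OF circle_measure_\<mu>])
    show "norm ((cmod (d z))\<^sup>2) \<le> M0\<^sup>2" if "cmod z = 1" for z using M0(3)[of z] that by (simp add: power_mono)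
  qed measurable
  then have "(\<integral>z. c0\<^sup>2 \<partial>\<mu>) \<le> N_inf" unfolding N_inf_def
  proof (rule integral_mono_AE[rotated])
    show "AE z in \<mu>. c0\<^sup>2 \<le> (cmod (d z))\<^sup>2" using AE_circle
    proof eventually_elim
      case (elim z)
      then show ?case using M0(1) M0(3)[of z] by (simp add: power_mono)
    qed
  qed simp
  then have "c0\<^sup>2 \<le> N_inf" by (simp add: prob_space)
  moreover have "0 < c0\<^sup>2" using M0 by simp
  ultimately show ?thesis by linarith
qed

end

section \<open>Angles, and the weight of the absolutely continuous part\<close>

lemma emeasure_angle_interval: "emeasure lborel {0..<2 * pi} = ennreal (2 * pi)"
  by simp

lemma AE_angle_measure: "(AE \<theta> in angle_measure. P \<theta>) \<longleftrightarrow> (AE \<theta> in lborel. \<theta> \<in> {0..<2 * pi} \<longrightarrow> P \<theta>)"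
  unfolding angle_measure_def by (rule AE_uniform_measure) auto

lemma prob_space_angle_measure: "prob_space angle_measure"
  unfolding angle_measure_def by (rule prob_space_uniform_measure) auto

lemma sets_angle_measure [measurable_cong]: "sets angle_measure = sets borel"
  by (simp add: angle_measure_def)

lemma space_angle_measure: "space angle_measure = UNIV"
  by (simp add: angle_measure_def)

lemma cis_measurable [measurable]: "cis \<in> borel_measurable borel"
  by (intro borel_measurable_continuous_onI continuous_intros)

text \<open>A measurable inverse of \<open>cis\<close> on [0, 2 pi), used to turn sets of angles
  into Borel sets of the plane.\<close>

definition angle :: "complex \<Rightarrow> real" where
  "angle z = (if Im (Ln z) < 0 then Im (Ln z) + 2 * pi else Im (Ln z))"

lemma angle_measurable [measurable]: "angle \<in> borel_measurable borel"
  unfolding angle_def[abs_def] by measurable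

lemma angle_cis:
  assumes "0 \<le> \<theta>" "\<theta> < 2 * pi"
  shows "angle (cis \<theta>) = \<theta>"
proof (cases "\<theta> \<le> pi")
  case True
  have "Ln (exp (\<i> * of_real \<theta>)) = \<i> * of_real \<theta>"
  proof (rule Ln_exp)
    have "- pi < \<theta>" using assms pi_gt_zero by linarith
    then show "- pi < Im (\<i> * complex_of_real \<theta>)" by simp
  qed (use True in simp)
  then show ?thesis using assms by (simp add: angle_def cis_conv_exp)
next
  case False
  have "cis \<theta> = cis (\<theta> - 2 * pi)" by (simp add: cis_divide[symmetric])
  also have "\<dots> = exp (\<i> * of_real (\<theta> - 2 * pi))" by (simp add: cis_conv_exp)
  finally have e: "cis \<theta> = exp (\<i> * of_real (\<theta> - 2 * pi))" .
  have "Ln (exp (\<i> * of_real (\<theta> - 2 * pi))) = \<i> * of_real (\<theta> - 2 * pi)"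
    using assms False by (intro Ln_exp) auto
  then show ?thesis using assms unfolding e by (simp add: angle_def)
qed

lemma integral_angle_measure_cis_power:
  "(\<integral>\<theta>. cis \<theta> ^ k \<partial>angle_measure) = (if k = 0 then 1 else 0)"
proof -
  have ang: "angle_measure = density lborel (\<lambda>\<theta>. ennreal (indicator {0..<2 * pi} \<theta> / (2 * pi)))"
    unfolding angle_measure_def uniform_measure_def emeasure_angle_interval
    by (intro arg_cong[where f = "density lborel"] ext)
       (auto simp: indicator_def divide_ennreal[symmetric] simp flip: ennreal_1)
  have m: "(\<lambda>\<theta>. cis \<theta> ^ k) \<in> borel_measurable lborel" by measurable
  have "(\<integral>\<theta>. cis \<theta> ^ k \<partial>angle_measure) = (\<integral>\<theta>. (indicator {0..<2 * pi} \<theta> / (2 * pi)) *\<^sub>R cis \<theta> ^ k \<partial>lborel)"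
    unfolding ang by (rule integral_density[OF m]) auto
  also have "\<dots> = (\<integral>\<theta>. (1 / (2 * pi)) *\<^sub>R (indicator {0..2 * pi} \<theta> *\<^sub>R cis \<theta> ^ k) \<partial>lborel)"
  proof (rule integral_cong_AE)
    have "AE \<theta> in lborel. \<theta> \<noteq> 2 * pi" by (rule AE_lborel_singleton)
    then show "AE \<theta> in lborel. (indicator {0..<2 * pi} \<theta> / (2 * pi)) *\<^sub>R cis \<theta> ^ k = (1 / (2 * pi)) *\<^sub>R (indicator {0..2 * pi} \<theta> *\<^sub>R cis \<theta> ^ k)"
      by eventually_elim (auto simp: indicator_def)
  qed measurable
  also have "\<dots> = (1 / (2 * pi)) *\<^sub>R (LINT \<theta>:{0..2 * pi}|lborel. cis \<theta> ^ k)"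
    unfolding set_lebesgue_integral_def by (rule integral_scaleR_right)
  also have "(LINT \<theta>:{0..2 * pi}|lborel. cis \<theta> ^ k) = integral {0..2 * pi} (\<lambda>\<theta>. cis \<theta> ^ k)"
    by (intro set_borel_integral_eq_integral borel_integrable_atLeastAtMost' continuous_intros)
  also have "\<dots> = (if k = 0 then of_real (2 * pi) else 0)"
    by (rule integral_unique[OF cis_integral])
  finally show ?thesis by (simp add: scaleR_conv_of_real)
qed

context circle_prob_geometric
begin

definition \<nu> :: "complex measure" where "\<nu> = distr angle_measure borel cis"

lemma cis_angle_measurable: "cis \<in> measurable angle_measure borel"
  by (simp cong: measurable_cong_sets[OF sets_angle_measure refl])

lemma circle_measure_d: "circle_measure (density \<mu> (\<lambda>z. ennreal ((cmod (d z))\<^sup>2)))"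
  and circle_measure_\<nu>: "circle_measure (density \<nu> (\<lambda>z. ennreal N_inf))"
proof -
  obtain c0 M0 where M0: "0 < c0" "c0 \<le> M0" "\<And>z. cmod z \<le> 1 \<Longrightarrow> c0 \<le> cmod (d z) \<and> cmod (d z) \<le> M0"
    by (rule d_bounds) blast
  have m: "(\<lambda>z. ennreal ((cmod (d z))\<^sup>2)) \<in> borel_measurable \<mu>"
    by (simp cong: measurable_cong_sets[OF sets_\<mu> refl])
  have "(\<integral>\<^sup>+z. ennreal ((cmod (d z))\<^sup>2) \<partial>\<mu>) \<le> (\<integral>\<^sup>+z. ennreal (M0\<^sup>2) \<partial>\<mu>)"
    by (rule nn_integral_mono_AE) (use AE_circle M0 in \<open>auto elim!: eventually_mono intro!: ennreal_leI power_mono\<close>)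
  also have "\<dots> < \<infinity>" by (simp add: emeasure_space_1)
  finally have fin: "(\<integral>\<^sup>+z. ennreal ((cmod (d z))\<^sup>2) \<partial>\<mu>) \<noteq> \<infinity>" by simp
  have "finite_measure (density \<mu> (\<lambda>z. ennreal ((cmod (d z))\<^sup>2)))"
    by (rule finite_measureI) (use fin m in \<open>simp add: emeasure_density cong: nn_integral_cong\<close>)
  moreover have "AE z in density \<mu> (\<lambda>z. ennreal ((cmod (d z))\<^sup>2)). cmod z = 1"
    using m AE_circle by (subst AE_density) (auto elim: eventually_mono)
  ultimately show "circle_measure (density \<mu> (\<lambda>z. ennreal ((cmod (d z))\<^sup>2)))"
    unfolding circle_measure_def using sets_\<mu> by simp
  interpret A: prob_space angle_measure by (rule prob_space_angle_measure)
  interpret n: prob_space \<nu> unfolding \<nu>_def by (rule A.prob_space_distr[OF cis_angle_measurable])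
  have "finite_measure (density \<nu> (\<lambda>z. ennreal N_inf))"
    by (rule finite_measureI) (simp add: emeasure_density n.emeasure_space_1)
  moreover have "AE z in \<nu>. cmod z = 1" unfolding \<nu>_def
    by (subst AE_distr_iff[OF cis_angle_measurable]) auto
  then have "AE z in density \<nu> (\<lambda>z. ennreal N_inf). cmod z = 1"
    by (subst AE_density) (auto elim: eventually_mono)
  ultimately show "circle_measure (density \<nu> (\<lambda>z. ennreal N_inf))"
    unfolding circle_measure_def by (simp add: \<nu>_def)
qed

text \<open>The moments of both sides are \<open>N_inf\<close> for k = 0 and 0 otherwise; on the
  left this is the conjugate of \<open>d_moments\<close>.\<close>

lemma density_d_eq: "density \<mu> (\<lambda>z. ennreal ((cmod (d z))\<^sup>2)) = density \<nu> (\<lambda>z. ennreal N_inf)"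
proof (rule circle_measure_eqI[OF circle_measure_d circle_measure_\<nu>])
  fix k
  have "(\<integral>z. z ^ k \<partial>density \<mu> (\<lambda>z. ennreal ((cmod (d z))\<^sup>2))) = (\<integral>z. (cmod (d z))\<^sup>2 *\<^sub>R z ^ k \<partial>\<mu>)"
    by (rule integral_density) (simp_all cong: measurable_cong_sets[OF sets_\<mu> refl])
  also have "\<dots> = (\<integral>z. cnj (cnj (z ^ k) * complex_of_real ((cmod (d z))\<^sup>2)) \<partial>\<mu>)"
    by (intro Bochner_Integration.integral_cong refl) (simp add: scaleR_conv_of_real mult.commute)
  also have "\<dots> = cnj (\<integral>z. cnj (z ^ k) * complex_of_real ((cmod (d z))\<^sup>2) \<partial>\<mu>)"
    by (rule Bochner_Integration.integral_cnj)
  also have "\<dots> = (if k = 0 then of_real N_inf else 0)" unfolding d_moments by simp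
  finally have 1: "(\<integral>z. z ^ k \<partial>density \<mu> (\<lambda>z. ennreal ((cmod (d z))\<^sup>2))) = (if k = 0 then of_real N_inf else 0)" .
  have "(\<integral>z. z ^ k \<partial>density \<nu> (\<lambda>z. ennreal N_inf)) = (\<integral>z. N_inf *\<^sub>R z ^ k \<partial>\<nu>)"
    using N_inf_pos by (intro integral_density) (auto simp: \<nu>_def)
  also have "\<dots> = N_inf *\<^sub>R (\<integral>z. z ^ k \<partial>\<nu>)" by simp
  also have "(\<integral>z. z ^ k \<partial>\<nu>) = (\<integral>\<theta>. cis \<theta> ^ k \<partial>angle_measure)"
    unfolding \<nu>_def by (rule integral_distr[OF cis_angle_measurable]) simp
  also have "\<dots> = (if k = 0 then 1 else 0)" by (rule integral_angle_measure_cis_power)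
  finally show "(\<integral>z. z ^ k \<partial>density \<mu> (\<lambda>z. ennreal ((cmod (d z))\<^sup>2))) = (\<integral>z. z ^ k \<partial>density \<nu> (\<lambda>z. ennreal N_inf))"
    unfolding 1 by (simp add: scaleR_conv_of_real)
qed

text \<open>Off a null set carrying the singular part, \<open>\<mu>\<close> is given both by
  \<open>w\<close> and, after division by the nonvanishing \<open>|d|^2\<close>, by
  \<open>N_inf / |d|^2\<close>. Densities are unique almost everywhere.\<close>

lemma weight_eq:
  assumes dec: "circle_decomposition \<mu> w \<mu>s"
  shows "AE \<theta> in angle_measure. w \<theta> = N_inf / (cmod (d (cis \<theta>)))\<^sup>2"
proof -
  interpret A: prob_space angle_measure by (rule prob_space_angle_measure)
  have w [measurable]: "w \<in> borel_measurable borel" and w0: "\<And>\<theta>. 0 \<le> w \<theta>" and sets_\<mu>s: "sets \<mu>s = sets borel"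
    using dec unfolding circle_decomposition_def by auto
  obtain S where S [measurable]: "S \<in> sets borel" and S0: "emeasure \<nu> S = 0" "emeasure \<mu>s (UNIV - S) = 0"
    using dec unfolding circle_decomposition_def \<nu>_def by blast
  have em: "emeasure \<mu> E = emeasure (distr (density angle_measure (\<lambda>\<theta>. ennreal (w \<theta>))) borel cis) E + emeasure \<mu>s E"
    if "E \<in> sets borel" for E using dec that unfolding circle_decomposition_def by blast
  define v where "v z = N_inf / (cmod (d z))\<^sup>2" for z
  have v [measurable]: "v \<in> borel_measurable borel" unfolding v_def[abs_def] by measurable
  have wA: "w \<in> borel_measurable angle_measure" by (simp cong: measurable_cong_sets[OF sets_angle_measure refl])
  have vA: "(\<lambda>\<theta>. v (cis \<theta>)) \<in> borel_measurable angle_measure" by (simp cong: measurable_cong_sets[OF sets_angle_measure refl])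
  have good: "AE \<theta> in angle_measure. angle (cis \<theta>) = \<theta> \<and> cis \<theta> \<notin> S"
  proof (rule AE_conjI)
    show "AE \<theta> in angle_measure. angle (cis \<theta>) = \<theta>" unfolding AE_angle_measure by (auto simp: angle_cis)
    have "AE z in \<nu>. z \<notin> S" by (rule AE_not_in) (use S S0 in \<open>simp add: null_sets_def \<nu>_def\<close>)
    then show "AE \<theta> in angle_measure. cis \<theta> \<notin> S" unfolding \<nu>_def by (subst (asm) AE_distr_iff[OF cis_angle_measurable]) auto
  qed
  have "AE \<theta> in angle_measure. ennreal (w \<theta>) = ennreal (v (cis \<theta>))"
  proof (rule A.density_unique2)
    show "(\<lambda>\<theta>. ennreal (w \<theta>)) \<in> borel_measurable angle_measure" "(\<lambda>\<theta>. ennreal (v (cis \<theta>))) \<in> borel_measurable angle_measure"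
      using wA vA by measurable
    fix D assume "D \<in> sets angle_measure"
    then have D [measurable]: "D \<in> sets borel" by (simp add: sets_angle_measure)
    \<comment> \<open>The points with angle in \<open>D\<close>, with the carrier of the singular
      part removed. Almost every angle belongs to \<open>D\<close> exactly if its point belongs to
      \<open>E\<close>.\<close>
    define E where "E = angle -` D - S"
    have "angle -` D \<in> sets borel" using measurable_sets[OF angle_measurable D] by simp
    then have E [measurable]: "E \<in> sets borel" unfolding E_def by simp
    have ED: "AE \<theta> in angle_measure. cis \<theta> \<in> E \<longleftrightarrow> \<theta> \<in> D" using good by eventually_elim (auto simp: E_def)
    have "emeasure \<mu>s E \<le> emeasure \<mu>s (UNIV - S)" by (rule emeasure_mono) (auto simp: E_def sets_\<mu>s)
    then have "emeasure \<mu>s E = 0" using S0 by simp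
    then have "emeasure \<mu> E = emeasure (density angle_measure (\<lambda>\<theta>. ennreal (w \<theta>))) (cis -` E)"
      using em[OF E] by (subst (asm) emeasure_distr) (simp_all add: space_angle_measure cong: measurable_cong_sets[OF sets_angle_measure refl])
    also have "\<dots> = (\<integral>\<^sup>+\<theta>. ennreal (w \<theta>) * indicator (cis -` E) \<theta> \<partial>angle_measure)"
    proof (rule emeasure_density)
      show "cis -` E \<in> sets angle_measure" using measurable_sets[OF cis_measurable E] by (simp add: sets_angle_measure)
    qed (use wA in measurable)
    also have "\<dots> = (\<integral>\<^sup>+\<theta>\<in>D. ennreal (w \<theta>) \<partial>angle_measure)"
      using ED by (intro nn_integral_cong_AE) (auto elim!: eventually_mono simp: indicator_def)
    finally have 1: "emeasure \<mu> E = (\<integral>\<^sup>+\<theta>\<in>D. ennreal (w \<theta>) \<partial>angle_measure)" .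
    have "emeasure \<mu> E = (\<integral>\<^sup>+z. indicator E z \<partial>\<mu>)" by (simp add: sets_\<mu>)
    also have "\<dots> = (\<integral>\<^sup>+z. ennreal ((cmod (d z))\<^sup>2) * (ennreal (1 / (cmod (d z))\<^sup>2) * indicator E z) \<partial>\<mu>)"
    proof (rule nn_integral_cong_AE)
      show "AE z in \<mu>. indicator E z = ennreal ((cmod (d z))\<^sup>2) * (ennreal (1 / (cmod (d z))\<^sup>2) * indicator E z)"
        using AE_circle
      proof eventually_elim
        case (elim z)
        have "d z \<noteq> 0" using d_nonzero[of z] elim by simp
        then show ?case by (simp add: indicator_def ennreal_mult[symmetric])
      qed
    qed
    also have "\<dots> = (\<integral>\<^sup>+z. (ennreal (1 / (cmod (d z))\<^sup>2) * indicator E z) \<partial>density \<mu> (\<lambda>z. ennreal ((cmod (d z))\<^sup>2)))"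
      by (subst nn_integral_density) (simp_all cong: measurable_cong_sets[OF sets_\<mu> refl])
    also have "\<dots> = (\<integral>\<^sup>+z. ennreal N_inf * (ennreal (1 / (cmod (d z))\<^sup>2) * indicator E z) \<partial>\<nu>)"
      unfolding density_d_eq by (subst nn_integral_density) (simp_all add: \<nu>_def)
    also have "\<dots> = (\<integral>\<^sup>+\<theta>. ennreal N_inf * (ennreal (1 / (cmod (d (cis \<theta>)))\<^sup>2) * indicator E (cis \<theta>)) \<partial>angle_measure)"
      unfolding \<nu>_def by (rule nn_integral_distr[OF cis_angle_measurable]) simp
    also have "\<dots> = (\<integral>\<^sup>+\<theta>\<in>D. ennreal (v (cis \<theta>)) \<partial>angle_measure)"
      using ED N_inf_pos by (intro nn_integral_cong_AE) (auto elim!: eventually_mono simp: indicator_def v_def ennreal_mult[symmetric])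
    finally show "(\<integral>\<^sup>+\<theta>\<in>D. ennreal (w \<theta>) \<partial>angle_measure) = (\<integral>\<^sup>+\<theta>\<in>D. ennreal (v (cis \<theta>)) \<partial>angle_measure)"
      unfolding 1 .
  qed
  then show ?thesis
  proof eventually_elim
    case (elim \<theta>)
    have "0 \<le> v (cis \<theta>)" using N_inf_pos by (simp add: v_def)
    then show ?case using elim w0 by (simp add: v_def)
  qed
qed

end

section \<open>Schwarz's formula and the Szego function\<close>

lemma cauchy_angle_integral:
  fixes f :: "complex \<Rightarrow> complex"
  assumes f: "f holomorphic_on ball 0 R" "1 < R" and w: "cmod w < 1"
  shows "((\<lambda>\<theta>. f (cis \<theta>) * cis \<theta> / (cis \<theta> - w)) has_integral 2 * pi * f w) {0..2 * pi}"
proof -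
  have "f holomorphic_on cball 0 1" using f by (intro holomorphic_on_subset[OF f(1)]) auto
  from Cauchy_integral_circlepath_simple[OF this, of w] w
  have "((\<lambda>u. f u / (u - w)) has_contour_integral (2 * of_real pi * \<i> * f w)) (circlepath 0 1)" by simp
  then have "((\<lambda>t. f (cis t) / (cis t - w) * \<i> * cis t) has_integral (2 * of_real pi * \<i> * f w)) {0..2 * pi}"
    unfolding circlepath_def by (subst (asm) has_contour_integral_part_circlepath_iff) auto
  from has_integral_mult_right[OF this, of "- \<i>"]
  show ?thesis by (simp add: algebra_simps)
qed

text \<open>With \<open>c = ln N_inf\<close> and \<open>f\<close> a logarithm of \<open>d\<close>,
  the real factor is the logarithm of the weight. The kernel is
  \<open>2 * cis \<theta> / (cis \<theta> - z) - 1\<close>, so the constant and \<open>f\<close> are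
  handled by Cauchy's formula.\<close>

lemma schwarz_formula:
  fixes f :: "complex \<Rightarrow> complex"
  assumes f: "f holomorphic_on ball 0 R" "1 < R" and f0: "f 0 = 0" and z: "cmod z < 1"
  shows "((\<lambda>\<theta>. (cis \<theta> + z) / (cis \<theta> - z) * complex_of_real (c - 2 * Re (f (cis \<theta>)))) has_integral
           (2 * pi * c - 4 * pi * f z)) {0..2 * pi}"
proof -
  have ne: "cis \<theta> - z \<noteq> 0" for \<theta> using z by (metis eq_iff_diff_eq_0 norm_cis less_irrefl)
  have S: "(cis \<theta> + z) / (cis \<theta> - z) = 2 * (cis \<theta> / (cis \<theta> - z)) - 1" for \<theta>
    using ne[of \<theta>] by (simp add: field_simps)
  have 1: "((\<lambda>\<theta>. cis \<theta> / (cis \<theta> - z)) has_integral 2 * complex_of_real pi) {0..2 * pi}"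
    using cauchy_angle_integral[of "\<lambda>_. 1" 2 z] z by simp
  have one: "((\<lambda>\<theta>. 1::complex) has_integral 2 * complex_of_real pi) {0..2 * pi}"
    using has_integral_const_real[of "1::complex" 0 "2 * pi"] by (simp add: scaleR_conv_of_real)
  have I1: "((\<lambda>\<theta>. of_real c * (2 * (cis \<theta> / (cis \<theta> - z)) - 1)) has_integral of_real c * (2 * (2 * complex_of_real pi) - 2 * complex_of_real pi)) {0..2 * pi}"
    by (intro has_integral_mult_right has_integral_diff 1 one)
  have f1: "((\<lambda>\<theta>. f (cis \<theta>) * cis \<theta> / (cis \<theta> - z)) has_integral 2 * pi * f z) {0..2 * pi}"
    by (rule cauchy_angle_integral[OF f z])
  have f2: "((\<lambda>\<theta>. f (cis \<theta>)) has_integral 0) {0..2 * pi}"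
    using cauchy_angle_integral[OF f, of 0] f0 by simp
  have I2: "((\<lambda>\<theta>. 2 * (f (cis \<theta>) * cis \<theta> / (cis \<theta> - z)) - f (cis \<theta>)) has_integral 2 * (2 * pi * f z) - 0) {0..2 * pi}"
    by (intro has_integral_mult_right has_integral_diff f1 f2)
  \<comment> \<open>On the circle the conjugate of the kernel is holomorphic in the whole disk, so the
    antiholomorphic part of the integrand only sees \<open>f 0 = 0\<close>.\<close>
  define h where "h u = f u * (1 + cnj z * u) / (1 - cnj z * u)" for u
  \<comment> \<open>The pole of \<open>h\<close> has modulus \<open>1 / |z| > 1\<close>; for z = 0
    there is none and 2 is an arbitrary radius.\<close>
  define R' where "R' = min R (if z = 0 then 2 else 1 / cmod z)"
  have R': "1 < R'" using f(2) z by (auto simp: R'_def)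
  have hol: "h holomorphic_on ball 0 R'"
  proof -
    have "1 - cnj z * u \<noteq> 0" if "u \<in> ball 0 R'" for u
    proof
      assume "1 - cnj z * u = 0"
      then have "cnj z * u = 1" by simp
      then have "cmod z * cmod u = 1" by (metis norm_mult complex_mod_cnj norm_one)
      moreover have "z \<noteq> 0" using \<open>cnj z * u = 1\<close> by auto
      then have "cmod u < 1 / cmod z" using that by (simp add: R'_def)
      ultimately show False using \<open>z \<noteq> 0\<close> by (simp add: field_simps)
    qed
    moreover have "f holomorphic_on ball 0 R'" by (rule holomorphic_on_subset[OF f(1)]) (auto simp: R'_def)
    ultimately show ?thesis unfolding h_def[abs_def] by (intro holomorphic_intros) auto
  qed
  have "((\<lambda>\<theta>. h (cis \<theta>)) has_integral 0) {0..2 * pi}"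
    using cauchy_angle_integral[OF hol R', of 0] f0 by (simp add: h_def)
  then have "((cnj \<circ> (\<lambda>\<theta>. h (cis \<theta>))) has_integral cnj 0) {0..2 * pi}" by (subst has_integral_cnj)
  moreover have "cnj (h (cis \<theta>)) = (cis \<theta> + z) / (cis \<theta> - z) * cnj (f (cis \<theta>))" for \<theta>
  proof -
    have c: "cnj (cis \<theta>) = 1 / cis \<theta>" unfolding cis_cnj inverse_eq_divide[symmetric] by (rule cis_inverse[symmetric])
    have n0: "cis \<theta> \<noteq> 0" by simp
    have "cnj (h (cis \<theta>)) = cnj (f (cis \<theta>)) * ((1 + z * (1 / cis \<theta>)) / (1 - z * (1 / cis \<theta>)))"
      unfolding h_def by (simp only: complex_cnj_mult complex_cnj_divide complex_cnj_add complex_cnj_diff complex_cnj_one complex_cnj_cnj c times_divide_eq_right)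
    moreover have "(1 + z * (1 / cis \<theta>)) / (1 - z * (1 / cis \<theta>)) = (cis \<theta> + z) / (cis \<theta> - z)"
      using n0 ne[of \<theta>] by (simp add: field_simps)
    ultimately show ?thesis by (simp only: mult.commute)
  qed
  ultimately have I3: "((\<lambda>\<theta>. (cis \<theta> + z) / (cis \<theta> - z) * cnj (f (cis \<theta>))) has_integral 0) {0..2 * pi}"
    by (simp add: o_def)
  have total: "((\<lambda>\<theta>. of_real c * (2 * (cis \<theta> / (cis \<theta> - z)) - 1) - (2 * (f (cis \<theta>) * cis \<theta> / (cis \<theta> - z)) - f (cis \<theta>))
      - (cis \<theta> + z) / (cis \<theta> - z) * cnj (f (cis \<theta>))) has_integral
       of_real c * (2 * (2 * complex_of_real pi) - 2 * complex_of_real pi) - (2 * (2 * pi * f z) - 0) - 0) {0..2 * pi}"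
    by (intro has_integral_diff I1 I2 I3)
  have integrand: "of_real c * (2 * (cis \<theta> / (cis \<theta> - z)) - 1) - (2 * (f (cis \<theta>) * cis \<theta> / (cis \<theta> - z)) - f (cis \<theta>))
      - (cis \<theta> + z) / (cis \<theta> - z) * cnj (f (cis \<theta>)) = (cis \<theta> + z) / (cis \<theta> - z) * complex_of_real (c - 2 * Re (f (cis \<theta>)))" for \<theta>
  proof -
    define q where "q = cis \<theta> / (cis \<theta> - z)"
    have e1: "f (cis \<theta>) * cis \<theta> / (cis \<theta> - z) = f (cis \<theta>) * q" by (simp add: q_def)
    have Re2: "complex_of_real (2 * Re (f (cis \<theta>))) = f (cis \<theta>) + cnj (f (cis \<theta>))" by (rule complex_add_cnj[symmetric])
    show ?thesis unfolding of_real_diff Re2 S e1 q_def[symmetric] by algebra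
  qed
  have val: "of_real c * (2 * (2 * complex_of_real pi) - 2 * complex_of_real pi) - (2 * (2 * pi * f z) - 0) - 0 = 2 * pi * c - 4 * pi * f z"
    by (simp add: algebra_simps)
  from total[unfolded integrand val] show ?thesis .
qed

context circle_prob_geometric
begin

text \<open>\<open>d\<close> has no zeros in the closed disk, hence by compactness none in a
  slightly larger one, which is simply connected. The normalisation \<open>L 0 = 0\<close> is
  possible since \<open>d 0 = 1\<close>.\<close>

lemma log_d:
  obtains R L where "1 < R" "L holomorphic_on ball 0 R" "L 0 = 0" "\<And>z. z \<in> ball 0 R \<Longrightarrow> exp (L z) = d z" "R \<le> 1 / b"
proof -
  define U where "U = {z \<in> ball 0 (1 / b). d z \<noteq> 0}"
  have cont: "continuous_on (ball 0 (1 / b)) d" by (rule holomorphic_on_imp_continuous_on[OF d_holomorphic])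
  have "open (ball 0 (1 / b) \<inter> d -` (- {0}))" using cont by (intro continuous_open_preimage) auto
  moreover have "U = ball 0 (1 / b) \<inter> d -` (- {0})" by (auto simp: U_def)
  ultimately have U: "open U" by simp
  have "1 < 1 / b" using b by simp
  have sub: "cball 0 1 \<subseteq> U"
  proof
    fix z :: complex assume "z \<in> cball 0 1"
    then have z: "cmod z \<le> 1" by simp
    then show "z \<in> U" using le_less_trans[OF z \<open>1 < 1 / b\<close>] d_nonzero[OF z] by (simp add: U_def)
  qed
  obtain e where e: "e > 0" "(\<Union>x\<in>cball 0 1. ball x e) \<subseteq> U"
    using compact_subset_open_imp_ball_epsilon_subset[OF compact_cball U sub] by blast
  have sub': "ball 0 (1 + e) \<subseteq> U"
  proof
    fix z :: complex assume z: "z \<in> ball 0 (1 + e)"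
    show "z \<in> U"
    proof (cases "cmod z \<le> 1")
      case True
      then show ?thesis using sub by auto
    next
      case False
      then have z0: "z \<noteq> 0" by auto
      \<comment> \<open>The radial projection to the unit circle is at distance
        \<open>|z| - 1 < e\<close>.\<close>
      define x where "x = z / of_real (cmod z)"
      have "z - x = z * of_real (1 - 1 / cmod z)" using z0 by (simp add: x_def field_simps)
      then have "cmod (z - x) = cmod z * \<bar>1 - 1 / cmod z\<bar>" by (simp only: norm_mult norm_of_real)
      also have "\<bar>1 - 1 / cmod z\<bar> = 1 - 1 / cmod z" using False by (simp add: divide_le_eq)
      also have "cmod z * (1 - 1 / cmod z) = cmod z - 1" using z0 by (simp add: field_simps)
      finally have "dist x z < e" using z by (simp add: dist_norm norm_minus_commute)
      moreover have "x \<in> cball 0 1" using z0 by (simp add: x_def norm_divide)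
      ultimately have "z \<in> (\<Union>x\<in>cball 0 1. ball x e)" by (meson UN_I mem_ball)
      then show ?thesis using e(2) by blast
    qed
  qed
  define R where "R = min (1 + e) (1 / b)"
  have R: "1 < R" using e \<open>1 < 1 / b\<close> by (simp add: R_def)
  have RU: "ball 0 R \<subseteq> U" using sub' by (auto simp: R_def)
  then have hd: "d holomorphic_on ball 0 R" by (intro holomorphic_on_subset[OF d_holomorphic]) (auto simp: U_def)
  have nz: "d z \<noteq> 0" if "z \<in> ball 0 R" for z using that RU by (auto simp: U_def)
  obtain L where L: "L holomorphic_on ball 0 R" "\<And>z. z \<in> ball 0 R \<Longrightarrow> d z = exp (L z)"
    by (rule contractible_imp_holomorphic_log[OF hd convex_imp_contractible[OF convex_ball]]) (use nz in auto)
  have z0: "0 \<in> ball 0 R" using R by simp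
  show thesis
  proof (rule that[of R "\<lambda>z. L z - L 0"])
    show "(\<lambda>z. L z - L 0) holomorphic_on ball 0 R" by (intro holomorphic_intros L)
    show "exp (L z - L 0) = d z" if "z \<in> ball 0 R" for z
      using L(2)[OF that] L(2)[OF z0] by (simp add: exp_diff)
  qed (use R in \<open>auto simp: R_def\<close>)
qed

text \<open>On the circle \<open>ln w\<close> equals \<open>ln N_inf - 2 * Re L\<close> almost
  everywhere with \<open>L\<close> a logarithm of \<open>d\<close>, so Schwarz's formula gives the
  exponent \<open>ln N_inf / 2 - L z\<close>.\<close>

lemma szego_function_eq:
  assumes dec: "circle_decomposition \<mu> w \<mu>s" and z: "cmod z < 1"
  shows "szego_function w z = of_real (sqrt N_inf) / d z"
proof -
  obtain R L where L: "1 < R" "L holomorphic_on ball 0 R" "L 0 = 0" "\<And>z. z \<in> ball 0 R \<Longrightarrow> exp (L z) = d z"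
    by (rule log_d) blast
  have w [measurable]: "w \<in> borel_measurable borel" using dec unfolding circle_decomposition_def by auto
  define g where "g \<theta> = (cis \<theta> + z) / (cis \<theta> - z) * complex_of_real (ln N_inf - 2 * Re (L (cis \<theta>)))" for \<theta>
  have ne: "cis \<theta> - z \<noteq> 0" for \<theta> using z by (metis eq_iff_diff_eq_0 norm_cis less_irrefl)
  have Lc: "continuous_on UNIV (\<lambda>\<theta>. L (cis \<theta>))"
    by (rule continuous_on_compose2[OF holomorphic_on_imp_continuous_on[OF L(2)]]) (use L(1) in \<open>auto intro!: continuous_intros\<close>)
  have gc: "continuous_on UNIV g" unfolding g_def[abs_def] by (intro continuous_intros Lc) (use ne in auto)
  have AEw: "AE \<theta> in lborel. \<theta> \<in> {0..<2 * pi} \<longrightarrow> w \<theta> = N_inf / (cmod (d (cis \<theta>)))\<^sup>2"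
    using weight_eq[OF dec] unfolding AE_angle_measure .
  have lnw: "ln (N_inf / (cmod (d (cis \<theta>)))\<^sup>2) = ln N_inf - 2 * Re (L (cis \<theta>))" for \<theta>
  proof -
    have "d (cis \<theta>) = exp (L (cis \<theta>))" using L(4)[of "cis \<theta>"] L(1) by simp
    then have "cmod (d (cis \<theta>)) = exp (Re (L (cis \<theta>)))" by simp
    then show ?thesis using N_inf_pos by (simp add: ln_div ln_realpow)
  qed
  have "(LINT \<theta>:{0..<2 * pi}|lborel. (cis \<theta> + z) / (cis \<theta> - z) * complex_of_real (ln (w \<theta>))) = (LINT \<theta>:{0..2 * pi}|lborel. g \<theta>)"
    unfolding set_lebesgue_integral_def
  proof (rule integral_cong_AE)
    show "(\<lambda>\<theta>. indicat_real {0..<2 * pi} \<theta> *\<^sub>R ((cis \<theta> + z) / (cis \<theta> - z) * complex_of_real (ln (w \<theta>)))) \<in> borel_measurable lborel"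
      by measurable
    have "g \<in> borel_measurable borel" using gc by (rule borel_measurable_continuous_onI)
    then show "(\<lambda>\<theta>. indicat_real {0..2 * pi} \<theta> *\<^sub>R g \<theta>) \<in> borel_measurable lborel" by measurable
    have "AE \<theta> in lborel. \<theta> \<noteq> 2 * pi" by (rule AE_lborel_singleton)
    with AEw show "AE \<theta> in lborel. indicat_real {0..<2 * pi} \<theta> *\<^sub>R ((cis \<theta> + z) / (cis \<theta> - z) * complex_of_real (ln (w \<theta>))) = indicat_real {0..2 * pi} \<theta> *\<^sub>R g \<theta>"
      by eventually_elim (auto simp: indicator_def g_def lnw)
  qed
  also have "\<dots> = integral {0..2 * pi} g"
    using gc by (intro set_borel_integral_eq_integral borel_integrable_atLeastAtMost') (auto elim: continuous_on_subset)
  also have "\<dots> = 2 * pi * ln N_inf - 4 * pi * L z"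
    unfolding g_def by (rule integral_unique[OF schwarz_formula[OF L(2,1,3) z]])
  finally have "szego_function w z = exp (complex_of_real (1 / (4 * pi)) * (2 * pi * ln N_inf - 4 * pi * L z))"
    by (simp add: szego_function_def)
  also have "complex_of_real (1 / (4 * pi)) * (2 * pi * ln N_inf - 4 * pi * L z) = of_real (ln N_inf / 2) - L z"
    by (simp add: field_simps)
  also have "exp (of_real (ln N_inf / 2) - L z) = exp (complex_of_real (ln N_inf / 2)) / exp (L z)" by (rule exp_diff)
  also have "exp (complex_of_real (ln N_inf / 2)) = of_real (sqrt N_inf)"
  proof -
    have "exp (ln N_inf / 2) = sqrt N_inf" using N_inf_pos by (simp add: ln_sqrt[symmetric])
    then show ?thesis by (metis exp_of_real)
  qed
  also have "exp (L z) = d z" using L(1,4) z by simp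
  finally show ?thesis .
qed

text \<open>The multiple of \<open>d\<close> witnesses that a continuation exists, so the choice in
  the definition is meaningful, and uniqueness identifies it.\<close>

lemma szego_inv_eq:
  assumes dec: "circle_decomposition \<mu> w \<mu>s" and z: "cmod z < 1 / b"
  shows "szego_inv w b z = d z / of_real (sqrt N_inf)"
proof -
  have c: "szego_inv_continuation w b (\<lambda>z. d z / of_real (sqrt N_inf))"
    unfolding szego_inv_continuation_def using N_inf_pos
    by (auto intro!: holomorphic_intros d_holomorphic simp: szego_function_eq[OF dec])
  then have "szego_inv_continuation w b (szego_inv w b)" unfolding szego_inv_def by (rule someI[of "szego_inv_continuation w b"])
  then show ?thesis using szego_inv_continuation_unique[OF b _ c, of "szego_inv w b" z] z by simp
qed

lemma szego_inv_reflected_eq: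
  assumes dec: "circle_decomposition \<mu> w \<mu>s" and z: "b < cmod z"
  shows "szego_inv_reflected w b z = of_real (1 / sqrt N_inf) * F z"
proof -
  have "cmod (1 / cnj z) < 1 / b" using z b by (simp add: norm_divide frac_less2)
  then show ?thesis unfolding szego_inv_reflected_def F_def szego_inv_eq[OF dec \<open>cmod (1 / cnj z) < 1 / b\<close>] by simp
qed

end

section \<open>Enumeration of the zeros by their arguments\<close>

lemma order_eq_1:
  fixes p :: "complex poly"
  assumes "poly p x = 0" "poly (pderiv p) x \<noteq> 0"
  shows "order x p = 1"
proof -
  have "pderiv p \<noteq> 0" using assms by auto
  then have "p \<noteq> 0" by auto
  then have "order x p \<noteq> 0" using assms(1) by (simp add: order_root)
  then have "order x p = Suc (order x (pderiv p))" using \<open>pderiv p \<noteq> 0\<close> assms(1) by (intro order_pderiv) auto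
  then show ?thesis using assms(2) by (simp add: order_0I)
qed

text \<open>For 0 \<le> t \<le> 1 / 2 use \<open>exp t \<le> 1 / (1 - t) \<le> 1 + 2 * t\<close>.
  This turns estimates in the logarithmic coordinate into estimates for moduli and their
  ratios.\<close>

lemma abs_exp_minus_one_le:
  fixes t :: real
  assumes "\<bar>t\<bar> \<le> 1 / 2"
  shows "\<bar>exp t - 1\<bar> \<le> 2 * \<bar>t\<bar>"
proof (cases "0 \<le> t")
  case True
  have "exp t * (1 - t) \<le> exp t * exp (- t)" using exp_ge_add_one_self[of "- t"] by (intro mult_left_mono) auto
  then have "exp t * (1 - t) \<le> 1" by (simp add: exp_minus)
  moreover have "1 \<le> (1 + 2 * t) * (1 - t)"
  proof -
    have "t * (1 - 2 * t) \<ge> 0" using True assms by (intro mult_nonneg_nonneg) auto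
    then show ?thesis by (simp add: algebra_simps)
  qed
  ultimately have "exp t * (1 - t) \<le> (1 + 2 * t) * (1 - t)" by linarith
  then have "exp t \<le> 1 + 2 * t" using assms True by (simp add: mult_le_cancel_right)
  moreover have "1 \<le> exp t" using True by simp
  ultimately show ?thesis using True by simp
next
  case False
  then have "exp t \<le> 1" by simp
  moreover have "1 + t \<le> exp t" by (rule exp_ge_add_one_self)
  ultimately show ?thesis using False by linarith
qed

lemma abs_SUP_le:
  fixes f :: "'a \<Rightarrow> real"
  assumes "finite I" "I \<noteq> {}" "\<And>i. i \<in> I \<Longrightarrow> 0 \<le> f i" "\<And>i. i \<in> I \<Longrightarrow> f i \<le> B"
  shows "\<bar>SUP i\<in>I. f i\<bar> \<le> B"
proof -
  obtain i where i: "i \<in> I" using assms by auto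
  have "f i \<le> (SUP i\<in>I. f i)" using assms i by (intro cSUP_upper) (auto intro: bdd_above_finite)
  moreover have "(SUP i\<in>I. f i) \<le> B" using assms by (intro cSUP_least)
  ultimately show ?thesis using assms(3)[OF i] by linarith
qed

section \<open>Ordering the zeros in the ring\<close>

context geometric_strip
begin

text \<open>For large n these lie in a genuine ring, since \<open>no_zeros_inside\<close> excludes
  the smaller moduli.\<close>

definition ring_zeros :: "nat \<Rightarrow> complex set" where
  "ring_zeros n = {z. poly (\<Phi> n) z = 0 \<and> cmod z < b * exp (\<eta> / 4)}"

lemma finite_ring_zeros: "finite (ring_zeros n)"
  unfolding ring_zeros_def using poly_roots_finite[OF szego_monic_nz] by (rule finite_subset[rotated]) auto

lemma log_zeros_deriv:
  fixes u :: complex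
  shows "deriv (\<lambda>u::complex. (b * exp u - b) * poly (\<Phi> n) (b * exp u) / b ^ n) u =
     (b * exp u * poly (\<Phi> n) (b * exp u) + (b * exp u - b) * (poly (pderiv (\<Phi> n)) (b * exp u) * (b * exp u))) / b ^ n"
proof (rule DERIV_imp_deriv)
  have "((\<lambda>u::complex. of_real b * exp u) has_field_derivative of_real b * exp u) (at u)"
    by (auto intro!: derivative_eq_intros)
  then have p: "((\<lambda>u. poly (\<Phi> n) (of_real b * exp u)) has_field_derivative poly (pderiv (\<Phi> n)) (of_real b * exp u) * (of_real b * exp u)) (at u)"
    by (rule DERIV_chain2[OF poly_DERIV])
  show "((\<lambda>u::complex. (b * exp u - b) * poly (\<Phi> n) (b * exp u) / b ^ n) has_field_derivative
     (b * exp u * poly (\<Phi> n) (b * exp u) + (b * exp u - b) * (poly (pderiv (\<Phi> n)) (b * exp u) * (b * exp u))) / b ^ n) (at u)"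
    using b by (auto intro!: derivative_eq_intros p)
qed

text \<open>Moduli are measured by \<open>ln (|z| / b)\<close>, the real part of the logarithmic
  coordinate. The bounds \<kappa> and \<epsilon> will be \<open>K * ln n / n\<close> and
  \<open>K / ln n\<close>. The clause on moduli stops at m - 1 because the end points belong to the
  spurious zero \<open>b\<close>.\<close>

definition angular_enumeration :: "nat \<Rightarrow> nat \<Rightarrow> real \<Rightarrow> real \<Rightarrow> (nat \<Rightarrow> complex) \<Rightarrow> (nat \<Rightarrow> real) \<Rightarrow> bool" where
  "angular_enumeration n m \<kappa> \<epsilon> z \<theta> \<longleftrightarrow>
     bij_betw z {1..m} (ring_zeros n) \<and> (\<forall>j\<in>{1..m}. order (z j) (\<Phi> n) = 1) \<and>
     (\<forall>j\<in>{1..m}. z j = complex_of_real (cmod (z j)) * cis (\<theta> j)) \<and> (\<forall>j\<in>{1..m}. 0 < cmod (z j)) \<and>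
     \<theta> 0 = 0 \<and> \<theta> (m + 1) = 2 * pi \<and> (\<forall>j\<in>{0..m}. \<theta> j < \<theta> (j + 1)) \<and>
     (\<forall>j\<in>{1..m}. \<bar>ln (cmod (z j) / b)\<bar> \<le> \<kappa>) \<and>
     (\<forall>j\<in>{0..m}. \<bar>n * (\<theta> (j + 1) - \<theta> j) - 2 * pi\<bar> \<le> \<epsilon>) \<and>
     (\<forall>j\<in>{1..m-1}. n * \<bar>ln (cmod (z (j + 1)) / b) - ln (cmod (z j) / b)\<bar> \<le> \<epsilon>)"

text \<open>Since consecutive solutions in the logarithmic coordinate are roughly \<open>2 * pi * \<i> / n\<close> apart and no
  two of them are closer than that in imaginary part, sorting by imaginary part enumerates them
  along the chain of successors.\<close>

lemma ring_zeros_enumeration: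
  fixes n :: nat and \<epsilon> \<kappa> :: real
  assumes n: "0 < n" and \<epsilon>: "0 \<le> \<epsilon>" "\<epsilon> \<le> 1"
    and lat: "\<And>u. \<lbrakk>u \<in> log_zeros n; -5 \<le> Im u; Im u \<le> 15\<rbrakk> \<Longrightarrow>
     \<bar>Re u\<bar> \<le> \<kappa> \<and>
     deriv (\<lambda>u::complex. (b * exp u - b) * poly (\<Phi> n) (b * exp u) / b ^ n) u \<noteq> 0 \<and>
     (\<exists>v\<in>log_zeros n. cmod (of_nat n * (v - u) - 2 * pi * \<i>) \<le> \<epsilon>) \<and>
     (\<forall>v\<in>log_zeros n. -5 \<le> Im v \<longrightarrow> Im v \<le> 15 \<longrightarrow> v \<noteq> u \<longrightarrow> 2 * pi - \<epsilon> \<le> n * \<bar>Im u - Im v\<bar>)"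
    and inside: "\<And>z. cmod z \<le> b * exp (- \<eta> / 4) \<Longrightarrow> poly (\<Phi> n) z \<noteq> 0"
  defines "m \<equiv> card (ring_zeros n)"
  shows "\<exists>z \<theta>. angular_enumeration n m \<kappa> \<epsilon> z \<theta>"
proof -
  define \<zeta> where "\<zeta> u = of_real b * exp u" for u :: complex
  have pi3: "3 < pi" using pi_gt3 .
  have sep: "2 * pi - \<epsilon> \<le> n * \<bar>Im u - Im v\<bar>"
    if "u \<in> log_zeros n" "v \<in> log_zeros n" "u \<noteq> v" "-5 \<le> Im u" "Im u \<le> 15" "-5 \<le> Im v" "Im v \<le> 15" for u v
    using lat[OF that(1,4,5)] that by blast
  have Im_eq: "u = v" if "u \<in> log_zeros n" "v \<in> log_zeros n" "Im u = Im v" "-5 \<le> Im u" "Im u \<le> 15" for u v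
    using sep[of u v] that \<epsilon> pi3 by force
  have zero: "0 \<in> log_zeros n" using \<eta> by (simp add: log_zeros_def)
  have turn: "2 * pi * \<i> \<in> log_zeros n" using \<eta> by (simp add: log_zeros_def)
  have pi35: "pi < 35 / 10" using pi_approx by simp
  have pi15: "2 * pi \<le> 15" using pi_less_4 by simp
  \<comment> \<open>The solution u = 0 is simple, and its derivative is a nonzero multiple of this
    value; so \<open>b\<close> is only the spurious zero.\<close>
  have \<Phi>b: "poly (\<Phi> n) b \<noteq> 0"
    using lat[OF zero] unfolding log_zeros_deriv by auto
  \<comment> \<open>One full turn without the spurious solution at the origin.\<close>
  define U where "U = {u \<in> log_zeros n. 0 \<le> Im u \<and> Im u < 2 * pi} - {0}"
  have UZ: "u \<in> log_zeros n" "0 < Im u" "Im u < 2 * pi" "-5 \<le> Im u" "Im u \<le> 15" if "u \<in> U" for u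
  proof -
    show 1: "u \<in> log_zeros n" "Im u < 2 * pi" using that by (auto simp: U_def)
    have "0 \<le> Im u" "u \<noteq> 0" using that by (auto simp: U_def)
    then show "0 < Im u" "-5 \<le> Im u" "Im u \<le> 15" using Im_eq[OF 1(1) zero] 1(2) pi15 by fastforce+
  qed
  have \<zeta>U: "\<zeta> u \<in> ring_zeros n" if "u \<in> U" for u
  proof -
    have "exp u \<noteq> 1"
    proof
      assume "exp u = 1"
      then obtain k :: int where k: "Im u = of_int (2 * k) * pi" by (auto simp: exp_eq_1)
      have "0 < of_int (2 * k) * pi" "of_int (2 * k) * pi < 2 * pi" using UZ(2,3)[OF that] k by auto
      then have "0 < k" "k < 1" by (auto simp: zero_less_mult_iff)
      then show False by simp
    qed
    then have "poly (\<Phi> n) (\<zeta> u) = 0" using UZ(1)[OF that] b unfolding log_zeros_def \<zeta>_def by auto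
    moreover have "cmod (\<zeta> u) < b * exp (\<eta> / 4)" using UZ(1)[OF that] b unfolding log_zeros_def \<zeta>_def by (auto simp: norm_mult)
    ultimately show ?thesis by (simp add: ring_zeros_def)
  qed
  have inj: "inj_on \<zeta> U"
  proof (rule inj_onI)
    fix u v assume uv: "u \<in> U" "v \<in> U" "\<zeta> u = \<zeta> v"
    then have "exp u = exp v" using b by (simp add: \<zeta>_def)
    moreover have "\<bar>Im u - Im v\<bar> < 2 * pi" using UZ(2,3)[OF uv(1)] UZ(2,3)[OF uv(2)] by auto
    ultimately show "u = v" by (rule exp_complex_eqI[rotated])
  qed
  have img: "\<zeta> ` U = ring_zeros n"
  proof
    show "\<zeta> ` U \<subseteq> ring_zeros n" using \<zeta>U by blast
    show "ring_zeros n \<subseteq> \<zeta> ` U"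
    proof
      fix z assume z: "z \<in> ring_zeros n"
      have zlow: "b * exp (- \<eta> / 4) < cmod z" using inside[of z] z by (fastforce simp: ring_zeros_def)
      then have z0: "0 < cmod z" using b by (meson exp_gt_zero less_trans mult_pos_pos)
      define u where "u = Complex (ln (cmod z / b)) (Arg2pi z)"
      have ez: "\<zeta> u = z"
      proof -
        have "exp u = of_real (exp (Re u)) * cis (Im u)" by (rule exp_eq_polar)
        also have "\<dots> = of_real (cmod z / b) * cis (Arg2pi z)" using z0 b by (simp add: u_def)
        finally have "\<zeta> u = of_real (cmod z) * cis (Arg2pi z)" using b by (simp add: \<zeta>_def)
        then show ?thesis using Arg2pi_eq[of z] by (simp add: cis_conv_exp)
      qed
      have "cmod z < b * exp (\<eta> / 4)" using z by (simp add: ring_zeros_def)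
      then have "exp (- (\<eta> / 4)) < cmod z / b" "cmod z / b < exp (\<eta> / 4)" using zlow b by (auto simp: field_simps)
      then have "- (\<eta> / 4) < ln (cmod z / b)" "ln (cmod z / b) < \<eta> / 4"
        using z0 b by (metis divide_pos_pos exp_gt_zero ln_exp ln_less_cancel_iff)+
      then have "u \<in> log_zeros n" using ez z unfolding log_zeros_def \<zeta>_def ring_zeros_def by (auto simp: u_def)
      moreover have "u \<noteq> 0"
      proof
        assume "u = 0"
        then have "z = b" using ez by (simp add: \<zeta>_def)
        then show False using \<Phi>b z by (simp add: ring_zeros_def)
      qed
      ultimately have "u \<in> U" using Arg2pi[of z] by (simp add: U_def u_def)
      then show "z \<in> \<zeta> ` U" using ez by force
    qed
  qed
  have finU: "finite U" using finite_ring_zeros[of n] inj unfolding img[symmetric] by (rule finite_imageD)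
  have injIm: "inj_on Im U" using Im_eq UZ by (intro inj_onI) blast
  define A where "A = Im ` U"
  have finA: "finite A" using finU by (simp add: A_def)
  have cardA: "card A = m" unfolding A_def m_def img[symmetric] card_image[OF injIm] card_image[OF inj] ..
  define xs where "xs = sorted_list_of_set A"
  have xs: "length xs = m" "set xs = A" "sorted_wrt (<) xs"
    using finA cardA by (auto simp: xs_def)
  define \<theta> where "\<theta> j = (if j = 0 then 0 else if j \<le> m then xs ! (j - 1) else 2 * pi)" for j
  \<comment> \<open>Both ends of the chain, 0 and \<open>2 * pi * \<i>\<close>, represent the
    spurious zero \<open>b\<close>.\<close>
  define u where "u j = (if j = 0 then 0 else if j \<le> m then inv_into U Im (\<theta> j) else 2 * pi * \<i>)" for j :: nat
  have \<theta>A: "\<theta> j \<in> A" if "j \<in> {1..m}" for j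
    using that xs by (auto simp: \<theta>_def)
  have uU: "u j \<in> U" "Im (u j) = \<theta> j" if j: "j \<in> {1..m}" for j
    using \<theta>A[OF j] j unfolding A_def u_def by (auto intro: inv_into_into f_inv_into_f)
  have uZ: "u j \<in> log_zeros n" "Im (u j) = \<theta> j" "0 \<le> \<theta> j" "\<theta> j \<le> 2 * pi" if jm: "j \<le> m + 1" for j
  proof -
    consider "j = 0" | "j \<in> {1..m}" | "j = m + 1" using jm by force
    then have "u j \<in> log_zeros n \<and> Im (u j) = \<theta> j \<and> 0 \<le> \<theta> j \<and> \<theta> j \<le> 2 * pi"
    proof cases
      case 2
      then show ?thesis using uU[OF 2] UZ[OF uU(1)[OF 2]] by auto
    qed (use zero turn in \<open>auto simp: u_def \<theta>_def\<close>)
    then show "u j \<in> log_zeros n" "Im (u j) = \<theta> j" "0 \<le> \<theta> j" "\<theta> j \<le> 2 * pi" by auto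
  qed
  have mono: "\<theta> i < \<theta> j" if "i < j" "j \<le> m + 1" for i j
  proof -
    have in01: "0 < \<theta> k \<and> \<theta> k < 2 * pi" if "k \<in> {1..m}" for k
      using uU[OF that] UZ[OF uU(1)[OF that]] by auto
    consider "i = 0" "j \<in> {1..m}" | "i = 0" "j = m + 1" | "i \<in> {1..m}" "j \<in> {1..m}" | "i \<in> {1..m}" "j = m + 1"
      using \<open>i < j\<close> \<open>j \<le> m + 1\<close> by force
    then show ?thesis
    proof cases
      case 1
      then show ?thesis using in01[of j] by (simp add: \<theta>_def)
    next
      case 2
      then show ?thesis by (simp add: \<theta>_def)
    next
      case 3
      then have "xs ! (i - 1) < xs ! (j - 1)" using xs(1) \<open>i < j\<close> by (intro sorted_wrt_nth_less[OF xs(3)]) auto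
      then show ?thesis using 3 by (simp add: \<theta>_def)
    next
      case 4
      then show ?thesis using in01[of i] by (simp add: \<theta>_def)
    qed
  qed
  have all: "\<exists>k\<le>m+1. v = u k" if v: "v \<in> log_zeros n" "0 \<le> Im v" "Im v < 2 * pi" for v
  proof (cases "v = 0")
    case True
    then show ?thesis by (intro exI[of _ 0]) (simp add: u_def)
  next
    case False
    then have "v \<in> U" using v by (simp add: U_def)
    then have "Im v \<in> set xs" using xs by (simp add: A_def)
    then obtain i where i: "i < m" "xs ! i = Im v" using xs(1) by (metis in_set_conv_nth)
    then have "i + 1 \<in> {1..m}" "\<theta> (i + 1) = Im v" by (auto simp: \<theta>_def)
    then have "v = u (i + 1)" using uU[of "i + 1"] \<open>v \<in> U\<close> injIm by (metis inj_onD)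
    then show ?thesis using i by (intro exI[of _ "i + 1"]) auto
  qed
  have nxt: "cmod (of_nat n * (u (j + 1) - u j) - 2 * pi * \<i>) \<le> \<epsilon>" if j: "j \<le> m" for j
  proof -
    have jm: "j \<le> m + 1" "j + 1 \<le> m + 1" using j by auto
    note uj = uZ[OF jm(1)] and uj1 = uZ[OF jm(2)]
    have r0: "-5 \<le> Im (u j)" "Im (u j) \<le> 15" "-5 \<le> Im (u (j + 1))" "Im (u (j + 1)) \<le> 15" using uj uj1 pi15 by auto
    obtain v where v: "v \<in> log_zeros n" "cmod (of_nat n * (v - u j) - 2 * pi * \<i>) \<le> \<epsilon>"
      using lat[OF uj(1) r0(1,2)] by blast
    have "\<bar>Im (of_nat n * (v - u j) - 2 * pi * \<i>)\<bar> \<le> \<epsilon>" using abs_Im_le_cmod v(2) by (rule order_trans)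
    then have Imv: "\<bar>n * (Im v - \<theta> j) - 2 * pi\<bar> \<le> \<epsilon>" using uj(2) by simp
    have "0 < n * (Im v - \<theta> j)" using Imv \<epsilon> pi3 by linarith
    then have gt: "\<theta> j < Im v" using n by (simp add: zero_less_mult_iff)
    have "Im v - \<theta> j \<le> n * (Im v - \<theta> j)" using gt n by (simp add: mult_le_cancel_right1)
    \<comment> \<open>The successor has height at most 4 pi + 1 < 15, which is where the bound 15
      comes from.\<close>
    then have vr: "-5 \<le> Im v" "Im v \<le> 15" using Imv gt uj(3,4) \<epsilon> pi35 by linarith+
    \<comment> \<open>Otherwise \<open>v\<close> lies beyond \<open>u (j + 1)\<close>, and two
      separations add up to at least 4 pi - 2 \<epsilon> > 2 pi + \<epsilon>, or strictly between
      two consecutive elements of the sorted list.\<close>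
    have "v = u (j + 1)"
    proof (rule ccontr)
      assume ne: "v \<noteq> u (j + 1)"
      have lt: "\<theta> j < \<theta> (j + 1)" by (rule mono) (use j in auto)
      have "u (j + 1) \<noteq> u j" using lt uj uj1 by auto
      then have s1: "2 * pi - \<epsilon> \<le> n * (\<theta> (j + 1) - \<theta> j)"
        using sep[OF uj1(1) uj(1)] r0 uj(2) uj1(2) lt by auto
      have s2: "2 * pi - \<epsilon> \<le> n * \<bar>Im v - \<theta> (j + 1)\<bar>"
        using sep[OF v(1) uj1(1) ne vr r0(3,4)] uj1(2) by simp
      show False
      proof (cases "\<theta> (j + 1) \<le> Im v")
        case True
        then have "n * (Im v - \<theta> j) = n * \<bar>Im v - \<theta> (j + 1)\<bar> + n * (\<theta> (j + 1) - \<theta> j)" by (simp add: algebra_simps)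
        then show False using s1 s2 Imv \<epsilon> pi3 by linarith
      next
        case False
        then obtain k where k: "k \<le> m + 1" "v = u k" using all[OF v(1)] gt uj uj1 by force
        then have "\<theta> j < \<theta> k" "\<theta> k < \<theta> (j + 1)" using gt False uZ(2)[OF k(1)] by auto
        moreover have "k \<le> j \<or> j + 1 \<le> k" by auto
        ultimately show False using mono[of k j] mono[of "j + 1" k] k(1) jm by (metis less_asym le_neq_implies_less less_irrefl)
      qed
    qed
    then show ?thesis using v(2) by simp
  qed
  define z where "z j = \<zeta> (u j)" for j
  have bij: "bij_betw z {1..m} (ring_zeros n)"
  proof -
    have "bij_betw u {1..m} U"
    proof (rule bij_betwI')
      show "u i = u j \<longleftrightarrow> i = j" if "i \<in> {1..m}" "j \<in> {1..m}" for i j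
        using uU(2)[OF that(1)] uU(2)[OF that(2)] mono[of i j] mono[of j i] that by (metis atLeastAtMost_iff le_SucI Suc_eq_plus1 less_irrefl linorder_neqE_nat)
      show "u i \<in> U" if "i \<in> {1..m}" for i using uU(1)[OF that] .
      show "\<exists>i\<in>{1..m}. v = u i" if vU: "v \<in> U" for v
      proof -
        obtain k where k: "k \<le> m + 1" "v = u k" using all[OF UZ(1)[OF vU]] UZ(2,3)[OF vU] by force
        have "k \<noteq> 0" "k \<noteq> m + 1" using UZ(2,3)[OF vU] k(2) uZ(2)[OF k(1)] by (auto simp: \<theta>_def split: if_splits)
        then show ?thesis using k by (intro bexI[of _ k]) auto
      qed
    qed
    moreover have "bij_betw \<zeta> U (ring_zeros n)" using inj img by (simp add: bij_betw_def)
    ultimately have "bij_betw (\<zeta> \<circ> u) {1..m} (ring_zeros n)" by (rule bij_betw_trans)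
    then show ?thesis by (simp add: z_def[abs_def] o_def)
  qed
  have cz: "cmod (z j) = b * exp (Re (u j))" for j using b by (simp add: z_def \<zeta>_def norm_mult)
  have lnz: "ln (cmod (z j) / b) = Re (u j)" for j using b by (simp add: cz)
  show ?thesis unfolding angular_enumeration_def
  proof (intro exI[of _ z] exI[of _ \<theta>] conjI ballI bij)
    show "\<theta> 0 = 0" "\<theta> (m + 1) = 2 * pi" by (auto simp: \<theta>_def)
    show "\<theta> j < \<theta> (j + 1)" if "j \<in> {0..m}" for j using that by (intro mono) auto
    fix j assume j: "j \<in> {1..m}"
    have uj: "u j \<in> log_zeros n" "-5 \<le> Im (u j)" "Im (u j) \<le> 15" using UZ[OF uU(1)[OF j]] by auto
    show "0 < cmod (z j)" using b by (simp add: cz)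
    show "z j = complex_of_real (cmod (z j)) * cis (\<theta> j)"
      unfolding cz uU(2)[OF j, symmetric] by (simp add: z_def \<zeta>_def exp_eq_polar[of "u j"] exp_of_real)
    show "\<bar>ln (cmod (z j) / b)\<bar> \<le> \<kappa>" using lat[OF uj] by (simp add: lnz)
    show "order (z j) (\<Phi> n) = 1"
    proof (rule order_eq_1)
      show "poly (\<Phi> n) (z j) = 0" using \<zeta>U[OF uU(1)[OF j]] by (simp add: z_def ring_zeros_def)
      then show "poly (pderiv (\<Phi> n)) (z j) \<noteq> 0"
        using lat[OF uj] unfolding log_zeros_deriv z_def \<zeta>_def by auto
    qed
  next
    fix j assume "j \<in> {0..m}"
    then have j: "j \<le> m" by simp
    have "\<bar>Im (of_nat n * (u (j + 1) - u j) - 2 * pi * \<i>)\<bar> \<le> \<epsilon>" using abs_Im_le_cmod nxt[OF j] by (rule order_trans)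
    then show "\<bar>n * (\<theta> (j + 1) - \<theta> j) - 2 * pi\<bar> \<le> \<epsilon>" using uZ(2)[of j] uZ(2)[of "j + 1"] j by simp
  next
    fix j assume "j \<in> {1..m-1}"
    then have j: "j \<le> m" by auto
    have "\<bar>Re (of_nat n * (u (j + 1) - u j) - 2 * pi * \<i>)\<bar> \<le> \<epsilon>" using abs_Re_le_cmod nxt[OF j] by (rule order_trans)
    then show "n * \<bar>ln (cmod (z (j + 1)) / b) - ln (cmod (z j) / b)\<bar> \<le> \<epsilon>" by (simp add: lnz abs_mult)
  qed
qed

lemma ring_zeros_eventually:
  obtains K z \<theta> where "K > 0" "\<forall>\<^sub>F n in sequentially. angular_enumeration n (card (ring_zeros n)) (K * ln n / n) (K / ln n) (z n) (\<theta> n)"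
proof -
  obtain K where K: "K > 0" "\<forall>\<^sub>F n in sequentially. \<forall>u\<in>log_zeros n. -5 \<le> Im u \<longrightarrow> Im u \<le> 15 \<longrightarrow>
     \<bar>Re u\<bar> \<le> K * ln n / n \<and>
     deriv (\<lambda>u::complex. (b * exp u - b) * poly (\<Phi> n) (b * exp u) / b ^ n) u \<noteq> 0 \<and>
     (\<exists>v\<in>log_zeros n. cmod (of_nat n * (v - u) - 2 * pi * \<i>) \<le> K / ln n) \<and>
     (\<forall>v\<in>log_zeros n. -5 \<le> Im v \<longrightarrow> Im v \<le> 15 \<longrightarrow> v \<noteq> u \<longrightarrow> 2 * pi - K / ln n \<le> n * \<bar>Im u - Im v\<bar>)"
    by (rule log_zeros_lattice)
  have "\<forall>\<^sub>F n in sequentially. K / ln (real n) \<le> 1" "\<forall>\<^sub>F n in sequentially. 1 < ln (real n)"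
    using K(1) by real_asymp+
  then have ev: "\<forall>\<^sub>F n in sequentially. \<exists>z \<theta>. angular_enumeration n (card (ring_zeros n)) (K * ln n / n) (K / ln n) z \<theta>"
    using K(2) no_zeros_inside eventually_gt_at_top[of 0]
  proof eventually_elim
    case (elim n)
    have "0 \<le> K / ln (real n)" using K(1) elim(2) by simp
    from ring_zeros_enumeration[OF elim(5) this elim(1), of "K * ln n / n"] elim(3,4)
    show ?case by blast
  qed
  define z\<theta> where "z\<theta> n = (SOME p. angular_enumeration n (card (ring_zeros n)) (K * ln n / n) (K / ln n) (fst p) (snd p))" for n
  have "\<forall>\<^sub>F n in sequentially. angular_enumeration n (card (ring_zeros n)) (K * ln n / n) (K / ln n) (fst (z\<theta> n)) (snd (z\<theta> n))"
    using ev
  proof eventually_elim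
    case (elim n)
    then obtain z \<theta> where "angular_enumeration n (card (ring_zeros n)) (K * ln n / n) (K / ln n) z \<theta>" by blast
    then have "angular_enumeration n (card (ring_zeros n)) (K * ln n / n) (K / ln n) (fst (z, \<theta>)) (snd (z, \<theta>))" by simp
    then show ?case unfolding z\<theta>_def by (rule someI)
  qed
  then show thesis by (rule that[OF K(1)])
qed

text \<open>Simplicity of the zeros in the ring is what allows a multiset of roots to be replaced by
  a set.\<close>

lemma filter_outside_eq:
  assumes out: "\<And>p z. \<lbrakk>p \<in> NT; z \<in> ball p \<delta>\<rbrakk> \<Longrightarrow> b * exp (\<eta> / 4) < cmod z"
    and near: "\<And>z. \<lbrakk>poly (\<Phi> n) z = 0; z \<notin> (\<Union>p\<in>NT. ball p \<delta>)\<rbrakk> \<Longrightarrow> cmod z < b * exp (\<eta> / 4)"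
    and simple: "\<And>z. z \<in> ring_zeros n \<Longrightarrow> order z (\<Phi> n) = 1"
  shows "{# x \<in># proots (\<Phi> n). x \<notin> (\<Union>p\<in>NT. ball p \<delta>) #} = mset_set (ring_zeros n)"
proof (rule multiset_eqI)
  fix x
  show "count {# x \<in># proots (\<Phi> n). x \<notin> (\<Union>p\<in>NT. ball p \<delta>) #} x = count (mset_set (ring_zeros n)) x"
  proof (cases "x \<in> ring_zeros n")
    case True
    then have "x \<notin> (\<Union>p\<in>NT. ball p \<delta>)" using out by (force simp: ring_zeros_def)
    then show ?thesis using True simple[OF True] finite_ring_zeros by simp
  next
    case False
    then have "poly (\<Phi> n) x \<noteq> 0 \<or> x \<in> (\<Union>p\<in>NT. ball p \<delta>)" using near[of x] by (auto simp: ring_zeros_def)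
    then show ?thesis using False by (auto simp: order_0I)
  qed
qed

text \<open>The discs are disjoint, so the roots split into those in the discs and those in the
  ring; the total number is the degree n.\<close>

lemma card_ring_zeros:
  assumes \<delta>: "\<delta> < \<delta>0"
    and sep: "\<And>p q. \<lbrakk>p \<in> NT; q \<in> NT; p \<noteq> q\<rbrakk> \<Longrightarrow> 2 * \<delta>0 \<le> dist p q"
    and filt: "{# x \<in># proots (\<Phi> n). x \<notin> (\<Union>p\<in>NT. ball p \<delta>) #} = mset_set (ring_zeros n)"
  shows "card (ring_zeros n) + (\<Sum>p\<in>NT. size {# x \<in># proots (\<Phi> n). x \<in> ball p \<delta> #}) = n"
proof -
  have "(\<Sum>p\<in>NT. size {# x \<in># proots (\<Phi> n). x \<in> ball p \<delta> #})
      = (\<Sum>x\<in>(\<Union>p\<in>NT. {x \<in> ball p \<delta>. poly (\<Phi> n) x = 0}). order x (\<Phi> n))"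
    unfolding size_filter_proots[OF szego_monic_nz]
  proof (rule sum.UNION_disjoint[symmetric, OF finite_NT])
    show "\<forall>p\<in>NT. finite {x \<in> ball p \<delta>. poly (\<Phi> n) x = 0}"
      using poly_roots_finite[OF szego_monic_nz] by (auto elim: finite_subset[rotated])
    show "\<forall>p\<in>NT. \<forall>q\<in>NT. p \<noteq> q \<longrightarrow> {x \<in> ball p \<delta>. poly (\<Phi> n) x = 0} \<inter> {x \<in> ball q \<delta>. poly (\<Phi> n) x = 0} = {}"
    proof (intro ballI impI equals0I)
      fix p q x assume "p \<in> NT" "q \<in> NT" "p \<noteq> q" "x \<in> {x \<in> ball p \<delta>. poly (\<Phi> n) x = 0} \<inter> {x \<in> ball q \<delta>. poly (\<Phi> n) x = 0}"
      then show False using sep[of p q] dist_triangle2[of p q x] \<delta> by auto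
    qed
  qed
  also have "\<dots> = size {# x \<in># proots (\<Phi> n). x \<in> (\<Union>p\<in>NT. ball p \<delta>) #}"
    unfolding size_filter_proots[OF szego_monic_nz] by (rule sum.cong) auto
  finally have "(\<Sum>p\<in>NT. size {# x \<in># proots (\<Phi> n). x \<in> ball p \<delta> #}) = size {# x \<in># proots (\<Phi> n). x \<in> (\<Union>p\<in>NT. ball p \<delta>) #}" .
  moreover have "size (proots (\<Phi> n)) = size {# x \<in># proots (\<Phi> n). x \<in> (\<Union>p\<in>NT. ball p \<delta>) #} + size {# x \<in># proots (\<Phi> n). x \<notin> (\<Union>p\<in>NT. ball p \<delta>) #}"
    by (metis multiset_partition size_union)
  moreover have "size {# x \<in># proots (\<Phi> n). x \<notin> (\<Union>p\<in>NT. ball p \<delta>) #} = card (ring_zeros n)"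
    unfolding filt by simp
  ultimately show ?thesis by (simp add: size_proots_complex degree_szego_monic)
qed

end

text \<open>The finitely many exceptional terms are absorbed by adding all their ratios
  \<open>|f k| / q ^ k\<close> to the constant.\<close>

lemma geometric_bound_everywhere:
  assumes "f \<in> O(\<lambda>n. complex_of_real (q ^ n))" "0 < q"
  shows "\<exists>K. \<forall>n. cmod (f n) \<le> K * q ^ n"
proof -
  obtain c where c: "c > 0" "\<forall>\<^sub>F n in sequentially. norm (f n) \<le> c * norm (complex_of_real (q ^ n))"
    using assms(1) by (rule landau_o.bigE)
  then obtain N where N: "\<And>n. N \<le> n \<Longrightarrow> cmod (f n) \<le> c * q ^ n"
    using assms(2) by (auto simp: eventually_sequentially norm_power)
  have "cmod (f n) \<le> (c + (\<Sum>k<N. cmod (f k) / q ^ k)) * q ^ n" for n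
  proof (cases "N \<le> n")
    case True
    have "c * q ^ n \<le> (c + (\<Sum>k<N. cmod (f k) / q ^ k)) * q ^ n"
      using assms(2) by (intro mult_right_mono) (auto intro!: sum_nonneg)
    then show ?thesis using N[OF True] by linarith
  next
    case False
    have "cmod (f n) / q ^ n \<le> (\<Sum>k<N. cmod (f k) / q ^ k)"
      using False assms(2) by (intro member_le_sum) auto
    then have "cmod (f n) / q ^ n \<le> c + (\<Sum>k<N. cmod (f k) / q ^ k)" using c(1) by linarith
    then show ?thesis using assms(2) by (simp add: divide_le_eq)
  qed
  then show ?thesis by blast
qed

theorem theorem4p3:
  fixes \<mu> \<mu>s :: "complex measure" and w :: "real \<Rightarrow> real"
    and C :: complex and b \<Delta> :: real
  assumes "nontrivial_circle_prob \<mu>"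
    and "circle_decomposition \<mu> w \<mu>s"
    and "C \<noteq> 0" and "0 < b" "b < 1" and "0 < \<Delta>" "\<Delta> < 1"
    and "(\<lambda>n. verblunsky \<mu> n - C * complex_of_real (b ^ n)) \<in> O(\<lambda>n. complex_of_real ((b * \<Delta>) ^ n))"
  shows "finite (nevai_totik_points w b) \<and>
    (let NT = nevai_totik_points w b; J = nevai_totik_number w b in
      \<exists>(z :: nat \<Rightarrow> nat \<Rightarrow> complex) (\<theta> :: nat \<Rightarrow> nat \<Rightarrow> real).
        (\<forall>\<^sub>F \<delta> in at_right 0. \<forall>\<^sub>F n in sequentially.
           (\<forall>p\<in>NT. size {# x \<in># proots (OPUC \<mu> n). x \<in> ball p \<delta> #} = nevai_totik_mult w b p) \<and>
           J \<le> n \<and>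
           {# x \<in># proots (OPUC \<mu> n). x \<notin> (\<Union>p\<in>NT. ball p \<delta>) #}
             = image_mset (z n) (mset_set {1..n - J})) \<and>
        (\<forall>\<^sub>F n in sequentially.
           (\<forall>j\<in>{1..n - J}. z n j = complex_of_real (cmod (z n j)) * cis (\<theta> n j)) \<and>
           \<theta> n 0 = 0 \<and> \<theta> n (n - J + 1) = 2 * pi \<and>
           (\<forall>j\<in>{0..n - J}. \<theta> n j < \<theta> n (j + 1))) \<and>
        (\<lambda>n. SUP j\<in>{1..n - J}. \<bar>cmod (z n j) - b\<bar>) \<in> O(\<lambda>n. ln (real n) / real n) \<and>
        (\<lambda>n. SUP j\<in>{0..n - J}. real n * \<bar>\<theta> n (j + 1) - \<theta> n j - 2 * pi / real n\<bar>)
          \<longlonglongrightarrow> 0 \<and>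
        (\<lambda>n. SUP j\<in>{1..n - J - 1}. \<bar>cmod (z n (j + 1)) / cmod (z n j) - 1\<bar>)
          \<in> O(\<lambda>n. 1 / (real n * ln (real n))))"
proof -
  interpret circle_prob \<mu> by standard (rule assms(1))
  interpret geometric_verblunsky "verblunsky \<mu>" C b \<Delta>
  proof
    show "\<exists>K. \<forall>n. cmod (verblunsky \<mu> n - C * of_real (b ^ n)) \<le> K * (b * \<Delta>) ^ n"
      using assms(4,6) by (intro geometric_bound_everywhere[OF assms(8)]) simp
  qed (use assms verblunsky_lt_1 in auto)
  interpret circle_prob_geometric \<mu> C b \<Delta> ..
  obtain \<eta> where \<eta>: "0 < \<eta>" "max \<Delta> b * exp (2 * \<eta>) < 1"
    "\<And>z. \<lbrakk>b * exp (- \<eta>) < cmod z; cmod z < b * exp \<eta>; H z = 0\<rbrakk> \<Longrightarrow> cmod z = b"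
    by (rule strip_exists) blast
  interpret geometric_strip "verblunsky \<mu>" C b \<Delta> \<eta> by standard (use \<eta> in auto)
  have NTeq: "nevai_totik_points w b = NT"
    using N_inf_pos szego_inv_reflected_eq[OF assms(2)] by (auto simp: nevai_totik_points_def NT_def)
  \<comment> \<open>The functions agree up to a constant only outside the closed disk of radius
    \<open>b\<close>; this is a neighbourhood of \<open>p\<close>, which is all the order depends
    on.\<close>
  have mult: "nevai_totik_mult w b p = nat (zorder F p)" if p: "p \<in> NT" for p
  proof -
    have "p \<in> {z. b < cmod z}" using p by (simp add: NT_def)
    then have "\<forall>\<^sub>F z in at p. b < cmod z"
      using eventually_at_in_open'[OF open_exterior] by simp
    then have "\<forall>\<^sub>F z in at p. szego_inv_reflected w b z = of_real (1 / sqrt N_inf) * F z"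
      by eventually_elim (rule szego_inv_reflected_eq[OF assms(2)])
    then have "zorder (szego_inv_reflected w b) p = zorder (\<lambda>z. of_real (1 / sqrt N_inf) * F z) p"
      by (rule zorder_cong) simp
    also have "\<dots> = zorder F p" using N_inf_pos by (intro zorder_cmult) simp
    finally show ?thesis by (simp add: nevai_totik_mult_def)
  qed
  define J where "J = nevai_totik_number w b"
  have Jsum: "J = (\<Sum>p\<in>NT. nat (zorder F p))" unfolding J_def nevai_totik_number_def NTeq by (simp add: mult)
  obtain \<delta>0 where \<delta>0: "\<delta>0 > 0" and sep: "\<And>p q. \<lbrakk>p \<in> NT; q \<in> NT; p \<noteq> q\<rbrakk> \<Longrightarrow> 2 * \<delta>0 \<le> dist p q"
    and out: "\<And>p z. \<lbrakk>p \<in> NT; z \<in> ball p \<delta>0\<rbrakk> \<Longrightarrow> b * exp (\<eta> / 4) < cmod z"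
    by (rule NT_isolation) blast
  \<comment> \<open>The enumeration is fixed before \<delta> is chosen, since
    \<open>ring_zeros\<close> does not depend on \<delta>.\<close>
  obtain K z \<theta> where K: "K > 0"
    and enum: "\<forall>\<^sub>F n in sequentially. angular_enumeration n (card (ring_zeros n)) (K * ln n / n) (K / ln n) (z n) (\<theta> n)"
    by (rule ring_zeros_eventually)
  note good = enum[unfolded angular_enumeration_def]
  have count: "\<forall>\<^sub>F n in sequentially. (\<forall>p\<in>NT. size {# x \<in># proots (\<Phi> n). x \<in> ball p \<delta> #} = nat (zorder F p)) \<and>
       card (ring_zeros n) + J = n \<and>
       {# x \<in># proots (\<Phi> n). x \<notin> (\<Union>p\<in>NT. ball p \<delta>) #} = mset_set (ring_zeros n)"
    if \<delta>: "0 < \<delta>" "\<delta> < \<delta>0" for \<delta>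
  proof -
    have "\<forall>\<^sub>F n in sequentially. (\<forall>p\<in>NT. int (size {# x \<in># proots (\<Phi> n). x \<in> ball p \<delta> #}) = zorder F p) \<and>
       (\<forall>x. poly (\<Phi> n) x = 0 \<longrightarrow> x \<notin> (\<Union>p\<in>NT. ball p \<delta>) \<longrightarrow> cmod x < b * exp (\<eta> / 4))"
      by (rule hurwitz_count[OF \<delta>]) (use sep out in auto)
    then show ?thesis using good
    proof eventually_elim
      case (elim n)
      have sz: "size {# x \<in># proots (\<Phi> n). x \<in> ball p \<delta> #} = nat (zorder F p)" if "p \<in> NT" for p
        using elim(1) that by (metis nat_int)
      have filt: "{# x \<in># proots (\<Phi> n). x \<notin> (\<Union>p\<in>NT. ball p \<delta>) #} = mset_set (ring_zeros n)"
      proof (rule filter_outside_eq)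
        show "b * exp (\<eta> / 4) < cmod x" if "p \<in> NT" "x \<in> ball p \<delta>" for p x
          using out[of p x] that \<delta> by auto
        show "cmod x < b * exp (\<eta> / 4)" if "poly (\<Phi> n) x = 0" "x \<notin> (\<Union>p\<in>NT. ball p \<delta>)" for x
          using elim(1) that by blast
        show "order x (\<Phi> n) = 1" if "x \<in> ring_zeros n" for x
        proof -
          have "x \<in> z n ` {1..card (ring_zeros n)}" using elim(2) that by (simp add: bij_betw_def)
          then show ?thesis using elim(2) by blast
        qed
      qed
      have "card (ring_zeros n) + (\<Sum>p\<in>NT. size {# x \<in># proots (\<Phi> n). x \<in> ball p \<delta> #}) = n"
        by (rule card_ring_zeros[OF \<delta>(2) _ filt]) (rule sep)
      moreover have "(\<Sum>p\<in>NT. size {# x \<in># proots (\<Phi> n). x \<in> ball p \<delta> #}) = J"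
        unfolding Jsum by (intro sum.cong refl sz)
      ultimately have "card (ring_zeros n) + J = n" by simp
      then show ?case using sz filt by blast
    qed
  qed
  \<comment> \<open>The statement is free of \<delta>, so one admissible value suffices.\<close>
  have card: "\<forall>\<^sub>F n in sequentially. J \<le> n \<and> card (ring_zeros n) = n - J"
    using count[of "\<delta>0 / 2"] \<delta>0 by (auto elim!: eventually_mono)
  \<comment> \<open>The bounds 1 / 2 admit the linear estimate for the exponential, and
    \<open>J + 2 \<le> n\<close> makes all index sets of the suprema nonempty.\<close>
  have large: "\<forall>\<^sub>F n in sequentially. 1 < ln (real n) \<and> K * ln n / n \<le> 1 / 2 \<and> K / (n * ln n) \<le> 1 / 2 \<and> J + 2 \<le> n"
  proof (intro eventually_conj)
    show "\<forall>\<^sub>F n in sequentially. 1 < ln (real n)" by real_asymp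
    have "(\<lambda>n. K * ln (real n) / n) \<longlonglongrightarrow> 0" by real_asymp
    then have "\<forall>\<^sub>F n in sequentially. K * ln (real n) / n < 1 / 2" by (rule order_tendstoD) simp
    then show "\<forall>\<^sub>F n in sequentially. K * ln (real n) / n \<le> 1 / 2" by (auto elim: eventually_mono)
    have "(\<lambda>n. K / (n * ln (real n))) \<longlonglongrightarrow> 0" by real_asymp
    then have "\<forall>\<^sub>F n in sequentially. K / (n * ln (real n)) < 1 / 2" by (rule order_tendstoD) simp
    then show "\<forall>\<^sub>F n in sequentially. K / (real n * ln (real n)) \<le> 1 / 2" by (auto elim: eventually_mono)
    show "\<forall>\<^sub>F n in sequentially. J + 2 \<le> n" by (rule eventually_ge_at_top)
  qed
  have fin: "finite (nevai_totik_points w b)" unfolding NTeq by (rule finite_NT)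
  have c1: "\<forall>\<^sub>F \<delta> in at_right 0. \<forall>\<^sub>F n in sequentially.
           (\<forall>p\<in>nevai_totik_points w b. size {# x \<in># proots (OPUC \<mu> n). x \<in> ball p \<delta> #} = nevai_totik_mult w b p) \<and>
           J \<le> n \<and>
           {# x \<in># proots (OPUC \<mu> n). x \<notin> (\<Union>p\<in>nevai_totik_points w b. ball p \<delta>) #}
             = image_mset (z n) (mset_set {1..n - J})"
  proof -
    have "\<forall>\<^sub>F \<delta> in at_right 0. 0 < \<delta> \<and> \<delta> < \<delta>0"
      using \<delta>0 by (auto simp: eventually_at_right_field)
    then show ?thesis
    proof eventually_elim
      case (elim \<delta>)
      have "\<forall>\<^sub>F n in sequentially. (\<forall>p\<in>NT. size {# x \<in># proots (\<Phi> n). x \<in> ball p \<delta> #} = nat (zorder F p)) \<and>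
         card (ring_zeros n) + J = n \<and>
         {# x \<in># proots (\<Phi> n). x \<notin> (\<Union>p\<in>NT. ball p \<delta>) #} = mset_set (ring_zeros n)"
        using elim by (intro count) auto
      then show ?case using good
      proof eventually_elim
        case (elim n)
        have "n - J = card (ring_zeros n)" using elim(1) by linarith
        then have "bij_betw (z n) {1..n - J} (ring_zeros n)" using elim(2) by simp
        then have "image_mset (z n) (mset_set {1..n - J}) = mset_set (ring_zeros n)"
          by (simp add: bij_betw_def image_mset_mset_set)
        then show ?case using elim(1) unfolding NTeq OPUC_eq_szego by (auto simp: mult)
      qed
    qed
  qed
  have c2: "\<forall>\<^sub>F n in sequentially.
           (\<forall>j\<in>{1..n - J}. z n j = complex_of_real (cmod (z n j)) * cis (\<theta> n j)) \<and>
           \<theta> n 0 = 0 \<and> \<theta> n (n - J + 1) = 2 * pi \<and>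
           (\<forall>j\<in>{0..n - J}. \<theta> n j < \<theta> n (j + 1))"
    using good card by eventually_elim auto
  have c3: "(\<lambda>n. SUP j\<in>{1..n - J}. \<bar>cmod (z n j) - b\<bar>) \<in> O(\<lambda>n. ln (real n) / real n)"
  \<comment> \<open>The factor 2 is that of the linear estimate for the exponential,
    \<open>b\<close> comes from \<open>|z| = b * exp (ln (|z| / b))\<close>.\<close>
  proof (rule landau_o.bigI[of "2 * b * K"])
    show "\<forall>\<^sub>F n in sequentially. norm (SUP j\<in>{1..n - J}. \<bar>cmod (z n j) - b\<bar>) \<le> 2 * b * K * norm (ln (real n) / real n)"
      using good card large
    proof eventually_elim
      case (elim n)
      have "\<bar>SUP j\<in>{1..n - J}. \<bar>cmod (z n j) - b\<bar>\<bar> \<le> 2 * b * (K * ln n / n)"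
      proof (rule abs_SUP_le)
        fix j assume "j \<in> {1..n - J}"
        then have "0 < cmod (z n j)" and t: "\<bar>ln (cmod (z n j) / b)\<bar> \<le> K * ln n / n" using elim(1,2) by auto
        then have "cmod (z n j) = b * exp (ln (cmod (z n j) / b))" using b by simp
        then have "\<bar>cmod (z n j) - b\<bar> = b * \<bar>exp (ln (cmod (z n j) / b)) - 1\<bar>"
          using b by (metis abs_mult abs_of_pos mult.right_neutral right_diff_distrib)
        also have "\<dots> \<le> b * (2 * \<bar>ln (cmod (z n j) / b)\<bar>)"
        proof (intro mult_left_mono abs_exp_minus_one_le)
          show "\<bar>ln (cmod (z n j) / b)\<bar> \<le> 1 / 2" using t elim(3) by linarith
        qed (use b in simp)
        also have "\<dots> \<le> b * (2 * (K * ln n / n))" using b t by (intro mult_left_mono) auto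
        also have "\<dots> = 2 * b * (K * ln n / n)" by (simp only: mult_ac)
        finally show "\<bar>cmod (z n j) - b\<bar> \<le> 2 * b * (K * ln n / n)" .
      qed (use elim(3) in auto)
      then show ?case using elim(3) by simp
    qed
  qed (use b K in simp)
  have c4: "(\<lambda>n. SUP j\<in>{0..n - J}. real n * \<bar>\<theta> n (j + 1) - \<theta> n j - 2 * pi / real n\<bar>) \<longlonglongrightarrow> 0"
  proof (rule Lim_null_comparison)
    show "\<forall>\<^sub>F n in sequentially. norm (SUP j\<in>{0..n - J}. real n * \<bar>\<theta> n (j + 1) - \<theta> n j - 2 * pi / real n\<bar>) \<le> K / ln n"
      using good card large
    proof eventually_elim
      case (elim n)
      have n: "0 < real n" using elim(3) by linarith
      show ?case unfolding real_norm_def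
      proof (rule abs_SUP_le)
        fix j assume "j \<in> {0..n - J}"
        then have "\<bar>n * (\<theta> n (j + 1) - \<theta> n j) - 2 * pi\<bar> \<le> K / ln n" using elim(1,2) by auto
        moreover have "n * (\<theta> n (j + 1) - \<theta> n j) - 2 * pi = real n * (\<theta> n (j + 1) - \<theta> n j - 2 * pi / real n)"
          using n by (simp add: right_diff_distrib)
        ultimately show "real n * \<bar>\<theta> n (j + 1) - \<theta> n j - 2 * pi / real n\<bar> \<le> K / ln n"
          using n by (simp add: abs_mult)
      qed auto
    qed
    show "(\<lambda>n. K / ln (real n)) \<longlonglongrightarrow> 0" by real_asymp
  qed
  have c5: "(\<lambda>n. SUP j\<in>{1..n - J - 1}. \<bar>cmod (z n (j + 1)) / cmod (z n j) - 1\<bar>) \<in> O(\<lambda>n. 1 / (real n * ln (real n)))"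
  proof (rule landau_o.bigI[of "2 * K"])
    show "\<forall>\<^sub>F n in sequentially. norm (SUP j\<in>{1..n - J - 1}. \<bar>cmod (z n (j + 1)) / cmod (z n j) - 1\<bar>) \<le> 2 * K * norm (1 / (real n * ln (real n)))"
      using good card large
    proof eventually_elim
      case (elim n)
      have n: "0 < real n" using elim(3) by linarith
      have "\<bar>SUP j\<in>{1..n - J - 1}. \<bar>cmod (z n (j + 1)) / cmod (z n j) - 1\<bar>\<bar> \<le> 2 * (K / (n * ln n))"
      proof (rule abs_SUP_le)
        fix j assume j: "j \<in> {1..n - J - 1}"
        then have p: "0 < cmod (z n j)" "0 < cmod (z n (j + 1))" using elim(1,2) by auto
        define t where "t = ln (cmod (z n (j + 1)) / b) - ln (cmod (z n j) / b)"
        have "n * \<bar>t\<bar> \<le> K / ln n" using elim(1,2) j unfolding t_def by auto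
        then have t: "\<bar>t\<bar> \<le> K / (n * ln n)" using n elim(3) by (simp add: field_simps)
        have "exp t = cmod (z n (j + 1)) / cmod (z n j)" using p b by (simp add: t_def exp_diff)
        then have "\<bar>cmod (z n (j + 1)) / cmod (z n j) - 1\<bar> = \<bar>exp t - 1\<bar>" by simp
        also have "\<dots> \<le> 2 * \<bar>t\<bar>" using t elim(3) by (intro abs_exp_minus_one_le) linarith
        finally show "\<bar>cmod (z n (j + 1)) / cmod (z n j) - 1\<bar> \<le> 2 * (K / (n * ln n))" using t by linarith
      qed (use elim(3) in auto)
      then show ?case using n elim(3) by simp
    qed
  qed (use K in simp)
  show ?thesis unfolding Let_def J_def[symmetric]
    using fin c1 c2 c3 c4 c5 by blast
qed

end
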